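(* Let $f:\mathbb{S}^3\to\mathbb{S}^2$ be a non-constant harmonic map between the unit spheres equipped with their standard round metrics. If the energy density $|df|^2$ is constant on $\mathbb{S}^3$, or if the $2$-dilation $\operatorname{D}_2=\lambda_1\lambda_2$ is constant on $\mathbb{S}^3$, then $f$ is a Hopf fibration.
   Context: $\mathbb{S}^3\subset\mathbb{R}^4$ and $\mathbb{S}^2\subset\mathbb{R}^3$ are the unit spheres with round metrics and Levi-Civita connections $\nabla$. A smooth map $f:\mathbb{S}^3\to\mathbb{S}^2$ is harmonic if its tension field, i.e. the trace of the Hessian $B(X,Y)=\nabla_X\,df(Y)-df(\nabla_XY)$ (the first $\nabla$ being the pull-back connection on $f^*T\mathbb{S}^2$), vanishes identically. The singular values $\lambda_1\ge\lambda_2\ge\lambda_3=0$ of $df$ at a point are the eigenvalues of $(df^*df)^{1/2}$, where $df^*$ is the transpose of $df$ with respect to the metrics. The $2$-dilation is $\operatorname{D}_2=\lambda_1\lambda_2$ and the energy density is $|df|^2=\lambda_1^2+\lambda_2^2$. A Hopf fibration $\mathbb{S}^3\to\mathbb{S}^2$ is any map obtained from $\pi_0(x_0,x_1,x_2,x_3)=(x_0^2+x_1^2-x_2^2-x_3^2,\;2(x_0x_2+x_1x_3),\;2(x_0x_3-x_1x_2))$ by composing with isometries of $\mathbb{S}^3$ and of $\mathbb{S}^2$. *)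

theory Defs
  imports "HOL-Analysis.Analysis"
begin

abbreviation usphere :: "'a::euclidean_space set" where
  "usphere \<equiv> sphere 0 1"

text \<open>Smoothness on an open set: continuity of all iterated directional derivatives.\<close>

primrec Ck_on :: "nat \<Rightarrow> 'a::euclidean_space set \<Rightarrow> ('a \<Rightarrow> 'b::euclidean_space) \<Rightarrow> bool" where
  "Ck_on 0 U f \<longleftrightarrow> continuous_on U f"
| "Ck_on (Suc k) U f \<longleftrightarrow> (\<forall>x\<in>U. f differentiable (at x)) \<and>
     (\<forall>v. Ck_on k U (\<lambda>x. frechet_derivative f (at x) v))"

text \<open>Since the sphere is an embedded submanifold, a map on it is smooth iff it extends locally to
  smooth maps on open subsets of the ambient space. Only the values of \<open>f\<close> on the sphere matter,
  here and below.\<close>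

definition smooth_on_sphere :: "('a::euclidean_space \<Rightarrow> 'b::euclidean_space) \<Rightarrow> bool" where
  "smooth_on_sphere f \<longleftrightarrow> (\<forall>p\<in>usphere. \<exists>U F. open U \<and> p \<in> U \<and>
     (\<forall>k. Ck_on k U F) \<and> (\<forall>x\<in>U \<inter> usphere. F x = f x))"

definition tangent_space :: "'a::euclidean_space \<Rightarrow> 'a set" where
  "tangent_space p = {v. v \<bullet> p = 0}"

definition tangent_proj :: "'a::euclidean_space \<Rightarrow> 'a \<Rightarrow> 'a" where
  "tangent_proj p v = v - (v \<bullet> p) *\<^sub>R p"

text \<open>A derivative at \<open>p\<close> within the sphere is determined on the tangent space at \<open>p\<close> only.
  The differential is made into a linear map on the whole ambient space by letting it vanish on the
  normal line; this makes the library's \<^const>\<open>adjoint\<close>, restricted to the tangent space at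
  \<open>f p\<close>, the transpose of the differential with respect to the round metrics.\<close>

definition differential ::
    "('a::euclidean_space \<Rightarrow> 'b::euclidean_space) \<Rightarrow> 'a \<Rightarrow> 'a \<Rightarrow> 'b" where
  "differential f p v = frechet_derivative f (at p within usphere) (tangent_proj p v)"

definition vector_field :: "('a::euclidean_space \<Rightarrow> 'a) \<Rightarrow> bool" where
  "vector_field X \<longleftrightarrow> smooth_on_sphere X \<and> (\<forall>p\<in>usphere. X p \<in> tangent_space p)"

text \<open>The Levi-Civita connection of the round metric is the tangential part of the ambient
  derivative. Correspondingly, for a section \<open>V\<close> of the pull-back of the tangent bundle of the target
  sphere, \<open>V p \<in> tangent_space (f p)\<close>, the pull-back connection is the part of the ambient
  derivative tangent to the target sphere at \<open>f p\<close>.\<close>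

definition levi_civita :: "('a::euclidean_space \<Rightarrow> 'a) \<Rightarrow> ('a \<Rightarrow> 'a) \<Rightarrow> 'a \<Rightarrow> 'a" where
  "levi_civita X Y p = tangent_proj p (differential Y p (X p))"

definition pullback_connection ::
    "('a::euclidean_space \<Rightarrow> 'b::euclidean_space) \<Rightarrow> ('a \<Rightarrow> 'a) \<Rightarrow> ('a \<Rightarrow> 'b) \<Rightarrow> 'a \<Rightarrow> 'b" where
  "pullback_connection f X V p = tangent_proj (f p) (differential V p (X p))"

definition hessian ::
    "('a::euclidean_space \<Rightarrow> 'b::euclidean_space) \<Rightarrow> ('a \<Rightarrow> 'a) \<Rightarrow> ('a \<Rightarrow> 'a) \<Rightarrow> 'a \<Rightarrow> 'b" where
  "hessian f X Y p = pullback_connection f X (\<lambda>q. differential f q (Y q)) p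
                      - differential f p (levi_civita X Y p)"

definition orthonormal_basis_at :: "real^4 \<Rightarrow> (3 \<Rightarrow> real^4) \<Rightarrow> bool" where
  "orthonormal_basis_at p e \<longleftrightarrow> (\<forall>i. e i \<in> tangent_space p) \<and>
     (\<forall>i j. e i \<bullet> e j = (if i = j then 1 else 0))"

text \<open>The trace of the Hessian at \<open>p\<close>, computed with vector fields \<open>E 1\<close>, \<open>E 2\<close>, \<open>E 3\<close> that are
  orthonormal at \<open>p\<close>. As the Hessian is tensorial, the value does not depend on the choice of \<open>E\<close>.\<close>

definition tension_field ::
    "(real^4 \<Rightarrow> real^3) \<Rightarrow> (3 \<Rightarrow> real^4 \<Rightarrow> real^4) \<Rightarrow> real^4 \<Rightarrow> real^3" where
  "tension_field f E p = (\<Sum>i\<in>UNIV. hessian f (E i) (E i) p)"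

definition harmonic :: "(real^4 \<Rightarrow> real^3) \<Rightarrow> bool" where
  "harmonic f \<longleftrightarrow> f \<in> usphere \<rightarrow> usphere \<and> smooth_on_sphere f \<and>
     (\<forall>p\<in>usphere. \<forall>E. (\<forall>i. vector_field (E i)) \<and> orthonormal_basis_at p (\<lambda>i. E i p)
        \<longrightarrow> tension_field f E p = 0)"

text \<open>\<open>R\<close> is the positive semidefinite square root of the composition of the transpose of the
  differential with the differential, as an operator on the tangent space at \<open>p\<close>.\<close>

definition is_sqrt_at :: "(real^4 \<Rightarrow> real^3) \<Rightarrow> real^4 \<Rightarrow> (real^4 \<Rightarrow> real^4) \<Rightarrow> bool" where
  "is_sqrt_at f p R \<longleftrightarrow> linear R \<and>
     (\<forall>v\<in>tangent_space p. R v \<in> tangent_space p \<and> 0 \<le> R v \<bullet> v \<and>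
        R (R v) = adjoint (differential f p) (differential f p v)) \<and>
     (\<forall>v\<in>tangent_space p. \<forall>w\<in>tangent_space p. R v \<bullet> w = v \<bullet> R w)"

text \<open>The eigenvalues of this square root, in decreasing order and with multiplicity.\<close>

definition singular_values :: "(real^4 \<Rightarrow> real^3) \<Rightarrow> real^4 \<Rightarrow> real^3" where
  "singular_values f p = (THE l. l $ 1 \<ge> l $ 2 \<and> l $ 2 \<ge> l $ 3 \<and>
     (\<exists>R e. is_sqrt_at f p R \<and> orthonormal_basis_at p e \<and> (\<forall>i. R (e i) = (l $ i) *\<^sub>R e i)))"

definition two_dilation :: "(real^4 \<Rightarrow> real^3) \<Rightarrow> real^4 \<Rightarrow> real" where
  "two_dilation f p = singular_values f p $ 1 * singular_values f p $ 2"

definition energy_density :: "(real^4 \<Rightarrow> real^3) \<Rightarrow> real^4 \<Rightarrow> real" where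
  "energy_density f p = (singular_values f p $ 1)\<^sup>2 + (singular_values f p $ 2)\<^sup>2"

text \<open>Riemannian isometries of the round sphere.\<close>

definition sphere_isometry :: "('a::euclidean_space \<Rightarrow> 'a) \<Rightarrow> bool" where
  "sphere_isometry \<phi> \<longleftrightarrow> bij_betw \<phi> usphere usphere \<and>
     smooth_on_sphere \<phi> \<and> smooth_on_sphere (inv_into usphere \<phi>) \<and>
     (\<forall>p\<in>usphere. \<forall>v\<in>tangent_space p. \<forall>w\<in>tangent_space p.
        differential \<phi> p v \<bullet> differential \<phi> p w = v \<bullet> w)"

text \<open>The coordinates \<open>x\<^sub>0, \<dots>, x\<^sub>3\<close> are \<open>x $ 1, \<dots>, x $ 4\<close>.\<close>

definition hopf_map :: "real^4 \<Rightarrow> real^3" where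
  "hopf_map x = vector
     [(x $ 1)\<^sup>2 + (x $ 2)\<^sup>2 - (x $ 3)\<^sup>2 - (x $ 4)\<^sup>2,
      2 * (x $ 1 * x $ 3 + x $ 2 * x $ 4),
      2 * (x $ 1 * x $ 4 - x $ 2 * x $ 3)]"

definition hopf_fibration :: "(real^4 \<Rightarrow> real^3) \<Rightarrow> bool" where
  "hopf_fibration f \<longleftrightarrow> (\<exists>\<phi> \<psi>. sphere_isometry \<phi> \<and> sphere_isometry \<psi> \<and>
     (\<forall>x\<in>usphere. f x = \<psi> (hopf_map (\<phi> x))))"

end

theory Submission
  imports Defs
begin

text \<open>Let \<open>F\<close> be the extension of \<open>f\<close> to \<open>\<real>\<^sup>4 - {0}\<close> that is constant on rays. For such an extension
  the curved geometry disappears: \<open>f\<close> is harmonic exactly if \<open>\<Delta>F = -|DF|\<^sup>2 F\<close> holds for the flat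
  Laplacian, and derivatives along the sphere are derivatives of \<open>F\<close> along great circles. All
  computations are done with directional derivatives of \<open>F\<close> in constant directions, which commute.

  At each point \<open>p\<close> of the sphere there is an orthonormal tangent basis in which the differential is
  diagonal: \<open>e\<^sub>3\<close> spans (part of) its kernel, and \<open>e\<^sub>1\<close>, \<open>e\<^sub>2\<close> have orthogonal images, of lengths
  \<open>a \<ge> b \<ge> 0\<close>. These are the singular values. They need not be smooth functions of the point, but
  the traces \<open>E = a\<^sup>2 + b\<^sup>2\<close> and \<open>Q = a\<^sup>4 + b\<^sup>4\<close> are, and so is \<open>v = 2 Q - E\<^sup>2 = (a\<^sup>2 - b\<^sup>2)\<^sup>2\<close>, which
  measures by how much \<open>f\<close> fails to be horizontally conformal. The theorem rests on two facts.

  First, \<open>a\<close> and \<open>b\<close> are equal, and constant (\<open>constant_dilation\<close>). If \<open>a\<^sup>2 + b\<^sup>2\<close> or \<open>a b\<close> is constant,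
  then at a maximum of \<open>v\<close> both \<open>E\<close> and \<open>Q\<close> have vanishing gradient. If \<open>a > b > 0\<close> there, this kills
  so many entries of the Hessian that the Laplacian of \<open>v\<close> along the sphere is \<open>8 v\<close> plus a sum of
  squares (\<open>critical_laplacian\<close>); it would be positive at a maximum, so \<open>v\<close> vanishes identically. That
  \<open>b\<close> has no zero follows from the Bochner formula for \<open>E\<close>: when \<open>E\<close> is constant directly, and when
  \<open>a b\<close> vanishes identically because \<open>E\<close> would then have to vanish at its maximum.

  Secondly, a harmonic map with \<open>a = b = l\<close> is the Hopf map up to isometries. Differentiating the
  conformality relation and using the Bochner formula once more leaves a single free entry \<open>s\<close> of
  the tangential Hessian at a point, with \<open>2 s\<^sup>2 = l\<^sup>4 - 2 l\<^sup>2\<close> (\<open>hessian_components\<close>, \<open>s_square\<close>). So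
  along a great circle \<open>c\<close> the curve \<open>g = F \<circ> c\<close> has constant speed and constant
  geodesic curvature, which means that it solves \<open>g''' = -w\<^sup>2 g'\<close> with a frequency \<open>w\<close> that is an
  explicit function of the speed (\<open>helix_equation\<close>). A great circle closes up after the time \<open>2\<pi>\<close>,
  so \<open>w\<close> is an integer whenever the speed is not zero. But \<open>w\<close> changes continuously with the direction
  of the great circle unless \<open>l = 2\<close>, and in that case \<open>w = 2\<close> (\<open>dilation_eq_2\<close>). Hence \<open>F\<close> is a
  trigonometric polynomial of degree two along each great circle through \<open>p\<close>. It is determined by its
  first two derivatives at \<open>p\<close> (\<open>quadratic_formula\<close>), and these give the Hopf map in the coordinates
  of the basis \<open>p, e\<^sub>1, e\<^sub>2, e\<^sub>3\<close> (\<open>hopf_form\<close>).\<close>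

section \<open>Smooth maps on open sets\<close>

definition dir_deriv :: "'a::euclidean_space \<Rightarrow> ('a \<Rightarrow> 'b::euclidean_space) \<Rightarrow> 'a \<Rightarrow> 'b" ("\<partial>") where
  "\<partial> v f = (\<lambda>x. frechet_derivative f (at x) v)"

definition smooth :: "'a::euclidean_space set \<Rightarrow> ('a \<Rightarrow> 'b::euclidean_space) \<Rightarrow> bool" where
  "smooth U f \<longleftrightarrow> (\<forall>k. Ck_on k U f)"

lemma Ck_on_Suc_iff:
  "Ck_on (Suc k) U f \<longleftrightarrow> (\<forall>x\<in>U. f differentiable (at x)) \<and> (\<forall>v. Ck_on k U (\<partial> v f))"
  by (simp add: dir_deriv_def)

declare Ck_on.simps(2)[simp del]

lemma dir_deriv_eq: "(f has_derivative f') (at x) \<Longrightarrow> \<partial> v f x = f' v"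
  unfolding dir_deriv_def by (simp add: frechet_derivative_at[symmetric])

lemma differentiable_dir_deriv:
  "f differentiable (at x) \<Longrightarrow> (f has_derivative (\<lambda>v. \<partial> v f x)) (at x)"
  unfolding dir_deriv_def by (simp add: frechet_derivative_works)

lemma dir_deriv_cong:
  assumes "open U" "\<And>x. x \<in> U \<Longrightarrow> f x = g x" "x \<in> U"
  shows "\<partial> v f x = \<partial> v g x"
proof -
  have "(f has_derivative f') (at x) \<longleftrightarrow> (g has_derivative f') (at x)" for f'
    using assms has_derivative_transform_within_open by (metis (no_types, lifting))
  then show ?thesis by (simp add: dir_deriv_def frechet_derivative_def)
qed

lemma Ck_on_cong:
  assumes "open U" "\<And>x. x \<in> U \<Longrightarrow> f x = g x" "Ck_on k U f"
  shows "Ck_on k U g"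
  using assms(2,3)
proof (induction k arbitrary: f g)
  case 0
  then show ?case by (simp cong: continuous_on_cong)
next
  case (Suc k)
  have "g differentiable (at x)" if "x \<in> U" for x
    using Suc.prems that \<open>open U\<close> unfolding Ck_on_Suc_iff differentiable_def
    by (metis has_derivative_transform_within_open)
  moreover have "Ck_on k U (\<partial> v g)" for v
  proof (rule Suc.IH)
    show "Ck_on k U (\<partial> v f)" using Suc.prems by (simp add: Ck_on_Suc_iff)
    show "\<partial> v f x = \<partial> v g x" if "x \<in> U" for x
      by (rule dir_deriv_cong[OF \<open>open U\<close> Suc.prems(1) that])
  qed
  ultimately show ?case by (simp add: Ck_on_Suc_iff)
qed

text \<open>Differentiability of class \<open>k + 1\<close> does not mention continuity; it comes from differentiability
  at the bottom of the recursion.\<close>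

lemma Ck_on_SucD: "Ck_on (Suc k) U f \<Longrightarrow> Ck_on k U f"
proof (induction k arbitrary: f)
  case 0
  then show ?case
    by (simp add: Ck_on_Suc_iff continuous_at_imp_continuous_on differentiable_imp_continuous_within)
next
  case (Suc k)
  then show ?case by (simp add: Ck_on_Suc_iff[of k] Ck_on_Suc_iff[of "Suc k"])
qed

lemma Ck_on_subset: "Ck_on k U f \<Longrightarrow> V \<subseteq> U \<Longrightarrow> Ck_on k V f"
  by (induction k arbitrary: f) (auto simp: Ck_on_Suc_iff intro: continuous_on_subset)

lemma Ck_on_local:
  assumes "\<And>x. x \<in> U \<Longrightarrow> \<exists>V. open V \<and> x \<in> V \<and> Ck_on k V f"
  shows "Ck_on k U f"
  using assms
proof (induction k arbitrary: f)
  case 0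
  have "isCont f x" if "x \<in> U" for x
    using 0[OF that] by (auto simp: continuous_on_eq_continuous_at)
  then show ?case by (simp add: continuous_at_imp_continuous_on)
next
  case (Suc k)
  then show ?case unfolding Ck_on_Suc_iff by meson
qed

lemma Ck_on_const: "Ck_on k U (\<lambda>x. c)"
proof (induction k arbitrary: c)
  case (Suc k)
  have "\<partial> v (\<lambda>x::'a. c) = (\<lambda>x. 0)" for v
    by (rule ext, rule dir_deriv_eq) simp
  then show ?case using Suc by (simp add: Ck_on_Suc_iff)
qed simp

lemma Ck_on_linear:
  assumes "linear L"
  shows "Ck_on k U L"
proof (cases k)
  case 0
  then show ?thesis using assms by (simp add: linear_continuous_on linear_conv_bounded_linear)
next
  case (Suc j)
  have d: "(L has_derivative L) (at x)" for x
    by (simp add: assms bounded_linear_imp_has_derivative linear_conv_bounded_linear[symmetric])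
  then have "\<partial> v L = (\<lambda>x. L v)" for v
    by (intro ext dir_deriv_eq)
  then show ?thesis using Suc d by (auto simp: Ck_on_Suc_iff Ck_on_const differentiable_def)
qed

lemma Ck_on_add:
  assumes "open U" "Ck_on k U f" "Ck_on k U g"
  shows "Ck_on k U (\<lambda>x. f x + g x)"
  using assms(2,3)
proof (induction k arbitrary: f g)
  case 0
  then show ?case by (simp add: continuous_on_add)
next
  case (Suc k)
  have "Ck_on k U (\<partial> v (\<lambda>x. f x + g x))" for v
  proof (rule Ck_on_cong[OF \<open>open U\<close>])
    show "Ck_on k U (\<lambda>x. \<partial> v f x + \<partial> v g x)"
      using Suc by (simp add: Ck_on_Suc_iff)
    show "\<partial> v f x + \<partial> v g x = \<partial> v (\<lambda>x. f x + g x) x" if "x \<in> U" for x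
      using Suc.prems that unfolding Ck_on_Suc_iff
      by (intro dir_deriv_eq[symmetric] has_derivative_add differentiable_dir_deriv) auto
  qed
  then show ?case using Suc.prems by (simp add: Ck_on_Suc_iff)
qed

text \<open>One statement for scalar multiplication, inner products and products of reals: by the Leibniz
  rule a directional derivative of a product is again a sum of two products.\<close>

lemma Ck_on_bilinear:
  fixes prod :: "'b::euclidean_space \<Rightarrow> 'c::euclidean_space \<Rightarrow> 'd::euclidean_space"
  assumes B: "bounded_bilinear prod" and "open U" "Ck_on k U f" "Ck_on k U g"
  shows "Ck_on k U (\<lambda>x. prod (f x) (g x))"
  using assms(3,4)
proof (induction k arbitrary: f g)
  case 0
  then show ?case by (simp add: bounded_bilinear.continuous_on[OF B])
next
  case (Suc k)
  have d: "((\<lambda>x. prod (f x) (g x)) has_derivative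
         (\<lambda>v. prod (f x) (\<partial> v g x) + prod (\<partial> v f x) (g x))) (at x)" if "x \<in> U" for x
    using Suc.prems that unfolding Ck_on_Suc_iff
    by (intro bounded_bilinear.FDERIV[OF B] differentiable_dir_deriv) auto
  have "Ck_on k U (\<partial> v (\<lambda>x. prod (f x) (g x)))" for v
  proof (rule Ck_on_cong[OF \<open>open U\<close>])
    show "Ck_on k U (\<lambda>x. prod (f x) (\<partial> v g x) + prod (\<partial> v f x) (g x))"
      using Suc.prems Suc.IH Ck_on_SucD[OF Suc.prems(1)] Ck_on_SucD[OF Suc.prems(2)]
      by (intro Ck_on_add[OF \<open>open U\<close>]) (auto simp: Ck_on_Suc_iff)
    show "prod (f x) (\<partial> v g x) + prod (\<partial> v f x) (g x) = \<partial> v (\<lambda>x. prod (f x) (g x)) x"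
      if "x \<in> U" for x
      by (rule dir_deriv_eq[OF d[OF that], symmetric])
  qed
  then show ?case using d by (auto simp: Ck_on_Suc_iff differentiable_def)
qed

lemma Ck_on_sum:
  assumes "open U" "finite I" "\<And>i. i \<in> I \<Longrightarrow> Ck_on k U (f i)"
  shows "Ck_on k U (\<lambda>x. \<Sum>i\<in>I. f i x)"
  using assms(2,3) by (induction I) (auto intro: Ck_on_const Ck_on_add[OF \<open>open U\<close>])

text \<open>The chain rule gives \<open>D(f \<circ> h)(x)v = Df(h x)(Dh(x)v)\<close>, where the direction of differentiation of
  \<open>f\<close> depends on \<open>x\<close>. Expanding this direction in the standard basis turns it into a sum of products
  of functions to which the induction hypothesis applies.\<close>

lemma Ck_on_compose:
  fixes h :: "'a::euclidean_space \<Rightarrow> 'b::euclidean_space" and f :: "'b \<Rightarrow> 'c::euclidean_space"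
  assumes "open U" "open V" "h ` V \<subseteq> U" "Ck_on k U f" "Ck_on k V h"
  shows "Ck_on k V (\<lambda>x. f (h x))"
  using assms(4,5)
proof (induction k arbitrary: f)
  case 0
  then show ?case using assms(3) continuous_on_compose2 by fastforce
next
  case (Suc k)
  have d: "((\<lambda>x. f (h x)) has_derivative (\<lambda>v. \<partial> (\<partial> v h x) f (h x))) (at x)" if "x \<in> V" for x
  proof (rule has_derivative_compose[where f = h and f' = "\<lambda>v. \<partial> v h x" and g = f
          and g' = "\<lambda>u. \<partial> u f (h x)"])
    show "(h has_derivative (\<lambda>v. \<partial> v h x)) (at x)"
      using Suc.prems that by (simp add: Ck_on_Suc_iff differentiable_dir_deriv)
    show "(f has_derivative (\<lambda>u. \<partial> u f (h x))) (at (h x))"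
      using Suc.prems that assms(3) by (auto simp add: Ck_on_Suc_iff intro!: differentiable_dir_deriv)
  qed
  have e: "\<partial> u f y = (\<Sum>b\<in>Basis. (u \<bullet> b) *\<^sub>R \<partial> b f y)" if "y \<in> U" for u y
  proof -
    have l: "linear (\<lambda>u. \<partial> u f y)"
      using Suc.prems that differentiable_dir_deriv[of f y] has_derivative_linear
      by (auto simp: Ck_on_Suc_iff)
    have "\<partial> u f y = \<partial> (\<Sum>b\<in>Basis. (u \<bullet> b) *\<^sub>R b) f y" by (simp add: euclidean_representation)
    also have "\<dots> = (\<Sum>b\<in>Basis. (u \<bullet> b) *\<^sub>R \<partial> b f y)"
      by (simp add: linear_sum[OF l] linear_cmul[OF l] del: euclidean_representation)
    finally show ?thesis .
  qed
  have "Ck_on k V (\<partial> v (\<lambda>x. f (h x)))" for v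
  proof (rule Ck_on_cong[OF \<open>open V\<close>])
    show "Ck_on k V (\<lambda>x. \<Sum>b\<in>Basis. (\<partial> v h x \<bullet> b) *\<^sub>R \<partial> b f (h x))"
    proof (intro Ck_on_sum[OF \<open>open V\<close>] Ck_on_bilinear[OF bounded_bilinear_scaleR \<open>open V\<close>]
        Ck_on_bilinear[OF bounded_bilinear_inner \<open>open V\<close>] Ck_on_const finite_Basis)
      show "Ck_on k V (\<partial> v h)" using Suc.prems by (simp add: Ck_on_Suc_iff)
      show "Ck_on k V (\<lambda>x. \<partial> b f (h x))" for b
        using Suc.prems Ck_on_SucD[OF Suc.prems(2)] by (intro Suc.IH) (simp_all add: Ck_on_Suc_iff)
    qed
    show "(\<Sum>b\<in>Basis. (\<partial> v h x \<bullet> b) *\<^sub>R \<partial> b f (h x)) = \<partial> v (\<lambda>x. f (h x)) x" if "x \<in> V" for x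
      using dir_deriv_eq[OF d[OF that], of v] e[of "h x" "\<partial> v h x"] that assms(3) by auto
  qed
  then show ?case using d by (auto simp: Ck_on_Suc_iff differentiable_def)
qed

lemma smooth_dir_deriv: "smooth U f \<Longrightarrow> smooth U (\<partial> v f)"
  unfolding smooth_def using Ck_on_Suc_iff by blast

lemma smooth_differentiable: "smooth U f \<Longrightarrow> x \<in> U \<Longrightarrow> f differentiable (at x)"
  unfolding smooth_def using Ck_on_Suc_iff by blast

lemma smooth_has_derivative: "smooth U f \<Longrightarrow> x \<in> U \<Longrightarrow> (f has_derivative (\<lambda>v. \<partial> v f x)) (at x)"
  by (simp add: differentiable_dir_deriv smooth_differentiable)

lemma smooth_linear_dir_deriv: "smooth U f \<Longrightarrow> x \<in> U \<Longrightarrow> linear (\<lambda>v. \<partial> v f x)"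
  using smooth_has_derivative has_derivative_linear by blast

lemma smooth_continuous_on: "smooth U f \<Longrightarrow> continuous_on U f"
  unfolding smooth_def using Ck_on.simps(1) by blast

lemma smooth_add: "open U \<Longrightarrow> smooth U f \<Longrightarrow> smooth U g \<Longrightarrow> smooth U (\<lambda>x. f x + g x)"
  by (simp add: smooth_def Ck_on_add)

lemma smooth_on_subset: "smooth U f \<Longrightarrow> V \<subseteq> U \<Longrightarrow> smooth V f"
  unfolding smooth_def using Ck_on_subset by blast

lemma smooth_sum:
  "open U \<Longrightarrow> finite I \<Longrightarrow> (\<And>i. i \<in> I \<Longrightarrow> smooth U (f i)) \<Longrightarrow> smooth U (\<lambda>x. \<Sum>i\<in>I. f i x)"
  by (simp add: smooth_def Ck_on_sum)

lemma smooth_bilinear: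
  fixes prod :: "'b::euclidean_space \<Rightarrow> 'c::euclidean_space \<Rightarrow> 'd::euclidean_space"
  shows
  "bounded_bilinear prod \<Longrightarrow> open U \<Longrightarrow> smooth U f \<Longrightarrow> smooth U g \<Longrightarrow> smooth U (\<lambda>x. prod (f x) (g x))"
  by (simp add: smooth_def Ck_on_bilinear)

lemma smooth_linear: "linear L \<Longrightarrow> smooth U L"
  by (simp add: smooth_def Ck_on_linear)

lemma smooth_const: "smooth U (\<lambda>x. c)"
  by (simp add: smooth_def Ck_on_const)

section \<open>Symmetry of second derivatives\<close>

lemma has_derivative_along_line:
  assumes "smooth U f" "a + s *\<^sub>R v \<in> U"
  shows "((\<lambda>s. f (a + s *\<^sub>R v)) has_derivative (\<lambda>t. t *\<^sub>R \<partial> v f (a + s *\<^sub>R v))) (at s)"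
proof -
  have "((\<lambda>s. f (a + s *\<^sub>R v)) has_derivative (\<lambda>t. \<partial> (t *\<^sub>R v) f (a + s *\<^sub>R v))) (at s)"
    by (rule has_derivative_compose[where g = f and f = "\<lambda>s. a + s *\<^sub>R v" and f' = "\<lambda>t. t *\<^sub>R v"
          and g' = "\<lambda>u. \<partial> u f (a + s *\<^sub>R v)"])
       (auto intro!: derivative_eq_intros smooth_has_derivative[OF assms])
  then show ?thesis using linear_cmul[OF smooth_linear_dir_deriv[OF assms]] by simp
qed

text \<open>Applying the mean value theorem first in the direction \<open>v\<close> and then in the direction \<open>w\<close>
  expresses the second difference, which is symmetric in \<open>v\<close> and \<open>w\<close>, by a mixed second derivative
  at a nearby point.\<close>

lemma second_difference_mvt:
  fixes f :: "'a::euclidean_space \<Rightarrow> real"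
  assumes f: "smooth (ball x r) f" and h: "0 < h" "h * (norm v + norm w) < r"
  shows "\<exists>y. dist x y \<le> h * (norm v + norm w) \<and>
     f (x + h *\<^sub>R v + h *\<^sub>R w) - f (x + h *\<^sub>R v) - f (x + h *\<^sub>R w) + f x = h\<^sup>2 * \<partial> w (\<partial> v f) y"
proof -
  have inb: "x + s *\<^sub>R v + t *\<^sub>R w \<in> ball x r"
    and le: "dist x (x + s *\<^sub>R v + t *\<^sub>R w) \<le> h * (norm v + norm w)"
    if "0 \<le> s" "s \<le> h" "0 \<le> t" "t \<le> h" for s t
  proof -
    have "dist x (x + s *\<^sub>R v + t *\<^sub>R w) = norm (s *\<^sub>R v + t *\<^sub>R w)"
      by (metis add.assoc dist_0_norm dist_add_cancel add.right_neutral)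
    also have "\<dots> \<le> s * norm v + t * norm w"
      using norm_triangle_ineq[of "s *\<^sub>R v" "t *\<^sub>R w"] that by simp
    also have "\<dots> \<le> h * (norm v + norm w)"
      using that by (simp add: distrib_left add_mono mult_right_mono)
    finally show "dist x (x + s *\<^sub>R v + t *\<^sub>R w) \<le> h * (norm v + norm w)" .
    then show "x + s *\<^sub>R v + t *\<^sub>R w \<in> ball x r" using h by simp
  qed
  define u where "u s = f (x + s *\<^sub>R v + h *\<^sub>R w) - f (x + s *\<^sub>R v)" for s
  have "(u has_real_derivative \<partial> v f (x + s *\<^sub>R v + h *\<^sub>R w) - \<partial> v f (x + s *\<^sub>R v)) (at s)"
    if "0 \<le> s" "s \<le> h" for s
  proof -
    have a: "((\<lambda>s. f (x + s *\<^sub>R v + c)) has_derivative (\<lambda>t. t *\<^sub>R \<partial> v f (x + s *\<^sub>R v + c))) (at s)"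
      if "x + s *\<^sub>R v + c \<in> ball x r" for c
      using has_derivative_along_line[OF f, of "x + c" s v] that by (simp add: add_ac)
    show ?thesis
      unfolding u_def has_field_derivative_def
      by (rule has_derivative_eq_rhs[OF has_derivative_diff[OF a[of "h *\<^sub>R w"] a[of 0, simplified]]])
         (use inb[of s h] inb[of s 0] that h in \<open>auto simp: algebra_simps\<close>)
  qed
  then obtain s where s: "0 < s" "s < h"
      "u h - u 0 = (h - 0) * (\<partial> v f (x + s *\<^sub>R v + h *\<^sub>R w) - \<partial> v f (x + s *\<^sub>R v))"
    using MVT2[of 0 h u "\<lambda>s. \<partial> v f (x + s *\<^sub>R v + h *\<^sub>R w) - \<partial> v f (x + s *\<^sub>R v)"] h by auto
  have g: "smooth (ball x r) (\<partial> v f)" by (rule smooth_dir_deriv[OF f])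
  have "((\<lambda>t. \<partial> v f (x + s *\<^sub>R v + t *\<^sub>R w)) has_real_derivative
        \<partial> w (\<partial> v f) (x + s *\<^sub>R v + t *\<^sub>R w)) (at t)" if "0 \<le> t" "t \<le> h" for t
  proof -
    have i: "x + s *\<^sub>R v + t *\<^sub>R w \<in> ball x r" using inb that s by auto
    show ?thesis unfolding has_field_derivative_def
      by (rule has_derivative_eq_rhs[OF has_derivative_along_line[OF g i]]) auto
  qed
  then obtain t where t: "0 < t" "t < h"
      "\<partial> v f (x + s *\<^sub>R v + h *\<^sub>R w) - \<partial> v f (x + s *\<^sub>R v + 0 *\<^sub>R w)
        = (h - 0) * \<partial> w (\<partial> v f) (x + s *\<^sub>R v + t *\<^sub>R w)"
    using MVT2[of 0 h "\<lambda>t. \<partial> v f (x + s *\<^sub>R v + t *\<^sub>R w)" "\<lambda>t. \<partial> w (\<partial> v f) (x + s *\<^sub>R v + t *\<^sub>R w)"] h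
    by auto
  show ?thesis
  proof (intro exI conjI)
    show "dist x (x + s *\<^sub>R v + t *\<^sub>R w) \<le> h * (norm v + norm w)"
      using le s t by auto
    show "f (x + h *\<^sub>R v + h *\<^sub>R w) - f (x + h *\<^sub>R v) - f (x + h *\<^sub>R w) + f x
        = h\<^sup>2 * \<partial> w (\<partial> v f) (x + s *\<^sub>R v + t *\<^sub>R w)"
      using s(3) t(3) by (simp add: u_def power2_eq_square)
  qed
qed

lemma dir_deriv_inner:
  assumes "f differentiable (at x)"
  shows "\<partial> v (\<lambda>x. f x \<bullet> c) x = \<partial> v f x \<bullet> c"
  by (rule dir_deriv_eq) (intro has_derivative_inner_left differentiable_dir_deriv assms)

text \<open>The two mixed derivatives agree at points arbitrarily close to \<open>x\<close>, because they represent the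
  same second difference; by continuity they agree at \<open>x\<close>.\<close>

lemma dir_deriv_commute_real:
  fixes f :: "'a::euclidean_space \<Rightarrow> real"
  assumes U: "open U" "x \<in> U" and f: "smooth U f"
  shows "\<partial> v (\<partial> w f) x = \<partial> w (\<partial> v f) x"
proof (rule ccontr)
  define e where "e = \<bar>\<partial> v (\<partial> w f) x - \<partial> w (\<partial> v f) x\<bar> / 2"
  assume "\<partial> v (\<partial> w f) x \<noteq> \<partial> w (\<partial> v f) x"
  then have e: "e > 0" by (simp add: e_def)
  obtain r where r: "r > 0" "ball x r \<subseteq> U" using U open_contains_ball by blast
  then have f': "smooth (ball x r) f" using smooth_on_subset[OF f] by blast
  have c: "isCont (\<partial> v (\<partial> w f)) x" for v w
    using smooth_continuous_on[OF smooth_dir_deriv[OF smooth_dir_deriv[OF f]]] U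
    by (simp add: continuous_on_eq_continuous_at)
  obtain d1 where d1: "d1 > 0" "\<And>y. dist x y < d1 \<Longrightarrow> \<bar>\<partial> v (\<partial> w f) y - \<partial> v (\<partial> w f) x\<bar> < e"
    using c[of v w] e unfolding continuous_at_eps_delta dist_real_def by (metis dist_commute)
  obtain d2 where d2: "d2 > 0" "\<And>y. dist x y < d2 \<Longrightarrow> \<bar>\<partial> w (\<partial> v f) y - \<partial> w (\<partial> v f) x\<bar> < e"
    using c[of w v] e unfolding continuous_at_eps_delta dist_real_def by (metis dist_commute)
  define d where "d = min r (min d1 d2)"
  define N where "N = norm v + norm w + 1"
  have d: "d > 0" using r d1 d2 by (simp add: d_def)
  have N: "N > 0" by (simp add: N_def add_nonneg_pos)
  define h where "h = d / (2 * N)"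
  have h: "h > 0" using d N by (simp add: h_def)
  have hd: "h * (norm v + norm w) < d"
  proof -
    have "h * (norm v + norm w) \<le> h * N" using h by (simp add: N_def)
    also have "\<dots> < d" using d N by (simp add: h_def)
    finally show ?thesis .
  qed
  obtain y where y: "dist x y \<le> h * (norm v + norm w)"
     "f (x + h *\<^sub>R v + h *\<^sub>R w) - f (x + h *\<^sub>R v) - f (x + h *\<^sub>R w) + f x = h\<^sup>2 * \<partial> w (\<partial> v f) y"
    using second_difference_mvt[OF f' h, of v w] hd by (auto simp: d_def)
  obtain z where z: "dist x z \<le> h * (norm v + norm w)"
     "f (x + h *\<^sub>R w + h *\<^sub>R v) - f (x + h *\<^sub>R w) - f (x + h *\<^sub>R v) + f x = h\<^sup>2 * \<partial> v (\<partial> w f) z"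
    using second_difference_mvt[OF f' h, of w v] hd by (auto simp: d_def add.commute)
  have "h\<^sup>2 * \<partial> w (\<partial> v f) y = h\<^sup>2 * \<partial> v (\<partial> w f) z"
    using y(2) z(2) by (simp add: algebra_simps)
  then have "\<partial> w (\<partial> v f) y = \<partial> v (\<partial> w f) z" using h by simp
  moreover have "\<bar>\<partial> w (\<partial> v f) y - \<partial> w (\<partial> v f) x\<bar> < e" "\<bar>\<partial> v (\<partial> w f) z - \<partial> v (\<partial> w f) x\<bar> < e"
    using d1(2)[of z] d2(2)[of y] y(1) z(1) hd by (auto simp: d_def)
  ultimately show False unfolding e_def by (smt (verit) field_sum_of_halves)
qed

lemma dir_deriv_commute:
  assumes U: "open U" "x \<in> U" and f: "smooth U f"
  shows "\<partial> v (\<partial> w f) x = \<partial> w (\<partial> v f) x"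
proof (rule euclidean_eqI)
  fix b :: 'b assume "b \<in> Basis"
  have s: "smooth U (\<lambda>y. f y \<bullet> b)"
    by (intro smooth_bilinear[OF bounded_bilinear_inner] U f smooth_const)
  have "\<partial> v (\<partial> w (\<lambda>y. f y \<bullet> b)) x = \<partial> v (\<partial> w f) x \<bullet> b" for v w
  proof -
    have "\<partial> v (\<partial> w (\<lambda>y. f y \<bullet> b)) x = \<partial> v (\<lambda>y. \<partial> w f y \<bullet> b) x"
      by (rule dir_deriv_cong[OF U(1) _ U(2)]) (simp add: dir_deriv_inner smooth_differentiable[OF f])
    also have "\<dots> = \<partial> v (\<partial> w f) x \<bullet> b"
      by (rule dir_deriv_inner) (rule smooth_differentiable[OF smooth_dir_deriv[OF f] U(2)])
    finally show ?thesis .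
  qed
  then show "\<partial> v (\<partial> w f) x \<bullet> b = \<partial> w (\<partial> v f) x \<bullet> b"
    using dir_deriv_commute_real[OF U s, of v w] by simp
qed

section \<open>Ray-constant extensions and great circles\<close>

text \<open>The derivative of \<open>1 / |x|\<close> in the direction \<open>v\<close> is \<open>- \<langle>x, v\<rangle> / |x|\<^sup>3\<close>, a product of a linear function and
  of powers of \<open>1 / |x|\<close> itself.\<close>

lemma smooth_inverse_norm: "smooth (- {0}) (\<lambda>x::'a::euclidean_space. inverse (norm x))"
  unfolding smooth_def
proof
  fix k show "Ck_on k (- {0}) (\<lambda>x::'a. inverse (norm x))"
  proof (induction k)
    case 0
    show ?case by (auto intro!: continuous_intros)
  next
    case (Suc k)
    have d: "((\<lambda>x. inverse (norm x)) has_derivative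
        (\<lambda>v. - (x \<bullet> v) * (inverse (norm x) * (inverse (norm x) * inverse (norm x))))) (at x)"
      if "x \<noteq> 0" for x :: 'a
      using that
      by (auto intro!: derivative_eq_intros has_derivative_norm simp: sgn_div_norm field_simps inner_commute)
    have o: "open (- {0::'a})" by auto
    have "Ck_on k (- {0}) (\<partial> v (\<lambda>x::'a. inverse (norm x)))" for v
    proof (rule Ck_on_cong[OF o])
      have "linear (\<lambda>x::'a. - (x \<bullet> v))"
        by (rule linearI) (auto simp: inner_add_left)
      from Ck_on_linear[OF this]
      show "Ck_on k (- {0}) (\<lambda>x::'a. - (x \<bullet> v) * (inverse (norm x) * (inverse (norm x) * inverse (norm x))))"
        by (intro Ck_on_bilinear[OF bounded_bilinear_mult o] Suc)
      show "- (x \<bullet> v) * (inverse (norm x) * (inverse (norm x) * inverse (norm x)))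
         = \<partial> v (\<lambda>x. inverse (norm x)) x" if "x \<in> - {0}" for x :: 'a
        using dir_deriv_eq[OF d] that by simp
    qed
    then show ?case using d by (auto simp: Ck_on_Suc_iff differentiable_def)
  qed
qed

lemma open_punctured: "open (- {0::'a::euclidean_space})"
  by auto

text \<open>The extension to the punctured space that is constant on rays. It makes the domain flat: the
  radial derivative vanishes, and nothing is lost along the sphere.\<close>

definition hom_ext :: "('a::euclidean_space \<Rightarrow> 'b) \<Rightarrow> 'a \<Rightarrow> 'b" where
  "hom_ext f x = f (x /\<^sub>R norm x)"

lemma smooth_hom_ext:
  fixes f :: "'a::euclidean_space \<Rightarrow> 'b::euclidean_space"
  assumes f: "smooth_on_sphere f"
  shows "smooth (- {0}) (hom_ext f)"
  unfolding smooth_def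
proof (intro allI Ck_on_local)
  fix k and x :: 'a assume "x \<in> - {0}"
  then have x: "x \<noteq> 0" by simp
  define \<nu> where "\<nu> = (\<lambda>y::'a. inverse (norm y) *\<^sub>R y)"
  have s: "smooth (- {0}) \<nu>"
    unfolding \<nu>_def
    by (intro smooth_bilinear[OF bounded_bilinear_scaleR] smooth_inverse_norm smooth_linear linear_ident) auto
  have u: "\<nu> y \<in> usphere" if "y \<noteq> 0" for y using that by (simp add: \<nu>_def)
  obtain U F where UF: "open U \<and> \<nu> x \<in> U \<and> (\<forall>k. Ck_on k U F) \<and> (\<forall>y\<in>U \<inter> usphere. F y = f y)"
    using bspec[OF f[unfolded smooth_on_sphere_def] u[OF x]] by (elim exE)
  then have U: "open U" "\<nu> x \<in> U" "\<And>k. Ck_on k U F"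
      "\<And>y. y \<in> U \<Longrightarrow> y \<in> usphere \<Longrightarrow> F y = f y"
    by simp_all
  define V where "V = - {0} \<inter> \<nu> -` U"
  have V: "open V" unfolding V_def
    using smooth_continuous_on[OF s] U(1) by (intro continuous_open_preimage) auto
  have "\<nu> ` V \<subseteq> U" and "V \<subseteq> - {0}" by (auto simp: V_def)
  then have c: "Ck_on k V (\<lambda>y. F (\<nu> y))"
    using Ck_on_compose[OF U(1) V _ U(3)] smooth_on_subset[OF s] by (simp add: smooth_def)
  have "F (\<nu> y) = hom_ext f y" if "y \<in> V" for y
    using U(4)[of "\<nu> y"] u[of y] that by (simp add: V_def hom_ext_def \<nu>_def)
  from Ck_on_cong[OF V this c] have "Ck_on k V (hom_ext f)" .
  then show "\<exists>V. open V \<and> x \<in> V \<and> Ck_on k V (hom_ext f)"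
    using V x U(2) by (intro exI[of _ V]) (simp add: V_def)
qed

definition great_circle :: "'a::real_vector \<Rightarrow> 'a \<Rightarrow> real \<Rightarrow> 'a" where
  "great_circle p u t = cos t *\<^sub>R p + sin t *\<^sub>R u"

lemma great_circle_0 [simp]: "great_circle p u 0 = p"
  by (simp add: great_circle_def)

lemma norm_great_circle:
  assumes "norm p = 1" "norm u = 1" "p \<bullet> u = 0"
  shows "norm (great_circle p u t) = 1"
proof -
  have "(norm (great_circle p u t))\<^sup>2 = (cos t)\<^sup>2 * (p \<bullet> p) + (sin t)\<^sup>2 * (u \<bullet> u)"
    using assms unfolding power2_norm_eq_inner great_circle_def
    by (simp add: inner_simps inner_commute power2_eq_square)
  also have "\<dots> = 1" using assms by (simp add: dot_square_norm)
  finally have "(norm (great_circle p u t))\<^sup>2 = 1\<^sup>2" by simp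
  then show ?thesis by (rule power2_eq_imp_eq) simp_all
qed

lemma great_circle_has_derivative:
  fixes p :: "'a::real_normed_vector"
  shows "(great_circle p u has_derivative (\<lambda>s. s *\<^sub>R (cos t *\<^sub>R u - sin t *\<^sub>R p))) (at t)"
  unfolding great_circle_def
  by (auto intro!: derivative_eq_intros simp: scaleR_diff_right scaleR_right_diff_distrib mult.commute)

text \<open>A derivative within the sphere is not unique, but any two of them agree on the velocities of
  great circles through \<open>p\<close>, and these are all the unit tangent vectors.\<close>

lemma derivative_within_sphere:
  fixes f G :: "'a::euclidean_space \<Rightarrow> 'b::euclidean_space"
  assumes p: "p \<in> usphere" and v: "v \<in> tangent_space p"
    and G: "G differentiable (at p)" and eq: "\<And>x. x \<in> usphere \<Longrightarrow> f x = G x"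
  shows "frechet_derivative f (at p within usphere) v = \<partial> v G p"
proof -
  have np: "norm p = 1" using p by simp
  have G': "(f has_derivative (\<lambda>v. \<partial> v G p)) (at p within usphere)"
    by (rule has_derivative_transform[OF p eq])
       (auto intro: has_derivative_at_withinI differentiable_dir_deriv[OF G])
  then have f': "(f has_derivative frechet_derivative f (at p within usphere)) (at p within usphere)"
    using differentiable_def frechet_derivative_works by blast
  have unit: "D1 u = D2 u" if D: "(f has_derivative D1) (at p within usphere)"
      "(f has_derivative D2) (at p within usphere)" and u: "norm u = 1" "u \<bullet> p = 0" for D1 D2 u
  proof -
    have c: "great_circle p u t \<in> usphere" for t
      using norm_great_circle[OF np u(1)] u by (simp add: inner_commute)
    have cd: "(great_circle p u has_derivative (\<lambda>s. s *\<^sub>R u)) (at 0)"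
      using great_circle_has_derivative[of p u 0] by simp
    have "((\<lambda>t. f (great_circle p u t)) has_derivative (\<lambda>s. D (s *\<^sub>R u))) (at 0)"
      if "(f has_derivative D) (at p within usphere)" for D
    proof (rule has_derivative_in_compose[where f = "great_circle p u" and f' = "\<lambda>s. s *\<^sub>R u"])
      show "(f has_derivative D) (at (great_circle p u 0) within range (great_circle p u))"
        unfolding great_circle_0 by (rule has_derivative_subset[OF that]) (use c in blast)
    qed (rule cd)
    then have "(\<lambda>s. D1 (s *\<^sub>R u)) = (\<lambda>s. D2 (s *\<^sub>R u))"
      using D has_derivative_unique by blast
    then show ?thesis by (metis scaleR_one)
  qed
  show ?thesis
  proof (cases "v = 0")
    case True
    then show ?thesis
      using linear_0[OF has_derivative_linear[OF f']] linear_0[OF has_derivative_linear[OF G']] by simp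
  next
    case False
    define u where "u = v /\<^sub>R norm v"
    have "norm u = 1" "u \<bullet> p = 0" using False v by (auto simp: u_def tangent_space_def)
    from unit[OF f' G' this] have "frechet_derivative f (at p within usphere) u = \<partial> u G p" .
    moreover have v: "v = norm v *\<^sub>R u" using False by (simp add: u_def)
    ultimately show ?thesis
      using linear_cmul[OF has_derivative_linear[OF f'], of "norm v" u]
        linear_cmul[OF has_derivative_linear[OF G'], of "norm v" u] by (simp flip: v)
  qed
qed

text \<open>Degree \<open>-k\<close>: each differentiation of a ray-constant map lowers the degree by one.\<close>

definition homogeneous :: "nat \<Rightarrow> ('a::euclidean_space \<Rightarrow> 'b::euclidean_space) \<Rightarrow> bool" where
  "homogeneous k h \<longleftrightarrow> (\<forall>x r. x \<noteq> 0 \<longrightarrow> r > 0 \<longrightarrow> h (r *\<^sub>R x) = inverse r ^ k *\<^sub>R h x)"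

lemma homogeneousD: "homogeneous k h \<Longrightarrow> x \<noteq> 0 \<Longrightarrow> r > 0 \<Longrightarrow> h (r *\<^sub>R x) = inverse r ^ k *\<^sub>R h x"
  by (simp add: homogeneous_def)

lemma homogeneous_hom_ext:
  fixes f :: "'a::euclidean_space \<Rightarrow> 'b::euclidean_space"
  shows "homogeneous 0 (hom_ext f)"
  unfolding homogeneous_def
proof (intro allI impI)
  fix x :: 'a and r :: real assume "x \<noteq> 0" "r > 0"
  then have "(r *\<^sub>R x) /\<^sub>R norm (r *\<^sub>R x) = x /\<^sub>R norm x" by (simp add: field_simps)
  then show "hom_ext f (r *\<^sub>R x) = inverse r ^ 0 *\<^sub>R hom_ext f x"
    by (simp only: hom_ext_def power_0 scaleR_one)
qed

lemma homogeneous_dir_deriv: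
  fixes h :: "'a::euclidean_space \<Rightarrow> 'b::euclidean_space"
  assumes s: "smooth (- {0}) h" and h: "homogeneous k h"
  shows "homogeneous (Suc k) (\<partial> v h)"
  unfolding homogeneous_def
proof (intro allI impI)
  fix x :: 'a and r :: real assume x: "x \<noteq> 0" and r: "r > 0"
  have rx: "r *\<^sub>R x \<in> - {0}" using x r by simp
  have "((\<lambda>y. h (r *\<^sub>R y)) has_derivative (\<lambda>v. \<partial> (r *\<^sub>R v) h (r *\<^sub>R x))) (at x)"
    by (rule has_derivative_compose[where f = "\<lambda>y. r *\<^sub>R y" and f' = "\<lambda>v. r *\<^sub>R v" and g = h
        and g' = "\<lambda>u. \<partial> u h (r *\<^sub>R x)"])
       (auto intro!: derivative_eq_intros smooth_has_derivative[OF s rx])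
  then have 1: "\<partial> v (\<lambda>y. h (r *\<^sub>R y)) x = r *\<^sub>R \<partial> v h (r *\<^sub>R x)"
    by (subst dir_deriv_eq) (auto simp: linear_cmul[OF smooth_linear_dir_deriv[OF s rx]])
  have "\<partial> v (\<lambda>y. h (r *\<^sub>R y)) x = \<partial> v (\<lambda>y. inverse r ^ k *\<^sub>R h y) x"
    by (rule dir_deriv_cong[OF open_punctured]) (use homogeneousD[OF h] x r in auto)
  also have "\<dots> = inverse r ^ k *\<^sub>R \<partial> v h x"
    by (rule dir_deriv_eq) (intro has_derivative_scaleR_right smooth_has_derivative[OF s], use x in simp)
  finally have "r *\<^sub>R \<partial> v h (r *\<^sub>R x) = inverse r ^ k *\<^sub>R \<partial> v h x" using 1 by simp
  then have "inverse r *\<^sub>R (r *\<^sub>R \<partial> v h (r *\<^sub>R x)) = inverse r *\<^sub>R (inverse r ^ k *\<^sub>R \<partial> v h x)" by simp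
  then show "\<partial> v h (r *\<^sub>R x) = inverse r ^ Suc k *\<^sub>R \<partial> v h x" using r by simp
qed

lemma euler_homogeneous:
  fixes h :: "'a::euclidean_space \<Rightarrow> 'b::euclidean_space"
  assumes s: "smooth (- {0}) h" and h: "homogeneous k h" and x: "x \<noteq> 0"
  shows "\<partial> x h x = - real k *\<^sub>R h x"
proof -
  have "((\<lambda>s. h (0 + s *\<^sub>R x)) has_derivative (\<lambda>t. t *\<^sub>R \<partial> x h (0 + 1 *\<^sub>R x))) (at 1)"
    by (rule has_derivative_along_line[OF s]) (use x in simp)
  then have 1: "((\<lambda>s. h (s *\<^sub>R x)) has_derivative (\<lambda>t. t *\<^sub>R \<partial> x h x)) (at 1)" by simp
  have "((\<lambda>s. inverse s ^ k *\<^sub>R h x) has_derivative (\<lambda>t. (- real k * t) *\<^sub>R h x)) (at 1)"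
    by (auto intro!: derivative_eq_intros)
  then have "((\<lambda>s. h (s *\<^sub>R x)) has_derivative (\<lambda>t. (- real k * t) *\<^sub>R h x)) (at 1)"
    by (rule has_derivative_transform_within_open[of _ _ _ _ "{0<..}"])
       (use homogeneousD[OF h x] in auto)
  from has_derivative_unique[OF 1 this] have "1 *\<^sub>R \<partial> x h x = (- real k * 1) *\<^sub>R h x"
    by (rule fun_cong)
  then show ?thesis by simp
qed

section \<open>Orthonormal frames\<close>

definition orthoframe :: "('n::finite \<Rightarrow> 'a::euclidean_space) \<Rightarrow> bool" where
  "orthoframe b \<longleftrightarrow> (\<forall>i j. b i \<bullet> b j = (if i = j then 1 else 0))"

lemma orthoframeD: "orthoframe b \<Longrightarrow> b i \<bullet> b j = (if i = j then 1 else 0)"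
  by (simp add: orthoframe_def)

lemma orthoframe_norm: "orthoframe b \<Longrightarrow> norm (b i) = 1"
  by (simp add: orthoframe_def norm_eq_sqrt_inner)

lemma orthoframe_expand:
  fixes b :: "'n::finite \<Rightarrow> 'a::euclidean_space"
  assumes b: "orthoframe b" and c: "CARD('n) = DIM('a)"
  shows "(\<Sum>i\<in>UNIV. (x \<bullet> b i) *\<^sub>R b i) = x"
proof -
  have inj: "inj b" using b by (metis injI orthoframe_def zero_neq_one)
  have po: "pairwise orthogonal (range b)"
    using b by (auto simp: pairwise_def orthogonal_def orthoframe_def)
  have n: "norm u = 1" if "u \<in> range b" for u using that orthoframe_norm[OF b] by auto
  have ind: "independent (range b)"
    using pairwise_orthogonal_independent[OF po] n by force
  have "card (range b) = DIM('a)" using inj c by (simp add: card_image)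
  then have "x \<in> span (range b)"
    using card_ge_dim_independent[of "range b" UNIV] ind by auto
  then have "(\<Sum>u\<in>range b. (x \<bullet> u) *\<^sub>R u) = x"
    by (intro orthonormal_basis_expand[OF po n]) auto
  then show ?thesis using inj by (simp add: sum.reindex)
qed

lemma orthoframe_inner:
  fixes b :: "'n::finite \<Rightarrow> 'a::euclidean_space"
  assumes b: "orthoframe b" and c: "CARD('n) = DIM('a)"
  shows "x \<bullet> y = (\<Sum>i\<in>UNIV. (x \<bullet> b i) * (y \<bullet> b i))"
proof -
  have "x \<bullet> y = x \<bullet> (\<Sum>i\<in>UNIV. (y \<bullet> b i) *\<^sub>R b i)" by (simp only: orthoframe_expand[OF b c])
  then show ?thesis by (simp add: inner_sum_right mult.commute)
qed

text \<open>Both arguments are expanded in the frame; the coefficients then sum up to the Gram matrix of the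
  frame by Parseval. The invariance is used to pass from the standard basis to a frame that is
  adapted to one point but kept constant near it.\<close>

lemma trace_orthoframe:
  fixes b :: "'n::finite \<Rightarrow> 'a::euclidean_space"
  assumes b: "orthoframe b" and c: "CARD('n) = DIM('a)"
    and l: "\<And>u. linear (\<lambda>w. H w u)" and r: "\<And>u. linear (H u)"
  shows "(\<Sum>u\<in>Basis. H u u) = (\<Sum>i\<in>UNIV. H (b i) (b i))"
proof -
  have e: "H u u = (\<Sum>j\<in>UNIV. \<Sum>k\<in>UNIV. ((u \<bullet> b j) * (u \<bullet> b k)) *\<^sub>R H (b j) (b k))" for u
  proof -
    have "H u u = H (\<Sum>j\<in>UNIV. (u \<bullet> b j) *\<^sub>R b j) (\<Sum>k\<in>UNIV. (u \<bullet> b k) *\<^sub>R b k)"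
      by (simp only: orthoframe_expand[OF b c])
    also have "\<dots> = (\<Sum>j\<in>UNIV. \<Sum>k\<in>UNIV. ((u \<bullet> b j) * (u \<bullet> b k)) *\<^sub>R H (b j) (b k))"
      by (subst sum.swap) (simp add: linear_sum[OF l] linear_sum[OF r] linear_cmul[OF l]
          linear_cmul[OF r] scaleR_sum_right mult.commute)
    finally show ?thesis .
  qed
  have "(\<Sum>u\<in>Basis. H u u)
      = (\<Sum>j\<in>UNIV. \<Sum>k\<in>UNIV. \<Sum>u\<in>Basis. ((u \<bullet> b j) * (u \<bullet> b k)) *\<^sub>R H (b j) (b k))"
    unfolding e by (subst sum.swap, rule sum.cong[OF refl], rule sum.swap)
  also have "\<dots> = (\<Sum>j\<in>UNIV. \<Sum>k\<in>UNIV. (b j \<bullet> b k) *\<^sub>R H (b j) (b k))"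
    by (simp add: scaleR_left.sum[symmetric] euclidean_inner[of "b _" "b _"] inner_commute)
  also have "\<dots> = (\<Sum>j\<in>UNIV. H (b j) (b j))"
    by (simp add: orthoframeD[OF b] if_distrib[of "\<lambda>x. x *\<^sub>R _"] cong: if_cong)
  finally show ?thesis .
qed

section \<open>The harmonic map equation in flat coordinates\<close>

definition laplacian :: "('a::euclidean_space \<Rightarrow> 'b::euclidean_space) \<Rightarrow> 'a \<Rightarrow> 'b" where
  "laplacian h x = (\<Sum>u\<in>Basis. \<partial> u (\<partial> u h) x)"

definition energy :: "('a::euclidean_space \<Rightarrow> 'b::euclidean_space) \<Rightarrow> 'a \<Rightarrow> real" where
  "energy h x = (\<Sum>u\<in>Basis. \<partial> u h x \<bullet> \<partial> u h x)"

lemma linear_inner_compose: "linear L \<Longrightarrow> linear (\<lambda>w. L w \<bullet> c)"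
  by (simp add: linear_iff inner_add_left)

lemma linear_inner_compose_right: "linear L \<Longrightarrow> linear (\<lambda>w. c \<bullet> L w)"
  by (simp add: linear_iff inner_add_right)

lemma smooth_hessian_linear:
  assumes "smooth U h" "open U" "x \<in> U"
  shows "linear (\<lambda>w. \<partial> w (\<partial> u h) x)" "linear (\<lambda>w. \<partial> u (\<partial> w h) x)"
proof -
  show l: "linear (\<lambda>w. \<partial> w (\<partial> u h) x)" for u
    by (rule smooth_linear_dir_deriv[OF smooth_dir_deriv[OF assms(1)] assms(3)])
  show "linear (\<lambda>w. \<partial> u (\<partial> w h) x)"
    using l by (simp add: dir_deriv_commute[OF assms(2,3,1), of u])
qed

lemma laplacian_orthoframe:
  fixes b :: "'n::finite \<Rightarrow> 'a::euclidean_space"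
  assumes "orthoframe b" "CARD('n) = DIM('a)" "smooth U h" "open U" "x \<in> U"
  shows "laplacian h x = (\<Sum>i\<in>UNIV. \<partial> (b i) (\<partial> (b i) h) x)"
  unfolding laplacian_def
  by (rule trace_orthoframe[OF assms(1,2), where H = "\<lambda>u w. \<partial> u (\<partial> w h) x"])
     (rule smooth_hessian_linear[OF assms(3-5)])+

lemma energy_orthoframe:
  fixes b :: "'n::finite \<Rightarrow> 'a::euclidean_space"
  assumes "orthoframe b" "CARD('n) = DIM('a)" "smooth U h" "x \<in> U"
  shows "energy h x = (\<Sum>i\<in>UNIV. \<partial> (b i) h x \<bullet> \<partial> (b i) h x)"
  unfolding energy_def
  by (rule trace_orthoframe[OF assms(1,2), where H = "\<lambda>u w. \<partial> u h x \<bullet> \<partial> w h x"])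
     (intro linear_inner_compose linear_inner_compose_right smooth_linear_dir_deriv[OF assms(3,4)])+

text \<open>The trace of the square of \<open>(DF)\<^sup>T DF\<close>. Together with \<open>energy\<close>, the trace of \<open>(DF)\<^sup>T DF\<close> itself, it
  determines the singular values of a map of rank at most two.\<close>

definition quartic :: "('a::euclidean_space \<Rightarrow> 'b::euclidean_space) \<Rightarrow> 'a \<Rightarrow> real" where
  "quartic h x = (\<Sum>u\<in>Basis. \<Sum>w\<in>Basis. (\<partial> u h x \<bullet> \<partial> w h x)\<^sup>2)"

lemma quartic_orthoframe:
  fixes b :: "'n::finite \<Rightarrow> 'a::euclidean_space"
  assumes "orthoframe b" "CARD('n) = DIM('a)" "smooth U h" "x \<in> U"
  shows "quartic h x = (\<Sum>i\<in>UNIV. \<Sum>j\<in>UNIV. (\<partial> (b i) h x \<bullet> \<partial> (b j) h x)\<^sup>2)"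
proof -
  note l = linear_inner_compose[OF smooth_linear_dir_deriv[OF assms(3,4)]]
    linear_inner_compose_right[OF smooth_linear_dir_deriv[OF assms(3,4)]]
  have m: "linear (\<lambda>w. L w * c)" "linear (\<lambda>w. c * L w)" if "linear L" for L :: "'a \<Rightarrow> real" and c
    using linear_inner_compose[OF that] linear_inner_compose_right[OF that] by simp_all
  have "quartic h x = (\<Sum>u\<in>Basis. \<Sum>j\<in>UNIV. (\<partial> u h x \<bullet> \<partial> (b j) h x)\<^sup>2)"
    unfolding quartic_def power2_eq_square
    by (intro sum.cong refl trace_orthoframe[OF assms(1,2)] m l)
  also have "\<dots> = (\<Sum>j\<in>UNIV. \<Sum>u\<in>Basis. (\<partial> u h x \<bullet> \<partial> (b j) h x)\<^sup>2)" by (rule sum.swap)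
  also have "\<dots> = (\<Sum>j\<in>UNIV. \<Sum>i\<in>UNIV. (\<partial> (b i) h x \<bullet> \<partial> (b j) h x)\<^sup>2)"
    unfolding power2_eq_square
    by (intro sum.cong refl trace_orthoframe[OF assms(1,2)] m l)
  finally show ?thesis by (subst sum.swap)
qed

locale sphere_extension =
  fixes F :: "'a::euclidean_space \<Rightarrow> 'b::euclidean_space"
  assumes smooth_F: "smooth (- {0}) F"
    and homogeneous_F: "homogeneous 0 F"
    and unit_F: "x \<noteq> 0 \<Longrightarrow> F x \<bullet> F x = 1"
begin

lemma dir_deriv_radial: "x \<noteq> 0 \<Longrightarrow> \<partial> x F x = 0"
  using euler_homogeneous[OF smooth_F homogeneous_F] by simp

lemma dir_deriv2_radial: "x \<noteq> 0 \<Longrightarrow> \<partial> x (\<partial> u F) x = - \<partial> u F x"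
  using euler_homogeneous[OF smooth_dir_deriv[OF smooth_F]
      homogeneous_dir_deriv[OF smooth_F homogeneous_F]] by simp

lemma dir_deriv3_radial: "x \<noteq> 0 \<Longrightarrow> \<partial> x (\<partial> x (\<partial> u F)) x = 2 *\<^sub>R \<partial> u F x"
  using euler_homogeneous[OF smooth_dir_deriv[OF smooth_dir_deriv[OF smooth_F]]
      homogeneous_dir_deriv[OF smooth_dir_deriv[OF smooth_F]
        homogeneous_dir_deriv[OF smooth_F homogeneous_F]], of x x u]
  by (simp add: dir_deriv2_radial)

lemma hessian_commute: "x \<noteq> 0 \<Longrightarrow> \<partial> u (\<partial> w F) x = \<partial> w (\<partial> u F) x"
  by (rule dir_deriv_commute[OF open_punctured _ smooth_F]) simp

lemma F_orth: assumes "x \<noteq> 0" shows "\<partial> u F x \<bullet> F x = 0"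
proof -
  have "\<partial> u (\<lambda>x. F x \<bullet> F x) x = \<partial> u (\<lambda>x. 1::real) x"
    by (rule dir_deriv_cong[OF open_punctured]) (use assms unit_F in auto)
  also have "\<dots> = 0" by (rule dir_deriv_eq) simp
  also have "\<partial> u (\<lambda>x. F x \<bullet> F x) x = F x \<bullet> \<partial> u F x + \<partial> u F x \<bullet> F x"
    by (rule dir_deriv_eq[OF has_derivative_inner]) (use assms in \<open>auto intro!: smooth_has_derivative[OF smooth_F]\<close>)
  finally show ?thesis by (simp add: inner_commute)
qed

text \<open>The component of the Hessian normal to the target sphere is minus the first fundamental form:
  differentiate \<open>\<langle>DF u, F\<rangle> = 0\<close>.\<close>

lemma hessian_orth: assumes "x \<noteq> 0" shows "\<partial> w (\<partial> u F) x \<bullet> F x = - (\<partial> w F x \<bullet> \<partial> u F x)"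
proof -
  have "\<partial> w (\<lambda>x. \<partial> u F x \<bullet> F x) x = \<partial> w (\<lambda>x. 0::real) x"
    by (rule dir_deriv_cong[OF open_punctured]) (use assms F_orth in auto)
  also have "\<dots> = 0" by (rule dir_deriv_eq) simp
  also have "\<partial> w (\<lambda>x. \<partial> u F x \<bullet> F x) x = \<partial> u F x \<bullet> \<partial> w F x + \<partial> w (\<partial> u F) x \<bullet> F x"
    by (rule dir_deriv_eq[OF has_derivative_inner])
       (use assms in \<open>auto intro!: smooth_has_derivative[OF smooth_F] smooth_has_derivative[OF smooth_dir_deriv[OF smooth_F]]\<close>)
  finally show ?thesis by (simp add: inner_commute)
qed

end

locale harmonic_extension = sphere_extension F for F :: "real^4 \<Rightarrow> real^3" +
  assumes laplacian_F: "x \<noteq> 0 \<Longrightarrow> laplacian F x = - energy F x *\<^sub>R F x"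

text \<open>The radial direction comes first, so the index \<open>i\<close> of a tangent vector becomes \<open>i + 1\<close>.\<close>

definition tangent_frame :: "'a::euclidean_space \<Rightarrow> (3 \<Rightarrow> 'a) \<Rightarrow> 4 \<Rightarrow> 'a" where
  "tangent_frame p e i = (if i = 1 then p else if i = 2 then e 1 else if i = 3 then e 2 else e 3)"

lemma tangent_frame_simps [simp]:
  "tangent_frame p e 1 = p" "tangent_frame p e 2 = e 1"
  "tangent_frame p e 3 = e 2" "tangent_frame p e 4 = e 3"
  by (simp_all add: tangent_frame_def)

lemma orthoframe_tangent_frame:
  assumes "orthonormal_basis_at p e" "norm p = 1"
  shows "orthoframe (tangent_frame p e)"
proof -
  have "p \<bullet> p = 1" using assms(2) by (simp add: dot_square_norm)
  moreover have "e i \<bullet> p = 0" "p \<bullet> e i = 0" "e i \<bullet> e j = (if i = j then 1 else 0)" for i j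
    using assms(1) by (auto simp: orthonormal_basis_at_def tangent_space_def inner_commute)
  ultimately show ?thesis unfolding orthoframe_def forall_4 by simp
qed

lemma differential_hom_ext:
  assumes "sphere_extension F" "p \<in> usphere" "\<And>x. x \<in> usphere \<Longrightarrow> f x = F x"
  shows "differential f p v = \<partial> v F p"
proof -
  interpret sphere_extension F by fact
  have p0: "p \<noteq> 0" "p \<bullet> p = 1" using assms(2) by (auto simp: dot_square_norm)
  have t: "tangent_proj p v \<in> tangent_space p"
    using p0 by (simp add: tangent_proj_def tangent_space_def inner_diff_left)
  have d: "F differentiable (at p)" using smooth_differentiable[OF smooth_F] p0 by simp
  have l: "linear (\<lambda>v. \<partial> v F p)" using smooth_linear_dir_deriv[OF smooth_F] p0 by simp
  have "differential f p v = \<partial> (tangent_proj p v) F p"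
    unfolding differential_def by (rule derivative_within_sphere[OF assms(2) t d assms(3)])
  also have "\<dots> = \<partial> v F p"
    unfolding tangent_proj_def linear_diff[OF l] linear_cmul[OF l] dir_deriv_radial[OF p0(1)] by simp
  finally show ?thesis .
qed

text \<open>The tangential part of a constant vector is a convenient vector field for computing the tension
  field: its covariant derivative at a point where it is tangent vanishes.\<close>

lemma vector_field_const_proj:
  "vector_field (\<lambda>x::'a::euclidean_space. e - (e \<bullet> x) *\<^sub>R x)" (is "vector_field ?X")
proof -
  have s: "smooth UNIV ?X"
  proof -
    have "smooth UNIV (\<lambda>x::'a. (e \<bullet> x) *\<^sub>R x)"
      by (intro smooth_bilinear[OF bounded_bilinear_scaleR] smooth_bilinear[OF bounded_bilinear_inner]
          smooth_const smooth_linear linear_ident open_UNIV)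
    then have "smooth UNIV (\<lambda>x::'a. e + (-1) *\<^sub>R ((e \<bullet> x) *\<^sub>R x))"
      by (intro smooth_add[OF open_UNIV] smooth_const
          smooth_bilinear[OF bounded_bilinear_scaleR open_UNIV smooth_const])
    then show ?thesis by simp
  qed
  then have "smooth_on_sphere ?X"
    unfolding smooth_on_sphere_def smooth_def by (intro ballI exI[of _ UNIV] exI[of _ ?X]) auto
  moreover have "?X p \<in> tangent_space p" if "p \<in> usphere" for p
    using that by (simp add: tangent_space_def inner_diff_left dot_square_norm)
  ultimately show ?thesis by (simp add: vector_field_def)
qed

text \<open>On the sphere the differential of \<open>f\<close> applied to the tangential part of \<open>e\<close> is the directional
  derivative of the extension in the constant direction \<open>e\<close>, because radial derivatives vanish. So the
  Hessian is the tangential part of an ordinary second derivative.\<close>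

lemma hessian_const_proj:
  assumes F: "sphere_extension F" and p: "p \<in> usphere" and eq: "\<And>x. x \<in> usphere \<Longrightarrow> f x = F x"
    and e: "e \<in> tangent_space p" "e \<bullet> e = 1"
  shows "hessian f (\<lambda>x. e - (e \<bullet> x) *\<^sub>R x) (\<lambda>x. e - (e \<bullet> x) *\<^sub>R x) p = tangent_proj (f p) (\<partial> e (\<partial> e F) p)"
proof -
  interpret sphere_extension F by fact
  define X where "X = (\<lambda>x. e - (e \<bullet> x) *\<^sub>R x)"
  have p0: "p \<noteq> 0" "p \<bullet> p = 1" using p by (auto simp: dot_square_norm)
  have ep: "e \<bullet> p = 0" using e by (simp add: tangent_space_def)
  have Xp: "X p = e" by (simp add: X_def ep)
  have te: "tangent_proj p e = e" by (simp add: tangent_proj_def ep)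
  have dX: "(X has_derivative (\<lambda>v. - ((e \<bullet> p) *\<^sub>R v + (e \<bullet> v) *\<^sub>R p))) (at p)"
    unfolding X_def by (auto intro!: derivative_eq_intros)
  have "differential X p e = \<partial> e X p"
    unfolding differential_def te
    by (rule derivative_within_sphere[OF p e(1)]) (use dX in \<open>auto simp: differentiable_def\<close>)
  also have "\<dots> = - p" using dir_deriv_eq[OF dX, of e] e ep by simp
  finally have "levi_civita X X p = 0"
    by (simp add: levi_civita_def Xp tangent_proj_def p0)
  then have 1: "differential f p (levi_civita X X p) = 0"
    using differential_hom_ext[OF F p eq] linear_0[OF smooth_linear_dir_deriv[OF smooth_F, of p]] p0 by simp
  have V: "differential f q (X q) = \<partial> e F q" if q: "q \<in> usphere" for q
  proof -
    have q0: "q \<noteq> 0" using q by auto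
    have l: "linear (\<lambda>v. \<partial> v F q)" using smooth_linear_dir_deriv[OF smooth_F] q0 by simp
    have "differential f q (X q) = \<partial> (X q) F q" by (rule differential_hom_ext[OF F q eq])
    then show ?thesis
      unfolding X_def linear_diff[OF l] linear_cmul[OF l]
        dir_deriv_radial[OF q0] by simp
  qed
  have "differential (\<lambda>q. differential f q (X q)) p e = \<partial> e (\<partial> e F) p"
    unfolding differential_def[of "\<lambda>q. differential f q (X q)"] te
    by (rule derivative_within_sphere[OF p e(1) _ V])
       (use smooth_differentiable[OF smooth_dir_deriv[OF smooth_F]] p0 in auto)
  then show ?thesis
    unfolding X_def[symmetric] by (simp add: hessian_def 1 pullback_connection_def Xp)
qed

lemma exists_tangent_frame:
  fixes p :: "real^4"
  assumes "norm p = 1"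
  shows "\<exists>e. orthonormal_basis_at p e"
proof -
  define S where "S = {x. p \<bullet> x = 0}"
  have S: "subspace S" unfolding S_def by (simp add: subspace_hyperplane)
  have "p \<noteq> 0" using assms by auto
  then have d: "dim S = 3" unfolding S_def using dim_hyperplane[of p] by auto
  obtain B where B: "B \<subseteq> S" "pairwise orthogonal B" "\<And>x. x \<in> B \<Longrightarrow> norm x = 1" "card B = dim S"
    by (rule orthonormal_basis_subspace[OF S]) (rule that; simp)
  have "card B = CARD(3)" using B d by simp
  moreover have "finite B" using B(4) d by (metis card.infinite zero_neq_numeral)
  ultimately have "\<exists>e::3 \<Rightarrow> real^4. bij_betw e UNIV B"
    by (intro finite_same_card_bij) simp_all
  then obtain e :: "3 \<Rightarrow> real^4" where e: "bij_betw e UNIV B" by (elim exE)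
  have "orthonormal_basis_at p e"
    unfolding orthonormal_basis_at_def
  proof (intro conjI allI)
    fix i j
    have i: "e i \<in> B" "e j \<in> B" using e by (auto simp: bij_betw_def)
    show "e i \<in> tangent_space p" using i B(1) by (auto simp: S_def tangent_space_def inner_commute)
    show "e i \<bullet> e j = (if i = j then 1 else 0)"
    proof (cases "i = j")
      case False
      then have "e i \<noteq> e j" using e by (auto simp: bij_betw_def inj_on_def)
      then show ?thesis using False B(2) i by (simp add: pairwise_def orthogonal_def)
    qed (use B(3)[OF i(1)] in \<open>simp add: dot_square_norm\<close>)
  qed
  then show ?thesis by blast
qed

text \<open>On the sphere, the tension field equation determines the tangential part of the flat Laplacian; the
  normal part is \<open>-|DF|\<^sup>2 F\<close> in any case, and the radial second derivative vanishes. Both sides are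
  homogeneous of degree \<open>-2\<close>, so the equation extends to all of the punctured space.\<close>

lemma harmonic_extension_hom_ext:
  assumes h: "harmonic f"
  shows "harmonic_extension (hom_ext f)"
proof -
  define F where "F = hom_ext f"
  have F: "sphere_extension F"
  proof
    show "smooth (- {0}) F" unfolding F_def by (rule smooth_hom_ext) (use h in \<open>simp add: harmonic_def\<close>)
    show "homogeneous 0 F" unfolding F_def by (rule homogeneous_hom_ext)
    show "F x \<bullet> F x = 1" if "x \<noteq> 0" for x
    proof -
      have "f (x /\<^sub>R norm x) \<in> usphere" using h that by (auto simp: harmonic_def)
      then show ?thesis by (simp add: F_def hom_ext_def dot_square_norm)
    qed
  qed
  interpret sphere_extension F by (rule F)
  have eq: "f x = F x" if "x \<in> usphere" for x using that by (simp add: F_def hom_ext_def)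
  have sph: "laplacian F p = - energy F p *\<^sub>R F p" if p: "norm p = 1" for p
  proof -
    have p0: "p \<noteq> 0" "p \<in> usphere" using p by auto
    obtain e where e: "orthonormal_basis_at p e" using exists_tangent_frame[OF p] by blast
    define E where "E = (\<lambda>i x. e i - (e i \<bullet> x) *\<^sub>R x)"
    have et: "e i \<in> tangent_space p" "e i \<bullet> e i = 1" "e i \<bullet> p = 0" for i
      using e by (auto simp: orthonormal_basis_at_def tangent_space_def)
    have "(\<lambda>i. E i p) = e" by (auto simp: E_def et)
    then have "tension_field f E p = 0"
      using h p0 e vector_field_const_proj unfolding harmonic_def E_def by force
    moreover have "hessian f (E i) (E i) p = tangent_proj (f p) (\<partial> (e i) (\<partial> (e i) F) p)" for i
      unfolding E_def by (rule hessian_const_proj[OF F p0(2) eq et(1,2)])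
    ultimately have "(\<Sum>i\<in>UNIV. tangent_proj (f p) (\<partial> (e i) (\<partial> (e i) F) p)) = 0"
      by (simp add: tension_field_def)
    then have 1: "(\<Sum>i\<in>UNIV. \<partial> (e i) (\<partial> (e i) F) p) 
          = - (\<Sum>i\<in>UNIV. \<partial> (e i) F p \<bullet> \<partial> (e i) F p) *\<^sub>R F p"
      using p0 by (simp add: tangent_proj_def sum_subtractf eq hessian_orth sum_negf scaleR_sum_left)
    note tf = orthoframe_tangent_frame[OF e p]
    have pp: "p \<in> - {0}" using p0 by simp
    have "laplacian F p = (\<Sum>i\<in>UNIV. \<partial> (e i) (\<partial> (e i) F) p)"
      using laplacian_orthoframe[OF tf _ smooth_F open_punctured pp]
      by (simp add: sum_4 sum_3 dir_deriv2_radial dir_deriv_radial p0)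
    moreover have "energy F p = (\<Sum>i\<in>UNIV. \<partial> (e i) F p \<bullet> \<partial> (e i) F p)"
      using energy_orthoframe[OF tf _ smooth_F pp]
      by (simp add: sum_4 sum_3 dir_deriv_radial p0)
    ultimately show ?thesis using 1 by simp
  qed
  have "harmonic_extension F"
  proof
    fix x :: "real^4" assume x: "x \<noteq> 0"
    define p r where "p = x /\<^sub>R norm x" and "r = norm x"
    have p: "norm p = 1" "p \<noteq> 0" and r: "r > 0" and xp: "x = r *\<^sub>R p" using x by (auto simp: p_def r_def)
    note h1 = homogeneous_dir_deriv[OF smooth_F homogeneous_F]
    have "laplacian F x = inverse r ^ 2 *\<^sub>R laplacian F p"
      unfolding laplacian_def xp scaleR_sum_right
      using homogeneousD[OF homogeneous_dir_deriv[OF smooth_dir_deriv[OF smooth_F] h1] p(2) r]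
      by (simp add: power2_eq_square)
    moreover have "energy F x = inverse r ^ 2 * energy F p"
      unfolding energy_def xp homogeneousD[OF h1 p(2) r]
      by (simp add: sum_distrib_left power2_eq_square mult.assoc)
    moreover have "F x = F p" using homogeneousD[OF homogeneous_F p(2) r] xp by simp
    ultimately show "laplacian F x = - energy F x *\<^sub>R F x" using sph[OF p(1)] by simp
  qed
  then show ?thesis by (simp add: F_def)
qed

section \<open>Singular values\<close>

text \<open>Right singular vectors of the differential, in decreasing order of the singular values.\<close>

definition adapted_basis :: "(real^4 \<Rightarrow> real^3) \<Rightarrow> real^4 \<Rightarrow> (3 \<Rightarrow> real^4) \<Rightarrow> bool" where
  "adapted_basis F p e \<longleftrightarrow> orthonormal_basis_at p e \<and> \<partial> (e 3) F p = 0 \<and>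
     \<partial> (e 1) F p \<bullet> \<partial> (e 2) F p = 0 \<and> norm (\<partial> (e 2) F p) \<le> norm (\<partial> (e 1) F p)"

text \<open>Diagonalizing a symmetric \<open>2 \<times> 2\<close> matrix by a rotation: the off-diagonal entry changes its sign
  after a quarter turn.\<close>

lemma exists_rotation_diagonalizing:
  fixes x y :: "'a::real_inner"
  shows "\<exists>t. (cos t *\<^sub>R x + sin t *\<^sub>R y) \<bullet> (cos t *\<^sub>R y - sin t *\<^sub>R x) = 0"
proof -
  define \<phi> where "\<phi> t = (cos t *\<^sub>R x + sin t *\<^sub>R y) \<bullet> (cos t *\<^sub>R y - sin t *\<^sub>R x)" for t
  have c: "continuous_on {0..pi/2} \<phi>" unfolding \<phi>_def by (intro continuous_intros)
  have v: "\<phi> 0 = x \<bullet> y" "\<phi> (pi/2) = - (x \<bullet> y)" by (simp_all add: \<phi>_def inner_commute)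
  show ?thesis
  proof (cases "x \<bullet> y \<ge> 0")
    case True
    then show ?thesis using IVT2'[of \<phi> "pi/2" 0 0] c v unfolding \<phi>_def by auto
  next
    case False
    then show ?thesis using IVT'[of \<phi> 0 0 "pi/2"] c v unfolding \<phi>_def by auto
  qed
qed

lemma orthonormal_basis_atI:
  assumes "a \<bullet> p = 0" "b \<bullet> p = 0" "c \<bullet> p = 0" "a \<bullet> a = 1" "b \<bullet> b = 1" "c \<bullet> c = 1"
    "a \<bullet> b = 0" "a \<bullet> c = 0" "b \<bullet> c = 0"
  shows "orthonormal_basis_at p (\<lambda>i. if i = 1 then a else if i = 2 then b else c)"
  using assms unfolding orthonormal_basis_at_def tangent_space_def forall_3 by (simp add: inner_commute)

text \<open>The differential maps the tangent space, of dimension three, into the orthogonal complement of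
  \<open>F p\<close>, of dimension two.\<close>

lemma exists_kernel_vector:
  fixes F :: "real^4 \<Rightarrow> real^3"
  assumes F: "sphere_extension F" and p: "norm p = 1"
  shows "\<exists>k. norm k = 1 \<and> k \<bullet> p = 0 \<and> \<partial> k F p = 0"
proof -
  interpret sphere_extension F by fact
  have p0: "p \<noteq> 0" using p by auto
  define T where "T = {x. p \<bullet> x = 0}"
  define W where "W = {y. F p \<bullet> y = 0}"
  define L where "L = (\<lambda>v. \<partial> v F p)"
  have l: "linear L" unfolding L_def by (rule smooth_linear_dir_deriv[OF smooth_F]) (use p0 in simp)
  have T: "subspace T" "dim T = 3" unfolding T_def using dim_hyperplane[OF p0] by (simp_all add: subspace_hyperplane)
  have "F p \<noteq> 0" using unit_F[OF p0] by auto
  then have W: "dim W = 2" unfolding W_def using dim_hyperplane[of "F p"] by simp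
  have "L ` T \<subseteq> W" unfolding L_def W_def using F_orth[OF p0] by (auto simp: inner_commute)
  then have "dim (L ` T) \<le> 2" using W dim_subset by metis
  then have "\<not> inj_on L (span T)" using dim_image_eq[OF l, of T] T by auto
  then obtain x y where xy: "x \<in> T" "y \<in> T" "x \<noteq> y" "L x = L y"
    using T by (auto simp: inj_on_def span_eq_iff[THEN iffD2])
  define k where "k = (x - y) /\<^sub>R norm (x - y)"
  have "norm k = 1" using xy by (simp add: k_def)
  moreover have "k \<bullet> p = 0" using xy by (simp add: k_def T_def inner_diff_right inner_commute[of _ p])
  moreover have "L k = 0" using xy by (simp add: k_def linear_cmul[OF l] linear_diff[OF l])
  ultimately show ?thesis by (auto simp: L_def)
qed

lemma exists_orthonormal_complement:
  fixes p k :: "real^4"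
  assumes p: "norm p = 1" and k: "norm k = 1" "k \<bullet> p = 0"
  shows "\<exists>u w. u \<bullet> u = 1 \<and> w \<bullet> w = 1 \<and> u \<bullet> w = 0 \<and> u \<bullet> p = 0 \<and> w \<bullet> p = 0 \<and> u \<bullet> k = 0 \<and> w \<bullet> k = 0"
proof -
  have p0: "p \<noteq> 0" and k0: "k \<noteq> 0" using p k by auto
  define T where "T = {x. p \<bullet> x = 0}"
  have T: "subspace T" "dim T = 3" unfolding T_def using dim_hyperplane[OF p0] by (simp_all add: subspace_hyperplane)
  define S where "S = {y \<in> T. \<forall>x\<in>span {k}. orthogonal x y}"
  have kT: "span {k} \<subseteq> T" using k by (intro span_minimal T) (simp add: T_def inner_commute)
  have "dim S + dim (span {k}) = dim T"
    unfolding S_def by (rule dim_subspace_orthogonal_to_vectors[OF subspace_span T(1) kT])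
  then have dS: "dim S = 2" using T k0 by (simp add: dim_span dim_singleton)
  have sS: "subspace S"
    unfolding S_def subspace_def using subspace_0[OF T(1)] subspace_add[OF T(1)] subspace_mul[OF T(1)]
    by (auto simp: orthogonal_clauses orthogonal_def inner_add_right)
  obtain B where B: "B \<subseteq> S" "pairwise orthogonal B" "\<And>x. x \<in> B \<Longrightarrow> norm x = 1" "card B = dim S"
    by (rule orthonormal_basis_subspace[OF sS]) (rule that; simp)
  obtain u w where uw: "B = {u, w}" "u \<noteq> w" using B(4) dS by (auto simp: card_2_iff)
  have "u \<bullet> w = 0" using B(2) uw by (auto simp: pairwise_def orthogonal_def)
  moreover have "x \<bullet> x = 1 \<and> x \<bullet> p = 0 \<and> x \<bullet> k = 0" if "x \<in> B" for x
    using B(1,3) that by (auto simp: S_def T_def inner_commute orthogonal_def span_base dot_square_norm)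
  ultimately show ?thesis using uw by blast
qed

lemma exists_adapted_basis:
  fixes F :: "real^4 \<Rightarrow> real^3"
  assumes F: "sphere_extension F" and p: "norm p = 1"
  shows "\<exists>e. adapted_basis F p e"
proof -
  interpret sphere_extension F by fact
  have p0: "p \<noteq> 0" using p by auto
  have l: "linear (\<lambda>v. \<partial> v F p)" by (rule smooth_linear_dir_deriv[OF smooth_F]) (use p0 in simp)
  obtain k where k: "norm k = 1" "k \<bullet> p = 0" "\<partial> k F p = 0" using exists_kernel_vector[OF F p] by blast
  obtain u w where uw: "u \<bullet> u = 1" "w \<bullet> w = 1" "u \<bullet> w = 0" "u \<bullet> p = 0" "w \<bullet> p = 0" "u \<bullet> k = 0" "w \<bullet> k = 0"
    using exists_orthonormal_complement[OF p k(1,2)] by blast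
  obtain t where t: "(cos t *\<^sub>R \<partial> u F p + sin t *\<^sub>R \<partial> w F p) \<bullet> (cos t *\<^sub>R \<partial> w F p - sin t *\<^sub>R \<partial> u F p) = 0"
    using exists_rotation_diagonalizing by blast
  define a where "a = cos t *\<^sub>R u + sin t *\<^sub>R w"
  define b where "b = cos t *\<^sub>R w - sin t *\<^sub>R u"
  have ab: "\<partial> a F p \<bullet> \<partial> b F p = 0"
    using t by (simp add: a_def b_def linear_add[OF l] linear_diff[OF l] linear_cmul[OF l])
  have kk: "k \<bullet> k = 1" using k(1) by (simp add: dot_square_norm)
  have on: "a \<bullet> a = 1" "b \<bullet> b = 1" "a \<bullet> b = 0" "a \<bullet> p = 0" "b \<bullet> p = 0" "a \<bullet> k = 0" "b \<bullet> k = 0" "k \<bullet> k = 1"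
    using uw kk sin_cos_squared_add[of t]
    by (simp_all add: a_def b_def inner_simps inner_commute power2_eq_square add.commute)
  show ?thesis
  proof (cases "norm (\<partial> b F p) \<le> norm (\<partial> a F p)")
    case True
    show ?thesis
      by (rule exI[of _ "\<lambda>i. if i = 1 then a else if i = 2 then b else k"])
         (use True ab on k(2,3) orthonormal_basis_atI[of a p b k] in \<open>simp add: adapted_basis_def\<close>)
  next
    case False
    show ?thesis
      by (rule exI[of _ "\<lambda>i. if i = 1 then b else if i = 2 then a else k"])
         (use False ab on k(2,3) orthonormal_basis_atI[of b p a k] in \<open>simp add: adapted_basis_def inner_commute\<close>)
  qed
qed

lemma orthonormal_basis_expand_at:
  assumes e: "orthonormal_basis_at p e" and p: "norm p = 1"
  shows "v = (v \<bullet> p) *\<^sub>R p + (v \<bullet> e 1) *\<^sub>R e 1 + (v \<bullet> e 2) *\<^sub>R e 2 + (v \<bullet> e 3) *\<^sub>R e 3"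
  using orthoframe_expand[OF orthoframe_tangent_frame[OF e p], of v] by (simp add: sum_4)

text \<open>The identity \<open>(a\<^sup>2 - b\<^sup>2)\<^sup>2 = 2 (a\<^sup>4 + b\<^sup>4) - (a\<^sup>2 + b\<^sup>2)\<^sup>2\<close> recovers the difference of the squares.\<close>

lemma ordered_pair_eq_of_power_sums:
  fixes a b c d :: real
  assumes "0 \<le> b" "b \<le> a" "0 \<le> d" "d \<le> c"
    and s: "a\<^sup>2 + b\<^sup>2 = c\<^sup>2 + d\<^sup>2" and q: "a^4 + b^4 = c^4 + d^4"
  shows "a = c \<and> b = d"
proof -
  have "(a\<^sup>2 - b\<^sup>2)\<^sup>2 = 2 * (a^4 + b^4) - (a\<^sup>2 + b\<^sup>2)\<^sup>2" by (simp add: algebra_simps power2_eq_square power4_eq_xxxx)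
  also have "\<dots> = (c\<^sup>2 - d\<^sup>2)\<^sup>2" unfolding s q by (simp add: algebra_simps power2_eq_square power4_eq_xxxx)
  finally have "a\<^sup>2 - b\<^sup>2 = c\<^sup>2 - d\<^sup>2"
    by (rule power2_eq_imp_eq) (use assms in \<open>auto intro: power_mono\<close>)
  then have "a\<^sup>2 = c\<^sup>2" "b\<^sup>2 = d\<^sup>2" using s by auto
  then show ?thesis using assms by (auto intro: power2_eq_imp_eq)
qed

text \<open>An adapted basis provides the square root of \<open>df\<^sup>* df\<close> and its eigenvalues. They are unique because
  any other eigenbasis is again orthogonal for \<open>df\<^sup>* df\<close>: a kernel vector forces its least eigenvalue
  to be zero, and the other two have the same power sums, namely energy and quartic.\<close>

lemma singular_values_eq:
  fixes F :: "real^4 \<Rightarrow> real^3"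
  assumes F: "sphere_extension F" and p: "norm p = 1" and eq: "\<And>x. x \<in> usphere \<Longrightarrow> f x = F x"
    and e: "adapted_basis F p e"
  shows "singular_values f p = vector [norm (\<partial> (e 1) F p), norm (\<partial> (e 2) F p), 0]"
proof -
  interpret sphere_extension F by fact
  have p0: "p \<noteq> 0" "p \<in> usphere" "p \<in> - {0}" using p by auto
  define L where "L = (\<lambda>v. \<partial> v F p)"
  have l: "linear L" unfolding L_def by (rule smooth_linear_dir_deriv[OF smooth_F p0(3)])
  have dL: "differential f p = L" unfolding L_def by (rule ext, rule differential_hom_ext[OF F p0(2) eq])
  have Lp: "L p = 0" unfolding L_def by (rule dir_deriv_radial[OF p0(1)])
  define a b where "a = norm (L (e 1))" and "b = norm (L (e 2))"
  have on: "orthonormal_basis_at p e" and L3: "L (e 3) = 0" and L12: "L (e 1) \<bullet> L (e 2) = 0" and ba: "b \<le> a"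
    using e by (auto simp: adapted_basis_def L_def a_def b_def)
  have ee: "e i \<bullet> e j = (if i = j then 1 else 0)" "e i \<bullet> p = 0" "p \<bullet> e i = 0" for i j
    using on by (auto simp: orthonormal_basis_at_def tangent_space_def inner_commute)
  have La: "L (e 1) \<bullet> L (e 1) = a\<^sup>2" "L (e 2) \<bullet> L (e 2) = b\<^sup>2" by (simp_all add: a_def b_def dot_square_norm)
  have Lv: "L v = (v \<bullet> e 1) *\<^sub>R L (e 1) + (v \<bullet> e 2) *\<^sub>R L (e 2)" for v
  proof -
    have "L v = L ((v \<bullet> p) *\<^sub>R p + (v \<bullet> e 1) *\<^sub>R e 1 + (v \<bullet> e 2) *\<^sub>R e 2 + (v \<bullet> e 3) *\<^sub>R e 3)"
      using orthonormal_basis_expand_at[OF on p, of v] by simp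
    then show ?thesis by (simp add: linear_add[OF l] linear_cmul[OF l] Lp L3)
  qed
  have adj: "adjoint L y \<bullet> w = y \<bullet> L w" for y w
    using adjoint_works[OF l, of w y] by (simp add: inner_commute)
  define P where "P l \<longleftrightarrow> l $ 1 \<ge> l $ 2 \<and> l $ 2 \<ge> l $ 3 \<and>
     (\<exists>R e. is_sqrt_at f p R \<and> orthonormal_basis_at p e \<and> (\<forall>i. R (e i) = (l $ i) *\<^sub>R e i))" for l :: "real^3"
  define R where "R v = (a * (v \<bullet> e 1)) *\<^sub>R e 1 + (b * (v \<bullet> e 2)) *\<^sub>R e 2" for v
  have "is_sqrt_at f p R"
    unfolding is_sqrt_at_def dL
  proof (intro conjI ballI)
    show "linear R" unfolding R_def by (rule linearI) (simp_all add: inner_simps algebra_simps)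
    fix v assume v: "v \<in> tangent_space p"
    show "R v \<in> tangent_space p" by (simp add: R_def tangent_space_def inner_simps ee)
    have "R v \<bullet> v = a * (v \<bullet> e 1)\<^sup>2 + b * (v \<bullet> e 2)\<^sup>2"
      by (simp add: R_def inner_simps inner_commute power2_eq_square)
    then show "0 \<le> R v \<bullet> v" by (simp add: a_def b_def)
    show "R (R v) = adjoint L (L v)"
    proof (rule vector_eq_ldot[THEN iffD1, rule_format])
      fix w
      have "w \<bullet> R (R v) = a\<^sup>2 * (v \<bullet> e 1) * (w \<bullet> e 1) + b\<^sup>2 * (v \<bullet> e 2) * (w \<bullet> e 2)"
        by (simp add: R_def inner_simps ee power2_eq_square)
      also have "\<dots> = L v \<bullet> L w"
        unfolding Lv[of v] Lv[of w] by (simp add: inner_simps La L12 inner_commute[of "L (e 2)" "L (e 1)"])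
      also have "\<dots> = w \<bullet> adjoint L (L v)" using adj[of "L v" w] by (simp add: inner_commute)
      finally show "w \<bullet> R (R v) = w \<bullet> adjoint L (L v)" .
    qed
    fix w show "R v \<bullet> w = v \<bullet> R w" by (simp add: R_def inner_simps inner_commute)
  qed
  moreover have "\<forall>i. R (e i) = (vector [a, b, 0] $ i) *\<^sub>R e i"
    unfolding forall_3 by (simp add: R_def ee)
  ultimately have P: "P (vector [a, b, 0])"
    unfolding P_def using on ba by (auto simp: b_def)
  have "l = vector [a, b, 0]" if Pl: "P l" for l
  proof -
    obtain R e' where R: "is_sqrt_at f p R" and e': "orthonormal_basis_at p e'"
      and ev: "\<And>i. R (e' i) = (l $ i) *\<^sub>R e' i" and ord: "l $ 1 \<ge> l $ 2" "l $ 2 \<ge> l $ 3"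
      using Pl unfolding P_def by blast
    have tan: "e' i \<in> tangent_space p" and ee': "e' i \<bullet> e' j = (if i = j then 1 else 0)" for i j
      using e' by (auto simp: orthonormal_basis_at_def)
    have lR: "linear R" using R by (simp add: is_sqrt_at_def)
    have pos: "l $ i \<ge> 0" for i
    proof -
      have "0 \<le> R (e' i) \<bullet> e' i" using R tan unfolding is_sqrt_at_def by blast
      then show ?thesis by (simp add: ev ee')
    qed
    have gram: "L (e' i) \<bullet> L (e' j) = (if i = j then (l $ i)\<^sup>2 else 0)" for i j
    proof -
      have "R (R (e' i)) = adjoint L (L (e' i))" using R tan unfolding is_sqrt_at_def dL by blast
      then have "adjoint L (L (e' i)) \<bullet> e' j = (l $ i)\<^sup>2 * (e' i \<bullet> e' j)"
        by (simp add: ev linear_cmul[OF lR] power2_eq_square flip: \<open>R (R (e' i)) = adjoint L (L (e' i))\<close>)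
      then show ?thesis by (simp add: adj ee')
    qed
    have Fr: "orthoframe (tangent_frame p e)" "orthoframe (tangent_frame p e')"
      by (rule orthoframe_tangent_frame[OF on p], rule orthoframe_tangent_frame[OF e' p])
    \<comment> \<open>The kernel vector \<open>e 3\<close> has a component along some vector of the other eigenbasis.\<close>
    have "\<exists>j. l $ j = 0"
    proof (rule ccontr)
      assume n: "\<nexists>j. l $ j = 0"
      have ex: "e 3 = (e 3 \<bullet> e' 1) *\<^sub>R e' 1 + (e 3 \<bullet> e' 2) *\<^sub>R e' 2 + (e 3 \<bullet> e' 3) *\<^sub>R e' 3"
        using orthonormal_basis_expand_at[OF e' p, of "e 3"] by (simp add: ee)
      have "L (e 3) = (e 3 \<bullet> e' 1) *\<^sub>R L (e' 1) + (e 3 \<bullet> e' 2) *\<^sub>R L (e' 2) + (e 3 \<bullet> e' 3) *\<^sub>R L (e' 3)"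
        by (subst ex) (simp add: linear_add[OF l] linear_cmul[OF l])
      then have "L (e 3) \<bullet> L (e' j) = (e 3 \<bullet> e' j) * (l $ j)\<^sup>2" for j
        using exhaust_3[of j] by (auto simp: inner_simps gram)
      then have "\<forall>j. e 3 \<bullet> e' j = 0" using n by (simp add: L3)
      then have "e 3 = 0" using ex by simp
      then show False using ee(1)[of 3 3] by simp
    qed
    then obtain j where "l $ j = 0" by blast
    then have l3: "l $ 3 = 0" using ord pos[of 3] pos[of 2] exhaust_3[of j] by auto
    have "energy F p = a\<^sup>2 + b\<^sup>2"
      using energy_orthoframe[OF Fr(1) _ smooth_F p0(3)] La L3 Lp by (simp add: sum_4 L_def)
    moreover have "energy F p = (l $ 1)\<^sup>2 + (l $ 2)\<^sup>2"
      using energy_orthoframe[OF Fr(2) _ smooth_F p0(3)] gram l3 Lp by (simp add: sum_4 L_def)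
    moreover have "quartic F p = a^4 + b^4"
      using quartic_orthoframe[OF Fr(1) _ smooth_F p0(3)] La L3 Lp L12 by (simp add: sum_4 L_def inner_commute)
    moreover have "quartic F p = (l $ 1)^4 + (l $ 2)^4"
      using quartic_orthoframe[OF Fr(2) _ smooth_F p0(3)] gram l3 Lp by (simp add: sum_4 L_def)
    ultimately have "l $ 1 = a \<and> l $ 2 = b"
      by (intro ordered_pair_eq_of_power_sums) (use ord pos ba in \<open>auto simp: b_def\<close>)
    then show ?thesis using l3 by (simp add: vec_eq_iff forall_3)
  qed
  then have "singular_values f p = vector [a, b, 0]"
    unfolding singular_values_def P_def[symmetric] using P by (intro the_equality) 
  then show ?thesis by (simp add: a_def b_def L_def)
qed

context
  fixes F :: "real^4 \<Rightarrow> real^3" and f p e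
  assumes F: "sphere_extension F" and p: "norm p = 1"
    and e: "adapted_basis F p e"
begin

lemma adapted_energy: "energy F p = (norm (\<partial> (e 1) F p))\<^sup>2 + (norm (\<partial> (e 2) F p))\<^sup>2"
proof -
  interpret sphere_extension F by (rule F)
  have p0: "p \<noteq> 0" "p \<in> - {0}" using p by auto
  show ?thesis
    using energy_orthoframe[OF orthoframe_tangent_frame[OF _ p] _ smooth_F p0(2), of e] e
      dir_deriv_radial[OF p0(1)]
    by (simp add: sum_4 adapted_basis_def dot_square_norm)
qed

lemma adapted_quartic: "quartic F p = norm (\<partial> (e 1) F p) ^ 4 + norm (\<partial> (e 2) F p) ^ 4"
proof -
  interpret sphere_extension F by (rule F)
  have p0: "p \<noteq> 0" "p \<in> - {0}" using p by auto
  show ?thesis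
    using quartic_orthoframe[OF orthoframe_tangent_frame[OF _ p] _ smooth_F p0(2), of e] e
      dir_deriv_radial[OF p0(1)]
    by (simp add: sum_4 adapted_basis_def dot_square_norm inner_commute)
qed

end

lemma energy_density_eq_energy:
  fixes F :: "real^4 \<Rightarrow> real^3"
  assumes F: "sphere_extension F" and p: "norm p = 1" and eq: "\<And>x. x \<in> usphere \<Longrightarrow> f x = F x"
  shows "energy_density f p = energy F p"
proof -
  obtain e where e: "adapted_basis F p e" using exists_adapted_basis[OF F p] by blast
  have sv: "singular_values f p = vector [norm (\<partial> (e 1) F p), norm (\<partial> (e 2) F p), 0]"
    by (rule singular_values_eq[OF F p eq e])
  show ?thesis by (simp add: energy_density_def sv adapted_energy[OF F p e])
qed

lemma two_dilation_power2:
  fixes F :: "real^4 \<Rightarrow> real^3"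
  assumes F: "sphere_extension F" and p: "norm p = 1" and eq: "\<And>x. x \<in> usphere \<Longrightarrow> f x = F x"
  shows "2 * (two_dilation f p)\<^sup>2 = (energy F p)\<^sup>2 - quartic F p"
proof -
  obtain e where e: "adapted_basis F p e" using exists_adapted_basis[OF F p] by blast
  have sv: "singular_values f p = vector [norm (\<partial> (e 1) F p), norm (\<partial> (e 2) F p), 0]"
    by (rule singular_values_eq[OF F p eq e])
  show ?thesis
    by (simp add: two_dilation_def sv
        adapted_energy[OF F p e] adapted_quartic[OF F p e] algebra_simps power2_eq_square power4_eq_xxxx)
qed

section \<open>Second derivatives along great circles\<close>

lemma great_circle_has_vector_derivative:
  fixes h :: "'a::euclidean_space \<Rightarrow> 'b::euclidean_space"
  assumes h: "smooth (- {0}) h" and pu: "norm p = 1" "norm u = 1" "p \<bullet> u = 0"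
  shows "((\<lambda>t. h (great_circle p u t)) has_vector_derivative
     cos t *\<^sub>R \<partial> u h (great_circle p u t) - sin t *\<^sub>R \<partial> p h (great_circle p u t)) (at t)"
proof -
  have c: "great_circle p u t \<in> - {0}" using norm_great_circle[OF pu, of t] by auto
  note l = smooth_linear_dir_deriv[OF h c]
  have "((\<lambda>t. h (great_circle p u t)) has_derivative
      (\<lambda>s. \<partial> (s *\<^sub>R (cos t *\<^sub>R u - sin t *\<^sub>R p)) h (great_circle p u t))) (at t)"
    by (rule has_derivative_compose[OF great_circle_has_derivative smooth_has_derivative[OF h c]])
  then show ?thesis
    by (simp add: has_vector_derivative_def linear_cmul[OF l] linear_diff[OF l])
qed

text \<open>The term \<open>- \<partial> p h p\<close> is the contribution of the acceleration of the great circle, which points to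
  the origin.\<close>

lemma great_circle_second_derivative:
  fixes h :: "'a::euclidean_space \<Rightarrow> 'b::euclidean_space"
  assumes h: "smooth (- {0}) h" and pu: "norm p = 1" "norm u = 1" "p \<bullet> u = 0"
  shows "((\<lambda>t. cos t *\<^sub>R \<partial> u h (great_circle p u t) - sin t *\<^sub>R \<partial> p h (great_circle p u t))
     has_vector_derivative \<partial> u (\<partial> u h) p - \<partial> p h p) (at 0)"
proof -
  note d = great_circle_has_vector_derivative[OF smooth_dir_deriv[OF h] pu, of _ 0]
  have "((\<lambda>t. cos t *\<^sub>R \<partial> u h (great_circle p u t)) has_vector_derivative \<partial> u (\<partial> u h) p) (at 0)"
    using has_vector_derivative_scaleR[OF DERIV_cos d[of u]] by simp
  moreover have "((\<lambda>t. sin t *\<^sub>R \<partial> p h (great_circle p u t)) has_vector_derivative \<partial> p h p) (at 0)"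
    using has_vector_derivative_scaleR[OF DERIV_sin d[of p]] by simp
  ultimately show ?thesis by (rule has_vector_derivative_diff)
qed

lemma has_real_derivative_inner:
  assumes "(f has_vector_derivative f') (at t)" "(g has_vector_derivative g') (at t)"
  shows "((\<lambda>t. f t \<bullet> g t) has_real_derivative (f t \<bullet> g' + f' \<bullet> g t)) (at t)"
  using bounded_bilinear.has_vector_derivative[OF bounded_bilinear_inner assms]
  by (simp add: has_real_derivative_iff_has_vector_derivative)

lemma second_derivative_at_max:
  fixes \<phi> :: "real \<Rightarrow> real"
  assumes d: "\<And>t. (\<phi> has_real_derivative \<phi>' t) (at t)" and dd: "(\<phi>' has_real_derivative d) (at 0)"
    and m: "\<And>t. \<phi> t \<le> \<phi> 0"
  shows "\<phi>' 0 = 0" "d \<le> 0"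
proof -
  show z: "\<phi>' 0 = 0" by (rule DERIV_local_max[OF d, of 1]) (use m in auto)
  show "d \<le> 0"
  proof (rule ccontr)
    assume "\<not> d \<le> 0"
    then obtain r where r: "r > 0" "\<And>h. 0 < h \<Longrightarrow> h < r \<Longrightarrow> \<phi>' 0 < \<phi>' (0 + h)"
      using DERIV_pos_inc_right[OF dd] by force
    have "\<phi> 0 < \<phi> (r/2)"
    proof (rule DERIV_pos_imp_increasing_open[where f = \<phi>])
      show "\<exists>y. (\<phi> has_real_derivative y) (at x) \<and> 0 < y" if "0 < x" "x < r/2" for x
        using d[of x] r(2)[of x] that z by auto
      show "continuous_on {0..r/2} \<phi>" using d by (intro continuous_at_imp_continuous_on) (auto intro: DERIV_isCont)
    qed (use r in simp)
    then show False using m[of "r/2"] by simp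
  qed
qed

context
  fixes P P' :: "'n::finite \<Rightarrow> real \<Rightarrow> 'b::euclidean_space" and P'' :: "'n \<Rightarrow> 'b"
  assumes P: "\<And>i t. (P i has_vector_derivative P' i t) (at t)"
    and P': "\<And>i. (P' i has_vector_derivative P'' i) (at 0)"
begin

lemma sum_squares_derivative:
  "((\<lambda>t. \<Sum>i\<in>UNIV. P i t \<bullet> P i t) has_real_derivative (\<Sum>i\<in>UNIV. 2 * (P i t \<bullet> P' i t))) (at t)"
  by (rule DERIV_cong[OF DERIV_sum[OF has_real_derivative_inner[OF P P]]]) (simp add: inner_commute)

lemma sum_squares_second_derivative:
  "((\<lambda>t. \<Sum>i\<in>UNIV. 2 * (P i t \<bullet> P' i t)) has_real_derivative
      (\<Sum>i\<in>UNIV. 2 * (P' i 0 \<bullet> P' i 0 + P i 0 \<bullet> P'' i))) (at 0)"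
  by (rule DERIV_cong[OF DERIV_sum[OF DERIV_cmult[OF has_real_derivative_inner[OF P P']]]])
     (simp add: algebra_simps)

lemma sum_gram_squares_derivative:
  "((\<lambda>t. \<Sum>i\<in>UNIV. \<Sum>k\<in>UNIV. (P i t \<bullet> P k t)\<^sup>2) has_real_derivative
     (\<Sum>i\<in>UNIV. \<Sum>k\<in>UNIV. 2 * (P i t \<bullet> P k t) * (P i t \<bullet> P' k t + P' i t \<bullet> P k t))) (at t)"
  by (intro DERIV_sum DERIV_cong[OF DERIV_power[OF has_real_derivative_inner[OF P P]]]) simp

lemma sum_gram_squares_second_derivative:
  "((\<lambda>t. \<Sum>i\<in>UNIV. \<Sum>k\<in>UNIV. 2 * (P i t \<bullet> P k t) * (P i t \<bullet> P' k t + P' i t \<bullet> P k t)) has_real_derivative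
     (\<Sum>i\<in>UNIV. \<Sum>k\<in>UNIV. 2 * (P i 0 \<bullet> P' k 0 + P' i 0 \<bullet> P k 0)\<^sup>2
        + 2 * (P i 0 \<bullet> P k 0) * (P i 0 \<bullet> P'' k + P'' i \<bullet> P k 0 + 2 * (P' i 0 \<bullet> P' k 0)))) (at 0)"
  by (intro DERIV_sum DERIV_cong[OF DERIV_mult[OF DERIV_cmult[OF has_real_derivative_inner[OF P P]]
        DERIV_add[OF has_real_derivative_inner[OF P P'] has_real_derivative_inner[OF P' P]]]])
     (simp add: algebra_simps power2_eq_square inner_commute)

end

context harmonic_extension
begin

text \<open>Differentiate the harmonic map equation. The derivative of the energy multiplies \<open>F\<close> and
  disappears because \<open>F\<close> is orthogonal to its derivatives.\<close>

lemma laplacian_dir_deriv: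
  assumes x: "x \<noteq> 0"
  shows "laplacian (\<partial> v F) x \<bullet> \<partial> w F x = - energy F x * (\<partial> v F x \<bullet> \<partial> w F x)"
proof -
  have xx: "x \<in> - {0}" using x by simp
  note s2 = smooth_dir_deriv[OF smooth_dir_deriv[OF smooth_F]]
  have c: "\<partial> u (\<partial> u (\<partial> v F)) x = \<partial> v (\<partial> u (\<partial> u F)) x" for u
  proof -
    have "\<partial> u (\<partial> u (\<partial> v F)) x = \<partial> u (\<partial> v (\<partial> u F)) x"
      by (rule dir_deriv_cong[OF open_punctured _ xx]) (simp add: hessian_commute)
    also have "\<dots> = \<partial> v (\<partial> u (\<partial> u F)) x"
      by (rule dir_deriv_commute[OF open_punctured xx smooth_dir_deriv[OF smooth_F]])
    finally show ?thesis .
  qed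
  have se: "smooth (- {0}) (energy F)"
    unfolding energy_def
    by (intro smooth_sum[OF open_punctured] smooth_bilinear[OF bounded_bilinear_inner open_punctured]
        smooth_dir_deriv[OF smooth_F]) auto
  have "\<partial> v (laplacian F) x = (\<Sum>u\<in>Basis. \<partial> v (\<partial> u (\<partial> u F)) x)"
    unfolding laplacian_def
    by (rule dir_deriv_eq) (intro has_derivative_sum smooth_has_derivative[OF s2 xx])
  then have "laplacian (\<partial> v F) x = \<partial> v (laplacian F) x" by (simp add: laplacian_def c)
  also have "\<dots> = \<partial> v (\<lambda>x. - (energy F x *\<^sub>R F x)) x"
    by (rule dir_deriv_cong[OF open_punctured _ xx]) (simp add: laplacian_F)
  also have "\<dots> = - (energy F x *\<^sub>R \<partial> v F x + \<partial> v (energy F) x *\<^sub>R F x)"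
    by (rule dir_deriv_eq)
       (intro has_derivative_minus has_derivative_scaleR smooth_has_derivative[OF smooth_F xx]
         smooth_has_derivative[OF se xx])
  finally show ?thesis using F_orth[OF x, of w] by (simp add: inner_simps inner_commute)
qed

end

text \<open>Energy and quartic are followed along the three great circles through \<open>p\<close> in the directions
  \<open>e j\<close>, computed in the frame \<open>b\<close> that stays constant along the way. The sum over \<open>j\<close> of the second
  derivatives at \<open>p\<close> is the Laplacian of the sphere.\<close>

locale harmonic_at = harmonic_extension +
  fixes p :: "real^4" and e :: "3 \<Rightarrow> real^4"
  assumes p: "norm p = 1" and e: "orthonormal_basis_at p e"
begin

lemma p0: "p \<noteq> 0" "p \<in> - {0}" using p by auto

lemma e_unit: "norm (e j) = 1" "p \<bullet> e j = 0"
  using e unfolding orthonormal_basis_at_def tangent_space_def by (auto simp: norm_eq_sqrt_inner inner_commute)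

abbreviation b where "b \<equiv> tangent_frame p e"
abbreviation D where "D i \<equiv> \<partial> (b i) F p"
abbreviation H where "H j i \<equiv> \<partial> (e j) (\<partial> (b i) F) p"
abbreviation En where "En \<equiv> energy F p"

text \<open>The last summand of \<open>P'' j i\<close> is minus the radial derivative of \<open>\<partial> (b i) F\<close>, which is homogeneous of
  degree \<open>-1\<close>.\<close>

definition P where "P j i t = \<partial> (b i) F (great_circle p (e j) t)"
definition P' where "P' j i t = cos t *\<^sub>R \<partial> (e j) (\<partial> (b i) F) (great_circle p (e j) t)
     - sin t *\<^sub>R \<partial> p (\<partial> (b i) F) (great_circle p (e j) t)"
definition P'' where "P'' j i = \<partial> (e j) (\<partial> (e j) (\<partial> (b i) F)) p + D i"

lemma P_deriv: "(P j i has_vector_derivative P' j i t) (at t)"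
  unfolding P_def P'_def
  by (rule great_circle_has_vector_derivative[OF smooth_dir_deriv[OF smooth_F] p e_unit])

lemma P'_deriv: "(P' j i has_vector_derivative P'' j i) (at 0)"
  using great_circle_second_derivative[OF smooth_dir_deriv[OF smooth_F, of "b i"] p e_unit[of j]]
  unfolding P'_def[abs_def] P''_def dir_deriv2_radial[OF p0(1)] by simp

lemma P_0 [simp]: "P j i 0 = D i" and P'_0 [simp]: "P' j i 0 = H j i"
  by (simp_all add: P_def P'_def)

lemma frame: "orthoframe b"
  by (rule orthoframe_tangent_frame[OF e p])

lemma great_circle_nz: "great_circle p (e j) t \<in> - {0}"
  using norm_great_circle[OF p e_unit, of j t] by auto

lemma energy_great_circle: "energy F (great_circle p (e j) t) = (\<Sum>i\<in>UNIV. P j i t \<bullet> P j i t)"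
  unfolding P_def by (rule energy_orthoframe[OF frame _ smooth_F great_circle_nz]) simp

lemma quartic_great_circle: "quartic F (great_circle p (e j) t) = (\<Sum>i\<in>UNIV. \<Sum>k\<in>UNIV. (P j i t \<bullet> P j k t)\<^sup>2)"
  unfolding P_def by (rule quartic_orthoframe[OF frame _ smooth_F great_circle_nz]) simp

lemma En_eq: "En = (\<Sum>i\<in>UNIV. D i \<bullet> D i)"
  using energy_great_circle[of _ 0] by simp

lemma quartic_eq: "quartic F p = (\<Sum>i\<in>UNIV. \<Sum>k\<in>UNIV. (D i \<bullet> D k)\<^sup>2)"
  using quartic_great_circle[of _ 0] by simp

text \<open>The Laplacian of the sphere applied to the first derivatives. The frame has the radial direction in
  addition, with the second derivative \<open>2 D i\<close> by homogeneity; against the three acceleration terms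
  this leaves one summand \<open>D i\<close>.\<close>

lemma sum_P'': "(\<Sum>j\<in>UNIV. P'' j i) \<bullet> D k = (1 - En) * (D i \<bullet> D k)"
proof -
  have "laplacian (\<partial> (b i) F) p = (\<Sum>j\<in>UNIV. \<partial> (b j) (\<partial> (b j) (\<partial> (b i) F)) p)"
    by (rule laplacian_orthoframe[OF frame _ smooth_dir_deriv[OF smooth_F] open_punctured p0(2)]) simp
  then have "laplacian (\<partial> (b i) F) p = 2 *\<^sub>R D i + (\<Sum>j\<in>UNIV. \<partial> (e j) (\<partial> (e j) (\<partial> (b i) F)) p)"
    by (simp add: sum_3 sum_4 dir_deriv3_radial[OF p0(1)] add.assoc)
  moreover have "(\<Sum>j\<in>UNIV. P'' j i) = (\<Sum>j\<in>UNIV. \<partial> (e j) (\<partial> (e j) (\<partial> (b i) F)) p) + 3 *\<^sub>R D i"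
    by (simp add: P''_def sum.distrib sum_constant_scaleR del: sum_constant)
  moreover have "3 *\<^sub>R D i = 2 *\<^sub>R D i + D i" using scaleR_add_left[of 2 1 "D i"] by simp
  ultimately have "(\<Sum>j\<in>UNIV. P'' j i) = laplacian (\<partial> (b i) F) p + D i" by simp
  then show ?thesis using laplacian_dir_deriv[OF p0(1), of "b i" "b k"]
    by (simp add: inner_add_left algebra_simps)
qed

definition energy_d where "energy_d j = (\<Sum>i\<in>UNIV. 2 * (D i \<bullet> H j i))"
definition energy_dd where "energy_dd j = (\<Sum>i\<in>UNIV. 2 * (H j i \<bullet> H j i + D i \<bullet> P'' j i))"
definition quartic_d where
  "quartic_d j = (\<Sum>i\<in>UNIV. \<Sum>k\<in>UNIV. 2 * (D i \<bullet> D k) * (D i \<bullet> H j k + H j i \<bullet> D k))"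
definition quartic_dd where
  "quartic_dd j = (\<Sum>i\<in>UNIV. \<Sum>k\<in>UNIV. 2 * (D i \<bullet> H j k + H j i \<bullet> D k)\<^sup>2
        + 2 * (D i \<bullet> D k) * (D i \<bullet> P'' j k + P'' j i \<bullet> D k + 2 * (H j i \<bullet> H j k)))"

lemma sum_energy_dd:
  "(\<Sum>j\<in>UNIV. energy_dd j) = 2 * (\<Sum>j\<in>UNIV. \<Sum>i\<in>UNIV. H j i \<bullet> H j i) + 2 * (1 - En) * En"
proof -
  have "(\<Sum>j\<in>UNIV. \<Sum>i\<in>UNIV. D i \<bullet> P'' j i) = (\<Sum>i\<in>UNIV. (\<Sum>j\<in>UNIV. P'' j i) \<bullet> D i)"
    by (subst sum.swap) (simp add: inner_sum_left inner_commute[of "D i" "P'' j i" for i j])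
  also have "\<dots> = (1 - En) * En" by (simp add: sum_P'' En_eq sum_distrib_left)
  finally have 1: "(\<Sum>j\<in>UNIV. \<Sum>i\<in>UNIV. D i \<bullet> P'' j i) = (1 - En) * En" .
  have "(\<Sum>j\<in>UNIV. energy_dd j) = 2 * (\<Sum>j\<in>UNIV. \<Sum>i\<in>UNIV. H j i \<bullet> H j i)
      + 2 * (\<Sum>j\<in>UNIV. \<Sum>i\<in>UNIV. D i \<bullet> P'' j i)"
    by (simp only: energy_dd_def sum_distrib_left[symmetric] sum.distrib distrib_left)
  then show ?thesis by (simp add: 1)
qed

lemma sum_quartic_dd:
  "(\<Sum>j\<in>UNIV. quartic_dd j) =
     2 * (\<Sum>j\<in>UNIV. \<Sum>i\<in>UNIV. \<Sum>k\<in>UNIV. (D i \<bullet> H j k + H j i \<bullet> D k)\<^sup>2)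
   + 4 * (\<Sum>j\<in>UNIV. \<Sum>i\<in>UNIV. \<Sum>k\<in>UNIV. (D i \<bullet> D k) * (H j i \<bullet> H j k))
   + 4 * (1 - En) * quartic F p"
proof -
  have "(\<Sum>j\<in>UNIV. \<Sum>i\<in>UNIV. \<Sum>k\<in>UNIV. (D i \<bullet> D k) * (D i \<bullet> P'' j k + P'' j i \<bullet> D k))
     = (\<Sum>i\<in>UNIV. \<Sum>k\<in>UNIV. \<Sum>j\<in>UNIV. (D i \<bullet> D k) * (D i \<bullet> P'' j k + P'' j i \<bullet> D k))"
    by (subst sum.swap, rule sum.cong[OF refl], rule sum.swap)
  also have "\<dots> = (\<Sum>i\<in>UNIV. \<Sum>k\<in>UNIV. (D i \<bullet> D k) * ((\<Sum>j\<in>UNIV. P'' j k) \<bullet> D i + (\<Sum>j\<in>UNIV. P'' j i) \<bullet> D k))"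
    by (simp add: inner_sum_left sum_distrib_left sum.distrib distrib_left
        inner_commute[of "D i" "P'' j k" for i j k])
  also have "\<dots> = (\<Sum>i\<in>UNIV. \<Sum>k\<in>UNIV. (2 * (1 - En)) * (D i \<bullet> D k)\<^sup>2)"
    unfolding sum_P'' by (intro sum.cong refl) (simp add: power2_eq_square inner_commute algebra_simps)
  also have "\<dots> = 2 * (1 - En) * quartic F p" by (simp only: quartic_eq sum_distrib_left)
  finally have 1: "(\<Sum>j\<in>UNIV. \<Sum>i\<in>UNIV. \<Sum>k\<in>UNIV. (D i \<bullet> D k) * (D i \<bullet> P'' j k + P'' j i \<bullet> D k))
     = 2 * (1 - En) * quartic F p" .
  have "quartic_dd j = 2 * (\<Sum>i\<in>UNIV. \<Sum>k\<in>UNIV. (D i \<bullet> H j k + H j i \<bullet> D k)\<^sup>2)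
      + 2 * (\<Sum>i\<in>UNIV. \<Sum>k\<in>UNIV. (D i \<bullet> D k) * (D i \<bullet> P'' j k + P'' j i \<bullet> D k))
      + 4 * (\<Sum>i\<in>UNIV. \<Sum>k\<in>UNIV. (D i \<bullet> D k) * (H j i \<bullet> H j k))" for j
    unfolding quartic_dd_def sum_distrib_left sum.distrib[symmetric]
    by (intro sum.cong refl) (simp add: algebra_simps)
  then have "(\<Sum>j\<in>UNIV. quartic_dd j) = 
     2 * (\<Sum>j\<in>UNIV. \<Sum>i\<in>UNIV. \<Sum>k\<in>UNIV. (D i \<bullet> H j k + H j i \<bullet> D k)\<^sup>2)
   + 2 * (\<Sum>j\<in>UNIV. \<Sum>i\<in>UNIV. \<Sum>k\<in>UNIV. (D i \<bullet> D k) * (D i \<bullet> P'' j k + P'' j i \<bullet> D k))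
   + 4 * (\<Sum>j\<in>UNIV. \<Sum>i\<in>UNIV. \<Sum>k\<in>UNIV. (D i \<bullet> D k) * (H j i \<bullet> H j k))"
    by (simp only: sum.distrib sum_distrib_left[symmetric])
  then show ?thesis unfolding 1 by simp
qed

lemma energy_d: "((\<lambda>t. energy F (great_circle p (e j) t)) has_real_derivative (\<Sum>i\<in>UNIV. 2 * (P j i t \<bullet> P' j i t))) (at t)"
  and energy_dd: "((\<lambda>t. \<Sum>i\<in>UNIV. 2 * (P j i t \<bullet> P' j i t)) has_real_derivative energy_dd j) (at 0)"
  using sum_squares_derivative[where P = "P j" and P' = "P' j" and P'' = "P'' j", OF P_deriv P'_deriv]
    sum_squares_second_derivative[where P = "P j" and P' = "P' j" and P'' = "P'' j", OF P_deriv P'_deriv]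
  unfolding energy_great_circle energy_dd_def by simp_all

lemma quartic_d: "((\<lambda>t. quartic F (great_circle p (e j) t)) has_real_derivative
      (\<Sum>i\<in>UNIV. \<Sum>k\<in>UNIV. 2 * (P j i t \<bullet> P j k t) * (P j i t \<bullet> P' j k t + P' j i t \<bullet> P j k t))) (at t)"
  and quartic_dd: "((\<lambda>t. \<Sum>i\<in>UNIV. \<Sum>k\<in>UNIV. 2 * (P j i t \<bullet> P j k t) * (P j i t \<bullet> P' j k t + P' j i t \<bullet> P j k t))
      has_real_derivative quartic_dd j) (at 0)"
  using sum_gram_squares_derivative[where P = "P j" and P' = "P' j" and P'' = "P'' j", OF P_deriv P'_deriv]
    sum_gram_squares_second_derivative[where P = "P j" and P' = "P' j" and P'' = "P'' j", OF P_deriv P'_deriv]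
  unfolding quartic_great_circle quartic_dd_def by simp_all

lemma energy_d_0: "((\<lambda>t. energy F (great_circle p (e j) t)) has_real_derivative energy_d j) (at 0)"
  using energy_d[of j 0] by (simp add: energy_d_def)

lemma quartic_d_0: "((\<lambda>t. quartic F (great_circle p (e j) t)) has_real_derivative quartic_d j) (at 0)"
  using quartic_d[of j 0] by (simp add: quartic_d_def)

end

section \<open>The maximum principle\<close>

lemma three_frame:
  fixes n u w :: "real^3"
  assumes "n \<bullet> n = 1" "u \<bullet> u = 1" "w \<bullet> w = 1" "n \<bullet> u = 0" "n \<bullet> w = 0" "u \<bullet> w = 0"
  shows "x \<bullet> y = (x \<bullet> n) * (y \<bullet> n) + (x \<bullet> u) * (y \<bullet> u) + (x \<bullet> w) * (y \<bullet> w)"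
    and "x = (x \<bullet> n) *\<^sub>R n + (x \<bullet> u) *\<^sub>R u + (x \<bullet> w) *\<^sub>R w"
proof -
  define c :: "3 \<Rightarrow> real^3" where "c i = (if i = 1 then n else if i = 2 then u else w)" for i
  have "orthoframe c" unfolding orthoframe_def forall_3 c_def using assms by (simp add: inner_commute)
  from orthoframe_inner[OF this, of x y] orthoframe_expand[OF this, of x]
  show "x \<bullet> y = (x \<bullet> n) * (y \<bullet> n) + (x \<bullet> u) * (y \<bullet> u) + (x \<bullet> w) * (y \<bullet> w)"
    "x = (x \<bullet> n) *\<^sub>R n + (x \<bullet> u) *\<^sub>R u + (x \<bullet> w) *\<^sub>R w"
    by (simp_all add: sum_3 c_def)
qed

context harmonic_at
begin

abbreviation Hs where "Hs j k \<equiv> \<partial> (e j) (\<partial> (e k) F) p"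

lemma Hs_commute: "Hs j k = Hs k j"
  by (rule hessian_commute[OF p0(1)])

lemma H_radial: "\<partial> (e j) (\<partial> p F) p = - \<partial> (e j) F p"
  using hessian_commute[OF p0(1), of "e j" p] dir_deriv2_radial[OF p0(1)] by simp

lemma sum_Hs: "(\<Sum>j\<in>UNIV. Hs j j) = - En *\<^sub>R F p"
proof -
  have "laplacian F p = (\<Sum>j\<in>UNIV. \<partial> (b j) (\<partial> (b j) F) p)"
    by (rule laplacian_orthoframe[OF frame _ smooth_F open_punctured p0(2)]) simp
  then show ?thesis
    using laplacian_F[OF p0(1)] by (simp add: sum_3 sum_4 dir_deriv2_radial dir_deriv_radial p0)
qed

lemma En_eq3: "En = (\<Sum>j\<in>UNIV. \<partial> (e j) F p \<bullet> \<partial> (e j) F p)"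
  by (simp add: En_eq sum_3 sum_4 dir_deriv_radial p0)

text \<open>The Bochner formula for the energy density. In terms of the part \<open>B\<close> of the Hessian tangent to the
  target, whose remaining part is the first fundamental form, the right-hand side is
  \<open>2 (|B|\<^sup>2 + 2 (a\<^sup>2 + b\<^sup>2) - 2 a\<^sup>2 b\<^sup>2)\<close>: the Ricci curvature of the domain against the curvature of the
  target.\<close>

lemma bochner: "(\<Sum>j\<in>UNIV. energy_dd j) = 2 * (\<Sum>j\<in>UNIV. \<Sum>k\<in>UNIV. Hs j k \<bullet> Hs j k) + 4 * En - 2 * En\<^sup>2"
proof -
  have "(\<Sum>j\<in>UNIV. \<Sum>i\<in>UNIV. H j i \<bullet> H j i) = (\<Sum>j\<in>UNIV. \<Sum>k\<in>UNIV. Hs j k \<bullet> Hs j k) + En"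
    unfolding En_eq3 by (simp add: sum_3 sum_4 H_radial)
  then show ?thesis unfolding sum_energy_dd by (simp add: algebra_simps power2_eq_square)
qed

end

locale adapted_at = harmonic_at +
  assumes adapted: "adapted_basis F p e"
begin

definition "s1 = norm (\<partial> (e 1) F p)"
definition "s2 = norm (\<partial> (e 2) F p)"

lemma s_props: "0 \<le> s2" "s2 \<le> s1"
  using adapted by (auto simp: s1_def s2_def adapted_basis_def)

lemma gram: "\<partial> (e 1) F p \<bullet> \<partial> (e 1) F p = s1\<^sup>2" "\<partial> (e 2) F p \<bullet> \<partial> (e 2) F p = s2\<^sup>2"
  "\<partial> (e 3) F p = 0" "\<partial> (e 1) F p \<bullet> \<partial> (e 2) F p = 0" "\<partial> (e 2) F p \<bullet> \<partial> (e 1) F p = 0" "\<partial> p F p = 0"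
  using adapted dir_deriv_radial[OF p0(1)]
  by (auto simp: s1_def s2_def adapted_basis_def dot_square_norm inner_commute)

lemma En_s: "En = s1\<^sup>2 + s2\<^sup>2"
  by (simp add: En_eq3 sum_3 gram)

lemma quartic_s: "quartic F p = s1^4 + s2^4"
  by (simp add: quartic_eq sum_4 gram)

lemma Hs_normal: "Hs j k \<bullet> F p = - (\<partial> (e j) F p \<bullet> \<partial> (e k) F p)"
  by (rule hessian_orth[OF p0(1)])

lemma unit_Fp: "F p \<bullet> F p = 1"
  by (rule unit_F[OF p0(1)])

text \<open>The right-hand side is what the normal components of the Hessian contribute.\<close>

lemma sum_Hs_lower: "s1^4 + s2^4 \<le> (\<Sum>j\<in>UNIV. \<Sum>k\<in>UNIV. Hs j k \<bullet> Hs j k)"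
proof -
  have c: "(x \<bullet> F p)\<^sup>2 \<le> x \<bullet> x" for x
    using Cauchy_Schwarz_ineq[of x "F p"] unit_Fp by simp
  have "s1^4 \<le> Hs 1 1 \<bullet> Hs 1 1" "s2^4 \<le> Hs 2 2 \<bullet> Hs 2 2"
    using c[of "Hs 1 1"] c[of "Hs 2 2"] unfolding Hs_normal gram by simp_all
  moreover have "0 \<le> Hs j k \<bullet> Hs j k" for j k by simp
  ultimately show ?thesis unfolding sum_3
    by (smt (verit))
qed

end

text \<open>Where the differential has rank two, the normalized images \<open>E1\<close>, \<open>E2\<close> of \<open>e 1\<close>, \<open>e 2\<close> complete \<open>F p\<close>
  to an orthonormal basis, and \<open>U\<close>, \<open>V\<close> are the components of the second fundamental form.\<close>

locale nondegenerate_at = adapted_at +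
  assumes s2_pos: "s2 > 0"
begin

lemma s1_pos: "s1 > 0" using s2_pos s_props by simp

definition "E1 = \<partial> (e 1) F p /\<^sub>R s1"
definition "E2 = \<partial> (e 2) F p /\<^sub>R s2"
definition "U j k = Hs j k \<bullet> E1"
definition "V j k = Hs j k \<bullet> E2"

lemma dF: "\<partial> (e 1) F p = s1 *\<^sub>R E1" "\<partial> (e 2) F p = s2 *\<^sub>R E2"
  using s1_pos s2_pos by (simp_all add: E1_def E2_def)

lemma E_frame: "F p \<bullet> F p = 1" "E1 \<bullet> E1 = 1" "E2 \<bullet> E2 = 1" "F p \<bullet> E1 = 0" "F p \<bullet> E2 = 0" "E1 \<bullet> E2 = 0"
  using s1_pos s2_pos gram F_orth[OF p0(1)] unit_Fp
  by (simp_all add: E1_def E2_def power2_eq_square inner_commute field_simps)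

lemmas E_inner = three_frame(1)[OF E_frame]
lemmas E_expand = three_frame(2)[OF E_frame]

lemma UV_sym: "U j k = U k j" "V j k = V k j"
  unfolding U_def V_def Hs_commute[of j k] by simp_all

lemma dF_Hs: "\<partial> (e 1) F p \<bullet> Hs j k = s1 * U j k" "\<partial> (e 2) F p \<bullet> Hs j k = s2 * V j k"
  "Hs j k \<bullet> \<partial> (e 1) F p = s1 * U j k" "Hs j k \<bullet> \<partial> (e 2) F p = s2 * V j k"
  by (simp_all add: dF U_def V_def inner_commute)

lemma Hs_norm: "Hs j k \<bullet> Hs j k = (\<partial> (e j) F p \<bullet> \<partial> (e k) F p)\<^sup>2 + (U j k)\<^sup>2 + (V j k)\<^sup>2"
  by (subst E_inner) (simp add: Hs_normal U_def V_def power2_eq_square)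

lemma UV_trace: "U 1 1 + U 2 2 + U 3 3 = 0" "V 1 1 + V 2 2 + V 3 3 = 0"
proof -
  have "(\<Sum>j\<in>UNIV. Hs j j) \<bullet> E1 = 0" "(\<Sum>j\<in>UNIV. Hs j j) \<bullet> E2 = 0"
    unfolding sum_Hs using E_frame by simp_all
  then show "U 1 1 + U 2 2 + U 3 3 = 0" "V 1 1 + V 2 2 + V 3 3 = 0"
    by (simp_all add: U_def V_def sum_3 inner_add_left)
qed

lemma energy_d_eq: "energy_d j = 2 * (s1 * U j 1 + s2 * V j 2)"
  by (simp add: energy_d_def sum_4 gram dF_Hs)

lemma quartic_d_eq: "quartic_d j = 4 * (s1^3 * U j 1 + s2^3 * V j 2)"
  by (simp add: quartic_d_def sum_4 gram dF_Hs power2_eq_square power3_eq_cube algebra_simps)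

text \<open>The gradients of \<open>a\<^sup>2 + b\<^sup>2\<close> and of \<open>a\<^sup>4 + b\<^sup>4\<close> are independent combinations of those of \<open>a\<^sup>2\<close> and
  \<open>b\<^sup>2\<close> as long as \<open>a > b > 0\<close>.\<close>

lemma critical_hessian:
  assumes ne: "s2 < s1" and d: "\<And>j. energy_d j = 0" "\<And>j. quartic_d j = 0"
  shows "U j 1 = 0" "V j 2 = 0"
proof -
  have 1: "s1 * U j 1 + s2 * V j 2 = 0" using d(1)[of j] by (simp add: energy_d_eq)
  have 2: "s1^3 * U j 1 + s2^3 * V j 2 = 0" using d(2)[of j] by (simp add: quartic_d_eq)
  have "s1 * (s1\<^sup>2 - s2\<^sup>2) * U j 1 = (s1^3 * U j 1 + s2^3 * V j 2) - s2\<^sup>2 * (s1 * U j 1 + s2 * V j 2)"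
    by (simp add: algebra_simps power2_eq_square power3_eq_cube)
  then have "s1 * (s1\<^sup>2 - s2\<^sup>2) * U j 1 = 0" using 1 2 by simp
  moreover have "s1\<^sup>2 - s2\<^sup>2 > 0" using ne s_props by (simp add: power_strict_mono)
  ultimately show u: "U j 1 = 0" using s1_pos by auto
  show "V j 2 = 0" using 1 u s2_pos by simp
qed

text \<open>The left-hand side is the Laplacian of \<open>2 Q - E\<^sup>2\<close> at a critical point of \<open>E\<close> and \<open>Q\<close>. By symmetry and
  the harmonic map equation only \<open>U 2 2\<close>, \<open>U 2 3\<close>, \<open>V 1 1\<close> and \<open>V 1 3\<close> are left, up to sign. The
  indefinite-looking terms in \<open>U 2 3\<close> and \<open>V 1 3\<close> combine to a complete square, which is what makes
  the maximum principle work.\<close>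

lemma critical_laplacian:
  assumes ne: "s2 < s1" and d: "\<And>j. energy_d j = 0" "\<And>j. quartic_d j = 0"
  shows "2 * (\<Sum>j\<in>UNIV. quartic_dd j) - 2 * En * (\<Sum>j\<in>UNIV. energy_dd j)
     = 8 * (s1\<^sup>2 - s2\<^sup>2)\<^sup>2 + 8 * (s2\<^sup>2 * (V 1 1)\<^sup>2 + s1\<^sup>2 * (U 2 2)\<^sup>2 + (s1 * U 2 3 + s2 * V 1 3)\<^sup>2)"
proof -
  note z = critical_hessian[OF ne d]
  have z': "U 1 j = 0" "V 2 j = 0" for j using z[of j] UV_sym by simp_all
  have t: "U 3 3 = - U 2 2" "V 3 3 = - V 1 1" using UV_trace z z' by auto
  have sy: "U 3 2 = U 2 3" "V 3 1 = V 1 3" using UV_sym by auto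
  have A: "(\<Sum>j\<in>UNIV. \<Sum>i\<in>UNIV. \<Sum>k\<in>UNIV. (D i \<bullet> H j k + H j i \<bullet> D k)\<^sup>2)
     = 2 * (s2 * V 1 1)\<^sup>2 + 2 * (s1^4 + (s2 * V 1 3)\<^sup>2) + 2 * (s1 * U 2 2)\<^sup>2 + 2 * (s2^4 + (s1 * U 2 3)\<^sup>2)
       + 2 * (s1 * U 2 3 + s2 * V 1 3)\<^sup>2 + 2 * ((s1 * U 2 2)\<^sup>2 + (s2 * V 1 1)\<^sup>2)"
    by (simp add: sum_3 sum_4 gram H_radial dF_Hs z z' t sy power_mult_distrib
        add.commute[of "s2 * V 1 3"])
  have B: "(\<Sum>j\<in>UNIV. \<Sum>i\<in>UNIV. \<Sum>k\<in>UNIV. (D i \<bullet> D k) * (H j i \<bullet> H j k))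
     = s1\<^sup>2 * (s1^4 + (V 1 1)\<^sup>2 + (V 1 3)\<^sup>2) + s2\<^sup>2 * (s2^4 + (U 2 2)\<^sup>2 + (U 2 3)\<^sup>2)"
    by (simp add: sum_3 sum_4 gram H_radial Hs_norm z z' t sy power_mult_distrib algebra_simps)
  have C: "(\<Sum>j\<in>UNIV. \<Sum>k\<in>UNIV. Hs j k \<bullet> Hs j k)
     = s1^4 + s2^4 + 2 * ((V 1 1)\<^sup>2 + (V 1 3)\<^sup>2 + (U 2 2)\<^sup>2 + (U 2 3)\<^sup>2)"
    by (simp add: sum_3 gram Hs_norm z z' t sy)
  show ?thesis
    unfolding sum_quartic_dd bochner A B C quartic_s En_s
    by (simp add: algebra_simps power2_eq_square power4_eq_xxxx)
qed

end

context harmonic_extension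
begin

lemma continuous_energy: "continuous_on (- {0}) (energy F)"
  and continuous_quartic: "continuous_on (- {0}) (quartic F)"
  unfolding energy_def[abs_def] quartic_def[abs_def]
  by (intro continuous_intros smooth_continuous_on[OF smooth_dir_deriv[OF smooth_F]])+

lemma adapted_atI: "norm p = 1 \<Longrightarrow> adapted_basis F p e \<Longrightarrow> adapted_at F p e"
  by unfold_locales (auto simp: adapted_basis_def)

lemma sphere_max:
  assumes "continuous_on (- {0}) (h :: real^4 \<Rightarrow> real)"
  obtains p e where "norm p = 1" "adapted_basis F p e" "\<And>x. norm x = 1 \<Longrightarrow> h x \<le> h p"
proof -
  have "continuous_on usphere h" by (rule continuous_on_subset[OF assms]) auto
  moreover have "usphere \<noteq> ({} :: (real^4) set)" by simp
  ultimately obtain p where p: "p \<in> usphere" "\<And>x. x \<in> usphere \<Longrightarrow> h x \<le> h p"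
    using continuous_attains_sup[of "usphere :: (real^4) set" h] by auto
  moreover obtain e where "adapted_basis F p e"
    using exists_adapted_basis[OF sphere_extension_axioms, of p] p by auto
  ultimately show thesis by (intro that[of p e]) auto
qed

text \<open>If the energy is constant, the Bochner formula reads \<open>2 a\<^sup>2 b\<^sup>2 = |B|\<^sup>2 + 2 E > 0\<close>. If \<open>E\<^sup>2 - Q = 2 a\<^sup>2 b\<^sup>2\<close>
  is constant, a zero of \<open>b\<close> makes it vanish everywhere; then at a maximum of \<open>E\<close> the formula gives
  \<open>|B|\<^sup>2 + 2 E \<le> 0\<close>, so \<open>E\<close> vanishes.\<close>

lemma nondegenerate:
  assumes nonconst: "\<exists>x. norm x = 1 \<and> energy F x \<noteq> 0"
    and const: "(\<exists>c. \<forall>x. norm x = 1 \<longrightarrow> energy F x = c) \<or> (\<exists>d. \<forall>x. norm x = 1 \<longrightarrow> (energy F x)\<^sup>2 - quartic F x = d)"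
    and p: "norm p = 1" and e: "adapted_basis F p e"
  shows "nondegenerate_at F p e"
proof -
  interpret adapted_at F p e by (rule adapted_atI[OF p e])
  have epos: "energy F x \<ge> 0" for x unfolding energy_def by (intro sum_nonneg) simp
  have "s2 \<noteq> 0"
  proof
    assume s2: "s2 = 0"
    from const show False
    proof (elim disjE exE)
      fix c assume c: "\<forall>x. norm x = 1 \<longrightarrow> energy F x = c"
      then have c0: "En > 0" using nonconst p epos[of p] by auto
      have "energy_dd j = 0" for j
      proof -
        have k: "energy F (great_circle p (e j) t) = c" for t
          using c norm_great_circle[OF p e_unit] by simp
        have "(\<Sum>i\<in>UNIV. 2 * (P j i t \<bullet> P' j i t)) = 0" for t
          using energy_d[of j t] unfolding k using DERIV_unique DERIV_const by blast
        then show ?thesis using energy_dd[of j] DERIV_unique[OF _ DERIV_const] by simp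
      qed
      then have "2 * (\<Sum>j\<in>UNIV. \<Sum>k\<in>UNIV. Hs j k \<bullet> Hs j k) + 4 * En - 2 * En\<^sup>2 = 0"
        using bochner by simp
      moreover have "En\<^sup>2 = s1^4 + s2^4" using s2 by (simp add: En_s)
      ultimately show False using sum_Hs_lower c0 by simp
    next
      fix d assume d: "\<forall>x. norm x = 1 \<longrightarrow> (energy F x)\<^sup>2 - quartic F x = d"
      have "d = 0" using d p s2 by (force simp: En_s quartic_s)
      obtain p' e' where m: "norm p' = 1" "adapted_basis F p' e'" "\<And>x. norm x = 1 \<Longrightarrow> energy F x \<le> energy F p'"
        using sphere_max[OF continuous_energy] by blast
      interpret M: adapted_at F p' e' by (rule adapted_atI[OF m(1,2)])
      have "M.energy_dd j \<le> 0" for j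
        by (rule second_derivative_at_max(2)[OF M.energy_d M.energy_dd])
           (use m(3) norm_great_circle[OF m(1) M.e_unit] in simp)
      then have "(\<Sum>j\<in>UNIV. M.energy_dd j) \<le> 0" by (intro sum_nonpos)
      then have "2 * (M.s1^4 + M.s2^4) + 4 * energy F p' - 2 * (energy F p')\<^sup>2 \<le> 0"
        using M.bochner M.sum_Hs_lower by simp
      moreover have "(energy F p')\<^sup>2 = M.s1^4 + M.s2^4" using d m(1) \<open>d = 0\<close> M.quartic_s by force
      ultimately have "energy F p' \<le> 0" by simp
      then show False using nonconst m(3) epos by (metis order_antisym_conv order_trans)
    qed
  qed
  then show ?thesis using s_props by unfold_locales auto
qed

text \<open>At a maximum of \<open>v\<close> the gradient of \<open>v = 2 Q - E\<^sup>2\<close> vanishes. Since \<open>E\<close> or \<open>E\<^sup>2 - Q\<close> is constant, the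
  gradients of \<open>E\<close> and \<open>Q\<close> vanish as well, and the previous computation of the Laplacian of \<open>v\<close>
  excludes \<open>a > b\<close>. So \<open>v = 0\<close> on the whole sphere.\<close>

lemma constant_dilation:
  assumes nonconst: "\<exists>x. norm x = 1 \<and> energy F x \<noteq> 0"
    and const: "(\<exists>c. \<forall>x. norm x = 1 \<longrightarrow> energy F x = c) \<or> (\<exists>d. \<forall>x. norm x = 1 \<longrightarrow> (energy F x)\<^sup>2 - quartic F x = d)"
  shows "\<exists>l>0. \<forall>p e. norm p = 1 \<longrightarrow> adapted_basis F p e \<longrightarrow>
     norm (\<partial> (e 1) F p) = l \<and> norm (\<partial> (e 2) F p) = l"
proof -
  note nd = nondegenerate[OF nonconst const]
  define v where "v x = 2 * quartic F x - (energy F x)\<^sup>2" for x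
  have "continuous_on (- {0}) v"
    unfolding v_def by (intro continuous_intros continuous_energy continuous_quartic)
  then obtain p e where m: "norm p = 1" "adapted_basis F p e" "\<And>x. norm x = 1 \<Longrightarrow> v x \<le> v p"
    using sphere_max by blast
  interpret nondegenerate_at F p e by (rule nd[OF m(1,2)])
  have v_eq: "v q = ((norm (\<partial> (c 1) F q))\<^sup>2 - (norm (\<partial> (c 2) F q))\<^sup>2)\<^sup>2"
    if "norm q = 1" "adapted_basis F q c" for q c
    unfolding v_def adapted_energy[OF sphere_extension_axioms that] adapted_quartic[OF sphere_extension_axioms that]
    by (simp add: algebra_simps power2_eq_square power4_eq_xxxx)
  have "\<not> s2 < s1"
  proof
    assume ne: "s2 < s1"
    have Epos: "En > 0" using s1_pos s2_pos by (simp add: En_s add_pos_pos)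
    let ?E = "\<lambda>j t. energy F (great_circle p (e j) t)"
    let ?Q = "\<lambda>j t. quartic F (great_circle p (e j) t)"
    let ?E' = "\<lambda>j t. \<Sum>i\<in>UNIV. 2 * (P j i t \<bullet> P' j i t)"
    let ?Q' = "\<lambda>j t. \<Sum>i\<in>UNIV. \<Sum>k\<in>UNIV. 2 * (P j i t \<bullet> P j k t) * (P j i t \<bullet> P' j k t + P' j i t \<bullet> P j k t)"
    have d1: "((\<lambda>t. v (great_circle p (e j) t)) has_real_derivative 2 * ?Q' j t - 2 * (?E j t * ?E' j t)) (at t)" for j t
      unfolding v_def power2_eq_square
      by (rule DERIV_cong[OF DERIV_diff[OF DERIV_cmult[OF quartic_d] DERIV_mult[OF energy_d energy_d]]]) simp
    have d2: "((\<lambda>t. 2 * ?Q' j t - 2 * (?E j t * ?E' j t)) has_real_derivative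
        2 * quartic_dd j - 2 * ((energy_d j)\<^sup>2 + En * energy_dd j)) (at 0)" for j
      by (rule DERIV_cong[OF DERIV_diff[OF DERIV_cmult[OF quartic_dd] DERIV_cmult[OF DERIV_mult[OF energy_d energy_dd]]]])
         (simp add: energy_d_def power2_eq_square)
    have max: "v (great_circle p (e j) t) \<le> v (great_circle p (e j) 0)" for j t
      using m(3) norm_great_circle[OF m(1) e_unit] by simp
    have crit: "2 * quartic_d j - 2 * (En * energy_d j) = 0" for j
      using second_derivative_at_max(1)[OF d1[of j] d2[of j] max] by (simp add: energy_d_def quartic_d_def)
    have le: "2 * quartic_dd j - 2 * ((energy_d j)\<^sup>2 + En * energy_dd j) \<le> 0" for j
      by (rule second_derivative_at_max(2)[OF d1[of j] d2[of j] max])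
    \<comment> \<open>The constancy assumption is a second linear relation between the gradients of energy and quartic.\<close>
    have E0: "energy_d j = 0" for j
      using const
    proof (elim disjE exE)
      fix c assume c: "\<forall>x. norm x = 1 \<longrightarrow> energy F x = c"
      have k: "energy F (great_circle p (e j) t) = c" for t
        using c norm_great_circle[OF p e_unit] by simp
      show ?thesis using energy_d_0[of j] unfolding k using DERIV_unique DERIV_const by blast
    next
      fix d assume d: "\<forall>x. norm x = 1 \<longrightarrow> (energy F x)\<^sup>2 - quartic F x = d"
      have k: "?E j t * ?E j t - ?Q j t = d" for t
        using d norm_great_circle[OF p e_unit] by (simp add: power2_eq_square)
      have "((\<lambda>t. ?E j t * ?E j t - ?Q j t) has_real_derivative 2 * (En * energy_d j) - quartic_d j) (at 0)"
        by (rule DERIV_cong[OF DERIV_diff[OF DERIV_mult[OF energy_d_0 energy_d_0] quartic_d_0]]) simp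
      then have "2 * (En * energy_d j) - quartic_d j = 0" unfolding k using DERIV_unique DERIV_const by blast
      then have "En * energy_d j = 0" using crit[of j] by simp
      then show ?thesis using Epos by simp
    qed
    have Q0: "quartic_d j = 0" for j using crit[of j] E0[of j] by simp
    have "(\<Sum>j\<in>UNIV. 2 * quartic_dd j - 2 * ((energy_d j)\<^sup>2 + En * energy_dd j)) \<le> 0"
      by (rule sum_nonpos) (use le in simp)
    then have "2 * (\<Sum>j\<in>UNIV. quartic_dd j) - 2 * En * (\<Sum>j\<in>UNIV. energy_dd j) \<le> 0"
      by (simp add: E0 sum_subtractf sum_distrib_left mult.assoc)
    then have "8 * (s1\<^sup>2 - s2\<^sup>2)\<^sup>2 + 8 * (s2\<^sup>2 * (V 1 1)\<^sup>2 + s1\<^sup>2 * (U 2 2)\<^sup>2 + (s1 * U 2 3 + s2 * V 1 3)\<^sup>2) \<le> 0"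
      unfolding critical_laplacian[OF ne E0 Q0] .
    moreover have "0 < (s1\<^sup>2 - s2\<^sup>2)\<^sup>2" using ne s_props by (simp add: power_strict_mono)
    moreover have "0 \<le> s2\<^sup>2 * (V 1 1)\<^sup>2 + s1\<^sup>2 * (U 2 2)\<^sup>2 + (s1 * U 2 3 + s2 * V 1 3)\<^sup>2"
      by (intro add_nonneg_nonneg mult_nonneg_nonneg) simp_all
    moreover have False if "8 * x + 8 * y \<le> 0" "0 < x" "0 \<le> y" for x y :: real
      using that by linarith
    ultimately show False by blast
  qed
  then have ss: "s1 = s2" using s_props by simp
  then have "v p = 0" using v_eq[OF m(1,2)] by (simp add: s1_def s2_def)
  have iso: "norm (\<partial> (c 1) F q) = norm (\<partial> (c 2) F q)" if q: "norm q = 1" "adapted_basis F q c" for q c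
  proof -
    have "v q = 0" using m(3)[OF q(1)] \<open>v p = 0\<close> v_eq[OF q] by simp
    then have "(norm (\<partial> (c 1) F q))\<^sup>2 = (norm (\<partial> (c 2) F q))\<^sup>2" using v_eq[OF q] by simp
    then show ?thesis by (simp add: power2_eq_iff_nonneg)
  qed
  show ?thesis
  proof (intro exI[of _ s1] conjI allI impI)
    show "s1 > 0" by (rule s1_pos)
    fix q c assume q: "norm q = 1" "adapted_basis F q c"
    let ?a = "norm (\<partial> (c 1) F q)"
    have E: "energy F q = 2 * ?a\<^sup>2" "quartic F q = 2 * ?a^4" "En = 2 * s1\<^sup>2" "quartic F p = 2 * s1^4"
      using adapted_energy[OF sphere_extension_axioms q] adapted_quartic[OF sphere_extension_axioms q]
        iso[OF q] En_s quartic_s ss by simp_all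
    from const show "?a = s1"
    proof (elim disjE exE)
      fix k assume "\<forall>x. norm x = 1 \<longrightarrow> energy F x = k"
      then have "energy F q = En" using q m by simp
      then show ?thesis using E s1_pos by (simp add: power2_eq_iff_nonneg)
    next
      fix d assume "\<forall>x. norm x = 1 \<longrightarrow> (energy F x)\<^sup>2 - quartic F x = d"
      then have "(energy F q)\<^sup>2 - quartic F q = En\<^sup>2 - quartic F p" using q m by simp
      then have "?a^4 = s1^4" unfolding E by (simp add: power_mult_distrib)
      then show ?thesis using s1_pos by (simp add: power_eq_iff_eq_base)
    qed
    then show "norm (\<partial> (c 2) F q) = s1" using iso[OF q] by simp
  qed
qed

end

section \<open>Curves with constant curvature in the sphere\<close>

lemma vector_derivative_zero_constant:
  fixes h :: "real \<Rightarrow> 'b::real_normed_vector"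
  assumes "\<And>t. (h has_vector_derivative 0) (at t)"
  shows "h t = h 0"
proof -
  obtain c where "\<And>x. x \<in> UNIV \<Longrightarrow> h x = c"
    using has_vector_derivative_zero_constant[OF convex_UNIV, of h] assms by auto
  then show ?thesis by simp
qed

lemma has_vector_derivative_cmult:
  "(f has_vector_derivative f') F \<Longrightarrow> ((\<lambda>t. c *\<^sub>R f t) has_vector_derivative c *\<^sub>R f') F"
  by (rule bounded_linear.has_vector_derivative[OF bounded_linear_scaleR_right])

text \<open>The three combinations \<open>P\<close>, \<open>R\<close> and \<open>S\<close> in the proof are first integrals of the equation
  \<open>g''' = -w\<^sup>2 g'\<close>; solving for the curve is then linear algebra.\<close>

lemma third_order_oscillation:
  fixes g g1 g2 :: "real \<Rightarrow> 'b::real_normed_vector"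
  assumes g: "\<And>t. (g has_vector_derivative g1 t) (at t)"
    and g1: "\<And>t. (g1 has_vector_derivative g2 t) (at t)"
    and g2: "\<And>t. (g2 has_vector_derivative - (w\<^sup>2 *\<^sub>R g1 t)) (at t)"
    and w: "w > 0"
  shows "g1 t = cos (w * t) *\<^sub>R g1 0 + (sin (w * t) / w) *\<^sub>R g2 0"
    and "g t = g 0 + (sin (w * t) / w) *\<^sub>R g1 0 + ((1 - cos (w * t)) / w\<^sup>2) *\<^sub>R g2 0"
proof -
  have dc: "((\<lambda>t. cos (w * t)) has_real_derivative - (w * sin (w * t))) (at t)"
    and ds: "((\<lambda>t. sin (w * t)) has_real_derivative w * cos (w * t)) (at t)" for t
    by (auto intro!: derivative_eq_intros)
  define P where "P t = w *\<^sub>R (cos (w * t) *\<^sub>R g1 t) - sin (w * t) *\<^sub>R g2 t" for t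
  define R where "R t = w *\<^sub>R (sin (w * t) *\<^sub>R g1 t) + cos (w * t) *\<^sub>R g2 t" for t
  define S where "S t = w\<^sup>2 *\<^sub>R g t + g2 t" for t
  have "(P has_vector_derivative 0) (at t)" for t
    unfolding P_def
    by (rule has_vector_derivative_eq_rhs[OF has_vector_derivative_diff[OF
          has_vector_derivative_cmult[OF has_vector_derivative_scaleR[OF dc g1]]
          has_vector_derivative_scaleR[OF ds g2]]])
       (simp add: algebra_simps power2_eq_square)
  then have P: "P t = w *\<^sub>R g1 0" for t using vector_derivative_zero_constant[of P t] by (simp add: P_def)
  have "(R has_vector_derivative 0) (at t)" for t
    unfolding R_def
    by (rule has_vector_derivative_eq_rhs[OF has_vector_derivative_add[OF
          has_vector_derivative_cmult[OF has_vector_derivative_scaleR[OF ds g1]]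
          has_vector_derivative_scaleR[OF dc g2]]])
       (simp add: algebra_simps power2_eq_square)
  then have R: "R t = g2 0" for t using vector_derivative_zero_constant[of R t] by (simp add: R_def)
  have "(S has_vector_derivative 0) (at t)" for t
    unfolding S_def
    by (rule has_vector_derivative_eq_rhs[OF has_vector_derivative_add[OF has_vector_derivative_cmult[OF g] g2]])
       simp
  then have S: "S t = w\<^sup>2 *\<^sub>R g 0 + g2 0" for t using vector_derivative_zero_constant[of S t] by (simp add: S_def)
  have sc: "(sin x)\<^sup>2 + (cos x)\<^sup>2 = 1" for x :: real by simp
  have "cos (w * t) *\<^sub>R P t + sin (w * t) *\<^sub>R R t = (w * ((sin (w * t))\<^sup>2 + (cos (w * t))\<^sup>2)) *\<^sub>R g1 t"
    by (simp add: P_def R_def algebra_simps power2_eq_square del: sin_cos_squared_add sin_cos_squared_add3)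
  then have "w *\<^sub>R g1 t = cos (w * t) *\<^sub>R (w *\<^sub>R g1 0) + sin (w * t) *\<^sub>R g2 0"
    unfolding sc P R by simp
  then have "inverse w *\<^sub>R (w *\<^sub>R g1 t) = inverse w *\<^sub>R (cos (w * t) *\<^sub>R (w *\<^sub>R g1 0) + sin (w * t) *\<^sub>R g2 0)"
    by simp
  then show "g1 t = cos (w * t) *\<^sub>R g1 0 + (sin (w * t) / w) *\<^sub>R g2 0"
    using w by (simp add: scaleR_add_right field_simps)
  have "cos (w * t) *\<^sub>R R t - sin (w * t) *\<^sub>R P t = ((sin (w * t))\<^sup>2 + (cos (w * t))\<^sup>2) *\<^sub>R g2 t"
    by (simp add: P_def R_def algebra_simps power2_eq_square del: sin_cos_squared_add sin_cos_squared_add3)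
  then have "g2 t = cos (w * t) *\<^sub>R g2 0 - (w * sin (w * t)) *\<^sub>R g1 0"
    unfolding sc P R by (simp add: mult.commute)
  moreover have "w\<^sup>2 *\<^sub>R g t = w\<^sup>2 *\<^sub>R g 0 + g2 0 - g2 t"
    using S[of t] by (simp add: S_def eq_diff_eq)
  ultimately have "w\<^sup>2 *\<^sub>R g t = w\<^sup>2 *\<^sub>R g 0 + g2 0 - (cos (w * t) *\<^sub>R g2 0 - (w * sin (w * t)) *\<^sub>R g1 0)"
    by simp
  then have "w\<^sup>2 *\<^sub>R g t = w\<^sup>2 *\<^sub>R g 0 + (1 - cos (w * t)) *\<^sub>R g2 0 + (w * sin (w * t)) *\<^sub>R g1 0"
    by (simp add: algebra_simps)
  from arg_cong[OF this, of "\<lambda>z. inverse (w\<^sup>2) *\<^sub>R z"]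
  have "(inverse (w\<^sup>2) * w\<^sup>2) *\<^sub>R g t = (inverse (w\<^sup>2) * w\<^sup>2) *\<^sub>R g 0
      + (inverse (w\<^sup>2) * (1 - cos (w * t))) *\<^sub>R g2 0 + (inverse (w\<^sup>2) * (w * sin (w * t))) *\<^sub>R g1 0"
    by (simp only: scaleR_add_right scaleR_scaleR)
  then show "g t = g 0 + (sin (w * t) / w) *\<^sub>R g1 0 + ((1 - cos (w * t)) / w\<^sup>2) *\<^sub>R g2 0"
    using w by (simp add: divide_inverse power2_eq_square mult.commute mult.left_commute add.commute add.left_commute)
qed

text \<open>A curve on the unit sphere with constant squared speed \<open>m\<close> whose geodesic curvature vector \<open>h\<close> has
  constant length. The vectors \<open>g\<close>, \<open>g\<^sub>1\<close>, \<open>h\<close> are orthogonal with constant lengths, so they span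
  \<open>\<real>\<^sup>3\<close> unless one of them is zero, and the derivative of \<open>h\<close> is determined by its inner products with
  them, which are found by differentiating the orthogonality relations.\<close>

lemma helix_equation:
  fixes g g1 g2 :: "real \<Rightarrow> real^3"
  assumes g: "\<And>t. (g has_vector_derivative g1 t) (at t)"
    and g1: "\<And>t. (g1 has_vector_derivative g2 t) (at t)"
    and g2: "\<And>t. \<exists>d. (g2 has_vector_derivative d) (at t)"
    and unit: "\<And>t. g t \<bullet> g t = 1"
    and orth: "\<And>t. g1 t \<bullet> g2 t = 0"
    and len: "\<And>t. (g2 t + (g1 t \<bullet> g1 t) *\<^sub>R g t) \<bullet> (g2 t + (g1 t \<bullet> g1 t) *\<^sub>R g t) = K (g1 t \<bullet> g1 t) * (g1 t \<bullet> g1 t)"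
    and m: "m = g1 0 \<bullet> g1 0"
  shows "(g2 has_vector_derivative - ((K m + m) *\<^sub>R g1 t)) (at t)"
proof -
  have m_const: "g1 t \<bullet> g1 t = m" for t
  proof -
    have "((\<lambda>t. g1 t \<bullet> g1 t) has_vector_derivative 0) (at t)" for t
      using has_real_derivative_inner[OF g1 g1, of t] orth[of t]
      by (simp add: has_real_derivative_iff_has_vector_derivative inner_commute)
    from vector_derivative_zero_constant[of "\<lambda>t. g1 t \<bullet> g1 t", OF this] show ?thesis by (simp add: m)
  qed
  define h where "h t = g2 t + m *\<^sub>R g t" for t
  have hh: "h t \<bullet> h t = K m * m" for t using len[of t] by (simp add: h_def m_const)
  have gg1: "g t \<bullet> g1 t = 0" for t
  proof -
    have "((\<lambda>t. g t \<bullet> g t) has_real_derivative 2 * (g t \<bullet> g1 t)) (at t)"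
      by (rule DERIV_cong[OF has_real_derivative_inner[OF g g]]) (simp add: inner_commute)
    then have "2 * (g t \<bullet> g1 t) = 0" unfolding unit by (metis DERIV_unique DERIV_const)
    then show ?thesis by simp
  qed
  have gg2: "g t \<bullet> g2 t = - m" for t
  proof -
    have "((\<lambda>t. g t \<bullet> g1 t) has_real_derivative g t \<bullet> g2 t + m) (at t)"
      by (rule DERIV_cong[OF has_real_derivative_inner[OF g g1]]) (simp add: m_const)
    then have "g t \<bullet> g2 t + m = 0" unfolding gg1 by (metis DERIV_unique DERIV_const)
    then show ?thesis by simp
  qed
  have hg: "h t \<bullet> g t = 0" and hg1: "h t \<bullet> g1 t = 0" and hg2: "h t \<bullet> g2 t = K m * m" for t
  proof -
    show 1: "h t \<bullet> g t = 0" by (simp add: h_def inner_simps unit gg2 inner_commute[of "g2 t"])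
    show "h t \<bullet> g1 t = 0" by (simp add: h_def inner_simps gg1 orth inner_commute[of "g2 t"])
    have "g2 t = h t - m *\<^sub>R g t" by (simp add: h_def)
    then show "h t \<bullet> g2 t = K m * m" by (simp add: inner_diff_right hh 1)
  qed
  obtain d where d: "(g2 has_vector_derivative d) (at t)" using g2 by blast
  define h' where "h' = d + m *\<^sub>R g1 t"
  have h': "(h has_vector_derivative h') (at t)"
    unfolding h_def h'_def
    by (rule has_vector_derivative_add[OF d has_vector_derivative_cmult[OF g]])
  have "h' = - (K m *\<^sub>R g1 t)"
  proof (cases "K m * m = 0")
    case True
    then have "h = (\<lambda>t. 0)" using hh by auto
    then have "h' = 0" using h' vector_derivative_unique_at has_vector_derivative_const by metis
    moreover have "K m *\<^sub>R g1 t = 0" using True m_const[of t] by auto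
    ultimately show ?thesis by simp
  next
    case False
    have mp: "m > 0" using False m_const[of t] inner_ge_zero[of "g1 t"] by (auto simp: less_le)
    have cp: "K m * m > 0" using False hh[of t] inner_ge_zero[of "h t"] by (auto simp: less_le)
    have "((\<lambda>t. h t \<bullet> g t) has_real_derivative h' \<bullet> g t) (at t)"
      by (rule DERIV_cong[OF has_real_derivative_inner[OF h' g]]) (simp add: hg1)
    then have 1: "h' \<bullet> g t = 0" unfolding hg by (metis DERIV_unique DERIV_const)
    have "((\<lambda>t. h t \<bullet> g1 t) has_real_derivative K m * m + h' \<bullet> g1 t) (at t)"
      by (rule DERIV_cong[OF has_real_derivative_inner[OF h' g1]]) (simp add: hg2)
    then have "K m * m + h' \<bullet> g1 t = 0" unfolding hg1 by (metis DERIV_unique DERIV_const)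
    then have 2: "h' \<bullet> g1 t = - (K m * m)" by simp
    have "((\<lambda>t. h t \<bullet> h t) has_real_derivative 2 * (h' \<bullet> h t)) (at t)"
      by (rule DERIV_cong[OF has_real_derivative_inner[OF h' h']]) (simp add: inner_commute)
    then have "2 * (h' \<bullet> h t) = 0" unfolding hh by (metis DERIV_unique DERIV_const)
    then have 3: "h' \<bullet> h t = 0" by simp
    define c where "c = K m * m"
    have sq: "inverse (sqrt m) * (m * inverse (sqrt m)) = 1" using mp by (simp add: field_simps)
    have hc: "h t \<bullet> h t = c" and c: "c > 0" using hh cp by (simp_all add: c_def)
    have gh: "g t \<bullet> h t = 0" "g1 t \<bullet> h t = 0" using hg hg1 by (simp_all add: inner_commute)
    have "h' = (h' \<bullet> g t) *\<^sub>R g t + (h' \<bullet> (g1 t /\<^sub>R sqrt m)) *\<^sub>R (g1 t /\<^sub>R sqrt m) + (h' \<bullet> (h t /\<^sub>R sqrt c)) *\<^sub>R (h t /\<^sub>R sqrt c)"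
      by (rule three_frame(2))
         (use mp c in \<open>simp_all add: unit gg1 gh m_const hc field_simps\<close>)
    also have "\<dots> = (- (K m * m) / (sqrt m * sqrt m)) *\<^sub>R g1 t"
      using mp sq by (simp add: 1 2 3 divide_inverse mult.assoc)
    also have "\<dots> = - (K m *\<^sub>R g1 t)" using mp by simp
    finally show ?thesis .
  qed
  then have "d = - ((K m + m) *\<^sub>R g1 t)" by (simp add: h'_def algebra_simps eq_neg_iff_add_eq_0)
  then show ?thesis using d by simp
qed

section \<open>Horizontally conformal maps of constant dilation\<close>

locale conformal_extension = harmonic_extension +
  fixes l :: real
  assumes l_pos: "l > 0"
    and dilation: "norm p = 1 \<Longrightarrow> adapted_basis F p e \<Longrightarrow> norm (\<partial> (e 1) F p) = l"
      "norm p = 1 \<Longrightarrow> adapted_basis F p e \<Longrightarrow> norm (\<partial> (e 2) F p) = l"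
begin

lemma nondegenerate_atI:
  assumes "norm p = 1" "adapted_basis F p e"
  shows "nondegenerate_at F p e"
proof -
  interpret adapted_at F p e by (rule adapted_atI[OF assms])
  show ?thesis by unfold_locales (use dilation[OF assms] l_pos in \<open>simp add: s2_def\<close>)
qed

lemma energy_constant: assumes "norm x = 1" shows "energy F x = 2 * l\<^sup>2"
proof -
  obtain e where e: "adapted_basis F x e" using exists_adapted_basis[OF sphere_extension_axioms assms] by blast
  show ?thesis using adapted_energy[OF sphere_extension_axioms assms e] dilation[OF assms e] by simp
qed

text \<open>The matrix \<open>DF (DF)\<^sup>T\<close> is \<open>l\<^sup>2\<close> times the projection to the tangent space of the target. Unlike an
  adapted basis, this matrix can be differentiated.\<close>

lemma conformal:
  assumes x: "norm x = 1"
  shows "(\<Sum>u\<in>Basis. (\<partial> u F x \<bullet> Y) * (\<partial> u F x \<bullet> Z)) = l\<^sup>2 * (Y \<bullet> Z - (F x \<bullet> Y) * (F x \<bullet> Z))"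
proof -
  obtain e where ad: "adapted_basis F x e" using exists_adapted_basis[OF sphere_extension_axioms x] by blast
  interpret nondegenerate_at F x e by (rule nondegenerate_atI[OF x ad])
  have s: "s1 = l" "s2 = l" using dilation[OF x ad] by (simp_all add: s1_def s2_def)
  note li = smooth_linear_dir_deriv[OF smooth_F p0(2)]
  have m: "linear (\<lambda>w. L w * c)" "linear (\<lambda>w. c * L w)" if "linear L" for L :: "real^4 \<Rightarrow> real" and c
    using linear_inner_compose[OF that] linear_inner_compose_right[OF that] by simp_all
  have "(\<Sum>u\<in>Basis. (\<partial> u F x \<bullet> Y) * (\<partial> u F x \<bullet> Z)) = (\<Sum>i\<in>UNIV. (D i \<bullet> Y) * (D i \<bullet> Z))"
    by (rule trace_orthoframe[OF frame, where H = "\<lambda>u w. (\<partial> u F x \<bullet> Y) * (\<partial> w F x \<bullet> Z)"])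
       (simp, (intro m linear_inner_compose li)+)
  also have "\<dots> = l\<^sup>2 * ((E1 \<bullet> Y) * (E1 \<bullet> Z) + (E2 \<bullet> Y) * (E2 \<bullet> Z))"
    by (simp add: sum_4 gram dF s power2_eq_square algebra_simps)
  also have "\<dots> = l\<^sup>2 * (Y \<bullet> Z - (F x \<bullet> Y) * (F x \<bullet> Z))"
    using E_inner[of Y Z] by (simp add: inner_commute)
  finally show ?thesis .
qed

end

locale conformal_at = conformal_extension F l + nondegenerate_at F p e
  for F :: "real^4 \<Rightarrow> real^3" and l p e
begin

lemma s_l: "s1 = l" "s2 = l"
  using dilation[OF p adapted] by (simp_all add: s1_def s2_def)

text \<open>The conformality relation is written in the frame \<open>b\<close>, which does not move along the great circle.\<close>

lemma conformal_derivative: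
  "(\<Sum>i\<in>UNIV. (H j i \<bullet> Y) * (D i \<bullet> Z) + (D i \<bullet> Y) * (H j i \<bullet> Z))
     = - l\<^sup>2 * ((\<partial> (e j) F p \<bullet> Y) * (F p \<bullet> Z) + (F p \<bullet> Y) * (\<partial> (e j) F p \<bullet> Z))"
proof -
  let ?c = "great_circle p (e j)"
  have m: "linear (\<lambda>w. L w * c)" "linear (\<lambda>w. c * L w)" if "linear L" for L :: "real^4 \<Rightarrow> real" and c
    using linear_inner_compose[OF that] linear_inner_compose_right[OF that] by simp_all
  have eq: "(\<Sum>i\<in>UNIV. (P j i t \<bullet> Y) * (P j i t \<bullet> Z)) = l\<^sup>2 * (Y \<bullet> Z - (F (?c t) \<bullet> Y) * (F (?c t) \<bullet> Z))" for t
  proof -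
    note li = smooth_linear_dir_deriv[OF smooth_F great_circle_nz[of j t]]
    have "(\<Sum>u\<in>Basis. (\<partial> u F (?c t) \<bullet> Y) * (\<partial> u F (?c t) \<bullet> Z)) = (\<Sum>i\<in>UNIV. (P j i t \<bullet> Y) * (P j i t \<bullet> Z))"
      unfolding P_def
      by (rule trace_orthoframe[OF frame, where H = "\<lambda>u w. (\<partial> u F (?c t) \<bullet> Y) * (\<partial> w F (?c t) \<bullet> Z)"])
         (simp, (intro m linear_inner_compose li)+)
    then show ?thesis using conformal[OF norm_great_circle[OF p e_unit, of j t]] by simp
  qed
  have dP: "((\<lambda>t. P j i t \<bullet> Y) has_real_derivative H j i \<bullet> Y) (at 0)" for i Y
    by (rule DERIV_cong[OF has_real_derivative_inner[OF P_deriv has_vector_derivative_const]]) simp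
  have dF: "((\<lambda>t. F (?c t) \<bullet> Y) has_real_derivative \<partial> (e j) F p \<bullet> Y) (at 0)" for Y
    by (rule DERIV_cong[OF has_real_derivative_inner[OF
          great_circle_has_vector_derivative[OF smooth_F p e_unit] has_vector_derivative_const]]) simp
  have "((\<lambda>t. \<Sum>i\<in>UNIV. (P j i t \<bullet> Y) * (P j i t \<bullet> Z)) has_real_derivative
     (\<Sum>i\<in>UNIV. (H j i \<bullet> Y) * (D i \<bullet> Z) + (D i \<bullet> Y) * (H j i \<bullet> Z))) (at 0)"
    by (rule DERIV_cong[OF DERIV_sum[OF DERIV_mult[OF dP dP]]]) (simp add: algebra_simps)
  moreover have "((\<lambda>t. l\<^sup>2 * (Y \<bullet> Z - (F (?c t) \<bullet> Y) * (F (?c t) \<bullet> Z))) has_real_derivative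
     - l\<^sup>2 * ((\<partial> (e j) F p \<bullet> Y) * (F p \<bullet> Z) + (F p \<bullet> Y) * (\<partial> (e j) F p \<bullet> Z))) (at 0)"
    by (rule DERIV_cong[OF DERIV_cmult[OF DERIV_diff[OF DERIV_const DERIV_mult[OF dF dF]]]])
       (simp add: algebra_simps)
  ultimately show ?thesis unfolding eq by (rule DERIV_unique)
qed

definition "s = V 1 3"

text \<open>Differentiating the conformality relation gives \<open>U j 1 = V j 2 = 0\<close> and \<open>U j 2 + V j 1 = 0\<close>. With the
  symmetry of the Hessian and the vanishing of its trace only the mixed components with the kernel
  direction \<open>e 3\<close> survive. In geometric terms, the fibres are great circles.\<close>

lemma hessian_components: "U 1 1 = 0" "U 1 2 = 0" "U 1 3 = 0" "U 2 2 = 0" "U 2 3 = - s" "U 3 3 = 0"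
  "V 1 1 = 0" "V 1 2 = 0" "V 1 3 = s" "V 2 2 = 0" "V 2 3 = 0" "V 3 3 = 0"
  "U 2 1 = 0" "U 3 1 = 0" "U 3 2 = - s" "V 2 1 = 0" "V 3 1 = s" "V 3 2 = 0"
proof -
  have EE: "E2 \<bullet> E1 = 0" "E1 \<bullet> E2 = 0" "E1 \<bullet> E1 = 1" "E2 \<bullet> E2 = 1" "F p \<bullet> E1 = 0" "F p \<bullet> E2 = 0"
    using E_frame by (simp_all add: inner_commute)
  have U1: "U j 1 = 0" for j
    using conformal_derivative[of j E1 E1] l_pos
    by (simp add: sum_4 gram dF s_l EE) (simp add: U_def)
  have V2: "V j 2 = 0" for j
    using conformal_derivative[of j E2 E2] l_pos
    by (simp add: sum_4 gram dF s_l EE) (simp add: V_def)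
  have UV: "U j 2 + V j 1 = 0" for j
  proof -
    have "l * (U j 2 + V j 1) = 0"
      using conformal_derivative[of j E1 E2]
      by (simp add: sum_4 gram dF s_l EE U_def V_def algebra_simps)
    then show ?thesis using l_pos by simp
  qed
  have c: "U 1 j = 0" "V 2 j = 0" for j using U1[of j] V2[of j] UV_sym by simp_all
  have 1: "V 1 1 = 0" using UV[of 1] c by simp
  have 2: "U 2 2 = 0" using UV[of 2] U1 c by simp
  have 3: "U 3 2 = - V 3 1" using UV[of 3] by simp
  show "U 1 1 = 0" "U 1 2 = 0" "U 1 3 = 0" "U 2 2 = 0" "U 2 3 = - s" "U 3 3 = 0"
    "V 1 1 = 0" "V 1 2 = 0" "V 1 3 = s" "V 2 2 = 0" "V 2 3 = 0" "V 3 3 = 0"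
    "U 2 1 = 0" "U 3 1 = 0" "U 3 2 = - s" "V 2 1 = 0" "V 3 1 = s" "V 3 2 = 0"
    using U1 V2 c 1 2 3 UV_trace UV_sym(1)[of 3 2] UV_sym(2)[of 3 1] by (simp_all add: s_def)
qed

text \<open>The energy is constant, so the Bochner formula determines the length of the second fundamental form.\<close>

lemma s_square: "2 * s\<^sup>2 = l^4 - 2 * l\<^sup>2"
proof -
  have "energy_dd j = 0" for j
  proof -
    have k: "energy F (great_circle p (e j) t) = 2 * l\<^sup>2" for t
      by (rule energy_constant[OF norm_great_circle[OF p e_unit]])
    have "(\<Sum>i\<in>UNIV. 2 * (P j i t \<bullet> P' j i t)) = 0" for t
      using energy_d[of j t] unfolding k using DERIV_unique DERIV_const by blast
    then show ?thesis using energy_dd[of j] DERIV_unique[OF _ DERIV_const] by simp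
  qed
  then have "2 * (\<Sum>j\<in>UNIV. \<Sum>k\<in>UNIV. Hs j k \<bullet> Hs j k) + 4 * En - 2 * En\<^sup>2 = 0"
    using bochner by simp
  then show ?thesis
    by (simp add: sum_3 Hs_norm gram hessian_components En_s s_l algebra_simps power2_eq_square power4_eq_xxxx)
qed

lemma directional:
  fixes v :: "real^4"
  defines "x1 \<equiv> v \<bullet> e 1" and "x2 \<equiv> v \<bullet> e 2" and "x3 \<equiv> v \<bullet> e 3"
  assumes v: "v \<bullet> p = 0"
  shows "\<partial> v F p = (l * x1) *\<^sub>R E1 + (l * x2) *\<^sub>R E2"
    and "\<partial> v (\<partial> v F) p = - (l\<^sup>2 * (x1\<^sup>2 + x2\<^sup>2)) *\<^sub>R F p - (2 * s * x2 * x3) *\<^sub>R E1 + (2 * s * x1 * x3) *\<^sub>R E2"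
proof -
  note l1 = smooth_linear_dir_deriv[OF smooth_F p0(2)]
  note l2 = smooth_hessian_linear[OF smooth_F open_punctured p0(2)]
  have v_eq: "v = x1 *\<^sub>R e 1 + x2 *\<^sub>R e 2 + x3 *\<^sub>R e 3"
    using orthonormal_basis_expand_at[OF e p, of v] v by (simp add: x1_def x2_def x3_def)
  show "\<partial> v F p = (l * x1) *\<^sub>R E1 + (l * x2) *\<^sub>R E2"
    unfolding v_eq by (simp add: linear_add[OF l1] linear_cmul[OF l1] gram dF s_l mult.commute)
  have Hv: "\<partial> v (\<partial> v F) p = (x1 * x1) *\<^sub>R Hs 1 1 + (x2 * x2) *\<^sub>R Hs 2 2 + (x3 * x3) *\<^sub>R Hs 3 3
      + (x1 * x2) *\<^sub>R Hs 1 2 + (x1 * x2) *\<^sub>R Hs 1 2 + (x1 * x3) *\<^sub>R Hs 1 3 + (x1 * x3) *\<^sub>R Hs 1 3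
      + (x2 * x3) *\<^sub>R Hs 2 3 + (x2 * x3) *\<^sub>R Hs 2 3"
    unfolding v_eq linear_add[OF l2(1)] linear_add[OF l2(2)] linear_cmul[OF l2(1)] linear_cmul[OF l2(2)]
      Hs_commute[of 2 1] Hs_commute[of 3 1] Hs_commute[of 3 2]
    by (simp add: algebra_simps)
  let ?h = "\<partial> v (\<partial> v F) p"
  have "?h = (?h \<bullet> F p) *\<^sub>R F p + (?h \<bullet> E1) *\<^sub>R E1 + (?h \<bullet> E2) *\<^sub>R E2" by (rule E_expand)
  moreover have "?h \<bullet> F p = - (l\<^sup>2 * (x1\<^sup>2 + x2\<^sup>2))"
    unfolding Hv inner_add_left inner_scaleR_left Hs_normal
    by (simp add: gram s_l algebra_simps power2_eq_square)
  moreover have "?h \<bullet> E1 = - (2 * s * x2 * x3)" "?h \<bullet> E2 = 2 * s * x1 * x3"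
    unfolding Hv inner_add_left inner_scaleR_left U_def[symmetric] V_def[symmetric]
    by (simp_all add: hessian_components)
  ultimately show "?h = - (l\<^sup>2 * (x1\<^sup>2 + x2\<^sup>2)) *\<^sub>R F p - (2 * s * x2 * x3) *\<^sub>R E1 + (2 * s * x1 * x3) *\<^sub>R E2"
    by simp
qed

end

context conformal_extension
begin

text \<open>The previous formulas without reference to a basis. If \<open>c\<close> is the component of \<open>X\<close> along the kernel,
  then \<open>m = l\<^sup>2 (1 - c\<^sup>2)\<close>, so that the length of the second fundamental form is a function of the squared
  speed \<open>m\<close> only. This is what allows one to move along a great circle although the adapted bases
  change.\<close>

lemma second_fundamental_form:
  assumes p: "norm p = 1" and X: "norm X = 1" "p \<bullet> X = 0"
  defines "m \<equiv> \<partial> X F p \<bullet> \<partial> X F p"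
  shows "\<partial> X F p \<bullet> \<partial> X (\<partial> X F) p = 0"
    and "(\<partial> X (\<partial> X F) p + m *\<^sub>R F p) \<bullet> (\<partial> X (\<partial> X F) p + m *\<^sub>R F p) = 2 * (l\<^sup>2 - 2) * (1 - m / l\<^sup>2) * m"
proof -
  obtain e where ad: "adapted_basis F p e" using exists_adapted_basis[OF sphere_extension_axioms p] by blast
  interpret nondegenerate_at F p e by (rule nondegenerate_atI[OF p ad])
  interpret conformal_at F l p e by unfold_locales
  have Xp: "X \<bullet> p = 0" using X by (simp add: inner_commute)
  define x1 x2 x3 where "x1 = X \<bullet> e 1" and "x2 = X \<bullet> e 2" and "x3 = X \<bullet> e 3"
  note d = directional[OF Xp, folded x1_def x2_def x3_def]
  have EE: "E2 \<bullet> E1 = 0" "E1 \<bullet> E2 = 0" "E1 \<bullet> E1 = 1" "E2 \<bullet> E2 = 1" "F p \<bullet> E1 = 0" "F p \<bullet> E2 = 0"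
      "E1 \<bullet> F p = 0" "E2 \<bullet> F p = 0"
    using E_frame by (simp_all add: inner_commute)
  have m: "m = l\<^sup>2 * (x1\<^sup>2 + x2\<^sup>2)"
    unfolding m_def d by (simp add: inner_simps EE algebra_simps power2_eq_square)
  have "X \<bullet> X = x1\<^sup>2 + x2\<^sup>2 + x3\<^sup>2"
    using orthoframe_inner[OF frame, of X X] Xp by (simp add: sum_4 x1_def x2_def x3_def power2_eq_square)
  then have x: "x1\<^sup>2 + x2\<^sup>2 + x3\<^sup>2 = 1" using X by (simp add: dot_square_norm)
  show "\<partial> X F p \<bullet> \<partial> X (\<partial> X F) p = 0"
    unfolding d by (simp add: inner_simps EE)
  have "m / l\<^sup>2 = x1\<^sup>2 + x2\<^sup>2" using l_pos by (simp add: m)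
  then have x3: "1 - m / l\<^sup>2 = x3\<^sup>2" using x by simp
  have k: "\<partial> X (\<partial> X F) p + m *\<^sub>R F p = - (2 * s * x2 * x3) *\<^sub>R E1 + (2 * s * x1 * x3) *\<^sub>R E2"
    unfolding d m by simp
  have "(\<partial> X (\<partial> X F) p + m *\<^sub>R F p) \<bullet> (\<partial> X (\<partial> X F) p + m *\<^sub>R F p) = 2 * (2 * s\<^sup>2) * x3\<^sup>2 * (x1\<^sup>2 + x2\<^sup>2)"
    unfolding k by (simp add: inner_simps EE algebra_simps power2_eq_square)
  also have "\<dots> = 2 * (l\<^sup>2 - 2) * x3\<^sup>2 * m"
    unfolding s_square m by (simp add: algebra_simps power2_eq_square power4_eq_xxxx)
  finally show "(\<partial> X (\<partial> X F) p + m *\<^sub>R F p) \<bullet> (\<partial> X (\<partial> X F) p + m *\<^sub>R F p) = 2 * (l\<^sup>2 - 2) * (1 - m / l\<^sup>2) * m"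
    unfolding x3 .
qed

end

section \<open>Images of great circles\<close>

context sphere_extension
begin

lemma great_circle_velocity:
  assumes pX: "norm p = 1" "norm X = 1" "p \<bullet> X = 0"
  defines "c \<equiv> great_circle p X" and "c' \<equiv> \<lambda>t. cos t *\<^sub>R X - sin t *\<^sub>R p"
  shows "((\<lambda>t. F (c t)) has_vector_derivative \<partial> (c' t) F (c t)) (at t)"
    and "((\<lambda>t. \<partial> (c' t) F (c t)) has_vector_derivative \<partial> (c' t) (\<partial> (c' t) F) (c t)) (at t)"
    and "\<exists>d. ((\<lambda>t. \<partial> (c' t) (\<partial> (c' t) F) (c t)) has_vector_derivative d) (at t)"
proof -
  have nz: "c t \<in> - {0}" for t using norm_great_circle[OF pX, of t] by (auto simp: c_def)
  note l1 = smooth_linear_dir_deriv[OF smooth_F nz]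
  note l2 = smooth_hessian_linear[OF smooth_F open_punctured nz]
  note s1 = smooth_dir_deriv[OF smooth_F]
  note gd = great_circle_has_vector_derivative[OF _ pX, folded c_def]
  have g1: "\<partial> (c' t) F (c t) = cos t *\<^sub>R \<partial> X F (c t) - sin t *\<^sub>R \<partial> p F (c t)" for t
    by (simp add: c'_def linear_diff[OF l1] linear_cmul[OF l1])
  show "((\<lambda>t. F (c t)) has_vector_derivative \<partial> (c' t) F (c t)) (at t)"
    unfolding g1 by (rule gd[OF smooth_F])
  let ?A = "\<lambda>u t. cos t *\<^sub>R \<partial> X (\<partial> u F) (c t) - sin t *\<^sub>R \<partial> p (\<partial> u F) (c t)"
  have g2: "\<partial> (c' t) (\<partial> (c' t) F) (c t) = cos t *\<^sub>R ?A X t - sin t *\<^sub>R ?A p t" for t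
    unfolding c'_def linear_diff[OF l2(1)] linear_diff[OF l2(2)] linear_cmul[OF l2(1)] linear_cmul[OF l2(2)]
    using hessian_commute[of "c t" p X] nz[of t] by (simp add: algebra_simps)
  \<comment> \<open>The acceleration of the great circle is radial, so it does not contribute to the second derivative.\<close>
  have "cos t *\<^sub>R \<partial> p F (c t) + sin t *\<^sub>R \<partial> X F (c t) = \<partial> (cos t *\<^sub>R p + sin t *\<^sub>R X) F (c t)"
    by (simp add: linear_add[OF l1] linear_cmul[OF l1])
  also have "\<dots> = \<partial> (c t) F (c t)" by (simp add: c_def great_circle_def)
  also have "\<dots> = 0" using dir_deriv_radial nz by simp
  finally have rad: "cos t *\<^sub>R \<partial> p F (c t) + sin t *\<^sub>R \<partial> X F (c t) = 0" .
  show "((\<lambda>t. \<partial> (c' t) F (c t)) has_vector_derivative \<partial> (c' t) (\<partial> (c' t) F) (c t)) (at t)"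
    unfolding g1 g2
    by (rule has_vector_derivative_eq_rhs[OF has_vector_derivative_diff[OF
          has_vector_derivative_scaleR[OF DERIV_cos gd[OF s1]] has_vector_derivative_scaleR[OF DERIV_sin gd[OF s1]]]])
       (use rad in \<open>simp add: algebra_simps\<close>)
  have A: "\<exists>d. (?A u has_vector_derivative d) (at t)" for u
    by (rule exI) (rule has_vector_derivative_diff[OF
          has_vector_derivative_scaleR[OF DERIV_cos gd[OF smooth_dir_deriv[OF s1]]]
          has_vector_derivative_scaleR[OF DERIV_sin gd[OF smooth_dir_deriv[OF s1]]]])
  obtain a where a: "(?A X has_vector_derivative a) (at t)" using A by blast
  obtain b where b: "(?A p has_vector_derivative b) (at t)" using A by blast
  show "\<exists>d. ((\<lambda>t. \<partial> (c' t) (\<partial> (c' t) F) (c t)) has_vector_derivative d) (at t)"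
    unfolding g2
    by (rule exI) (rule has_vector_derivative_diff[OF
          has_vector_derivative_scaleR[OF DERIV_cos a] has_vector_derivative_scaleR[OF DERIV_sin b]])
qed

end

context conformal_extension
begin

text \<open>The squared speed \<open>m\<close> plus the factor \<open>K m\<close> by which it has to be multiplied to give the squared length
  of the tangential acceleration.\<close>

definition frequency2 :: "real \<Rightarrow> real" where
  "frequency2 m = 2 * (l\<^sup>2 - 2) * (1 - m / l\<^sup>2) + m"

text \<open>By the formulas for the second fundamental form at all points of the great circle, its image satisfies
  the assumptions of the helix equation.\<close>

lemma great_circle_image:
  assumes pX: "norm p = 1" "norm X = 1" "p \<bullet> X = 0"
    and w: "w > 0" "w\<^sup>2 = frequency2 (\<partial> X F p \<bullet> \<partial> X F p)"
  shows "\<partial> (cos t *\<^sub>R X - sin t *\<^sub>R p) F (great_circle p X t)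
      = cos (w * t) *\<^sub>R \<partial> X F p + (sin (w * t) / w) *\<^sub>R \<partial> X (\<partial> X F) p"
    and "F (great_circle p X t)
      = F p + (sin (w * t) / w) *\<^sub>R \<partial> X F p + ((1 - cos (w * t)) / w\<^sup>2) *\<^sub>R \<partial> X (\<partial> X F) p"
proof -
  define c where "c = great_circle p X"
  define c' where "c' t = cos t *\<^sub>R X - sin t *\<^sub>R p" for t
  define m where "m = \<partial> X F p \<bullet> \<partial> X F p"
  define K where "K m = 2 * (l\<^sup>2 - 2) * (1 - m / l\<^sup>2)" for m
  note d = great_circle_velocity[OF pX, folded c_def c'_def]
  have c0: "c 0 = p" "c' 0 = X" by (simp_all add: c_def c'_def)
  have XX: "X \<bullet> X = 1" "p \<bullet> p = 1" using pX by (simp_all add: dot_square_norm)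
  have nc: "norm (c t) = 1" for t unfolding c_def by (rule norm_great_circle[OF pX])
  have cnz: "c t \<noteq> 0" for t using nc[of t] by auto
  have "c' t = great_circle X (- p) t" for t by (simp add: c'_def great_circle_def)
  then have nc': "norm (c' t) = 1" for t
    using norm_great_circle[of X "- p" t] pX by (simp add: inner_commute)
  have cc': "c t \<bullet> c' t = 0" for t
    by (simp add: c_def c'_def great_circle_def inner_simps XX pX inner_commute[of X p])
  note sff = second_fundamental_form[OF nc nc' cc']
  have g2': "((\<lambda>t. \<partial> (c' t) (\<partial> (c' t) F) (c t)) has_vector_derivative
       - ((K m + m) *\<^sub>R \<partial> (c' t) F (c t))) (at t)" for t
    by (rule helix_equation[OF d(1,2,3) unit_F sff(1)])
       (use cnz in \<open>auto simp: m_def K_def c0 sff(2)\<close>)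
  have "w\<^sup>2 = K m + m" by (simp add: w(2) frequency2_def K_def m_def)
  then have g2: "((\<lambda>t. \<partial> (c' t) (\<partial> (c' t) F) (c t)) has_vector_derivative
       - (w\<^sup>2 *\<^sub>R \<partial> (c' t) F (c t))) (at t)" for t using g2' by simp
  show "\<partial> (cos t *\<^sub>R X - sin t *\<^sub>R p) F (great_circle p X t)
      = cos (w * t) *\<^sub>R \<partial> X F p + (sin (w * t) / w) *\<^sub>R \<partial> X (\<partial> X F) p"
    using third_order_oscillation(1)[OF d(1,2) g2 w(1), of t] unfolding c0 by (simp add: c_def c'_def)
  show "F (great_circle p X t)
      = F p + (sin (w * t) / w) *\<^sub>R \<partial> X F p + ((1 - cos (w * t)) / w\<^sup>2) *\<^sub>R \<partial> X (\<partial> X F) p"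
    using third_order_oscillation(2)[OF d(1,2) g2 w(1), of t] unfolding c0 by (simp add: c_def)
qed

text \<open>After the time \<open>2\<pi>\<close> the great circle returns with the same velocity, and the first and second
  derivatives of its image are orthogonal.\<close>

lemma frequency_integer:
  assumes pX: "norm p = 1" "norm X = 1" "p \<bullet> X = 0"
    and w: "w > 0" "w\<^sup>2 = frequency2 (\<partial> X F p \<bullet> \<partial> X F p)" and nz: "\<partial> X F p \<noteq> 0"
  shows "w \<in> \<int>"
proof -
  have "\<partial> X F p = cos (w * (2 * pi)) *\<^sub>R \<partial> X F p + (sin (w * (2 * pi)) / w) *\<^sub>R \<partial> X (\<partial> X F) p"
    using great_circle_image(1)[OF pX w, of "2 * pi"] by (simp add: great_circle_def)
  then have "\<partial> X F p \<bullet> \<partial> X F p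
      = \<partial> X F p \<bullet> (cos (w * (2 * pi)) *\<^sub>R \<partial> X F p + (sin (w * (2 * pi)) / w) *\<^sub>R \<partial> X (\<partial> X F) p)"
    by simp
  then have "cos (w * (2 * pi)) = 1"
    using second_fundamental_form(1)[OF pX] nz by (simp add: inner_add_right)
  then obtain n :: int where "w * (2 * pi) = of_int n * 2 * pi" using cos_one_2pi_int by blast
  then have "w = of_int n" by simp
  then show ?thesis by simp
qed

text \<open>For the direction \<open>X \<theta>\<close> between a horizontal vector and the kernel the squared frequency is
  \<open>l\<^sup>2 + (l\<^sup>2 - 4) sin\<^sup>2 \<theta>\<close>. Unless \<open>l = 2\<close> it takes different values for different \<open>\<theta>\<close> in an
  interval, which is impossible for uncountably many squares of integers.\<close>

lemma dilation_eq_2: "l = 2"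
proof (rule ccontr)
  assume "l \<noteq> 2"
  define p :: "real^4" where "p = axis 1 1"
  have p1: "norm p = 1" by (simp add: p_def)
  obtain e where ad: "adapted_basis F p e" using exists_adapted_basis[OF sphere_extension_axioms p1] by blast
  interpret nondegenerate_at F p e by (rule nondegenerate_atI[OF p1 ad])
  interpret conformal_at F l p e by unfold_locales
  define X where "X \<theta> = cos \<theta> *\<^sub>R e 1 + sin \<theta> *\<^sub>R e 3" for \<theta>
  have ee: "e i \<bullet> e j = (if i = j then 1 else 0)" "p \<bullet> e i = 0" "e i \<bullet> p = 0" for i j
    using e by (auto simp: orthonormal_basis_at_def tangent_space_def inner_commute)
  have X: "norm (X \<theta>) = 1" "p \<bullet> X \<theta> = 0" for \<theta>
  proof -
    show "norm (X \<theta>) = 1"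
      using norm_great_circle[of "e 1" "e 3" \<theta>] e_unit ee by (simp add: X_def great_circle_def)
    show "p \<bullet> X \<theta> = 0" by (simp add: X_def inner_simps ee)
  qed
  have dX: "\<partial> (X \<theta>) F p = (l * cos \<theta>) *\<^sub>R E1" for \<theta>
    using directional(1)[of "X \<theta>"] X(2)[of \<theta>] by (simp add: inner_commute[of _ p]) (simp add: X_def inner_simps ee)
  have l2: "l\<^sup>2 \<ge> 2"
  proof -
    have "l\<^sup>2 * (l\<^sup>2 - 2) = 2 * s\<^sup>2"
      unfolding s_square by (simp add: algebra_simps power2_eq_square power4_eq_xxxx)
    then have "0 \<le> l\<^sup>2 * (l\<^sup>2 - 2)" by simp
    then show ?thesis using l_pos by (simp add: zero_le_mult_iff)
  qed
  define f2 where "f2 \<theta> = frequency2 (\<partial> (X \<theta>) F p \<bullet> \<partial> (X \<theta>) F p)" for \<theta>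
  have f2: "f2 \<theta> = l\<^sup>2 * (cos \<theta>)\<^sup>2 + 2 * (l\<^sup>2 - 2) * (sin \<theta>)\<^sup>2" for \<theta>
  proof -
    have "\<partial> (X \<theta>) F p \<bullet> \<partial> (X \<theta>) F p = l\<^sup>2 * (cos \<theta>)\<^sup>2"
      using E_frame by (simp add: dX power2_eq_square)
    moreover have "1 - l\<^sup>2 * (cos \<theta>)\<^sup>2 / l\<^sup>2 = (sin \<theta>)\<^sup>2" using l_pos by (simp add: sin_squared_eq)
    ultimately show ?thesis by (simp add: f2_def frequency2_def)
  qed
  let ?I = "{0<..<pi/2}"
  have pos: "f2 \<theta> > 0" if "\<theta> \<in> ?I" for \<theta>
  proof -
    have "cos \<theta> > 0" using that by (intro cos_gt_zero) auto
    then have "l\<^sup>2 * (cos \<theta>)\<^sup>2 > 0" using l_pos by simp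
    moreover have "2 * (l\<^sup>2 - 2) * (sin \<theta>)\<^sup>2 \<ge> 0" using l2 by simp
    ultimately show ?thesis by (simp add: f2)
  qed
  have int: "sqrt (f2 \<theta>) \<in> \<int>" if t: "\<theta> \<in> ?I" for \<theta>
  proof (rule frequency_integer[OF p1 X])
    show "0 < sqrt (f2 \<theta>)" "(sqrt (f2 \<theta>))\<^sup>2 = frequency2 (\<partial> (X \<theta>) F p \<bullet> \<partial> (X \<theta>) F p)"
      using pos[OF t] by (simp_all add: f2_def)
    have "cos \<theta> > 0" using t by (intro cos_gt_zero) auto
    then show "\<partial> (X \<theta>) F p \<noteq> 0" using l_pos E_frame(2) by (auto simp: dX)
  qed
  have "inj_on (\<lambda>\<theta>. sqrt (f2 \<theta>)) ?I"
  proof (rule inj_onI)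
    fix x y assume x: "x \<in> ?I" and y: "y \<in> ?I" and "sqrt (f2 x) = sqrt (f2 y)"
    then have "f2 x = f2 y" by simp
    moreover have "f2 \<theta> = l\<^sup>2 + (l\<^sup>2 - 4) * (sin \<theta>)\<^sup>2" for \<theta>
      unfolding f2 cos_squared_eq by (simp add: algebra_simps)
    moreover have "l\<^sup>2 - 4 \<noteq> 0"
      using \<open>l \<noteq> 2\<close> l_pos power2_eq_iff_nonneg[of l 2] by simp
    ultimately have "(sin x)\<^sup>2 = (sin y)\<^sup>2" by simp
    moreover have "sin x > 0" "sin y > 0" using x y by (auto intro!: sin_gt_zero2)
    ultimately have "sin x = sin y" by (simp add: power2_eq_iff_nonneg)
    then show "x = y" using x y by (intro sin_inj_pi[of x y]) auto
  qed
  moreover have "countable ((\<lambda>\<theta>. sqrt (f2 \<theta>)) ` ?I)"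
    by (rule countable_subset[of _ \<int>]) (use int countable_int in auto)
  ultimately have "countable ?I" using countable_image_inj_on by blast
  then show False using uncountable_open_interval[of 0 "pi/2"] by simp
qed

end

lemma sphere_point_on_great_circle:
  fixes p y :: "'a::euclidean_space"
  assumes p: "norm p = 1" and u: "norm u = 1" "p \<bullet> u = 0" and y: "norm y = 1"
  obtains X t where "norm X = 1" "p \<bullet> X = 0" "y = great_circle p X t"
proof -
  define v where "v = y - (y \<bullet> p) *\<^sub>R p"
  \<comment> \<open>If \<open>y\<close> is \<open>p\<close> or \<open>- p\<close>, every great circle through \<open>p\<close> passes through \<open>y\<close>.\<close>
  define X where "X = (if v = 0 then u else v /\<^sub>R norm v)"
  have pp: "p \<bullet> p = 1" "y \<bullet> y = 1" using p y by (simp_all add: dot_square_norm)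
  have pv: "p \<bullet> v = 0" by (simp add: v_def inner_simps pp inner_commute)
  have X: "norm X = 1" "p \<bullet> X = 0" using u pv by (simp_all add: X_def)
  have vX: "v = norm v *\<^sub>R X" by (simp add: X_def)
  have "(norm v)\<^sup>2 = 1 - (y \<bullet> p)\<^sup>2"
    unfolding power2_norm_eq_inner v_def by (simp add: inner_simps pp inner_commute power2_eq_square)
  then have "(y \<bullet> p)\<^sup>2 + (norm v)\<^sup>2 = 1" by simp
  then obtain t where t: "y \<bullet> p = cos t" "norm v = sin t" using sincos_total_2pi by metis
  have "y = (y \<bullet> p) *\<^sub>R p + v" by (simp add: v_def)
  then have "y = great_circle p X t" unfolding great_circle_def using t vX by simp
  then show thesis using that X by blast
qed

context conformal_extension
begin

text \<open>The solution of the third order equation with frequency 2. By \<open>sin 2t = 2 sin t cos t\<close> and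
  \<open>1 - cos 2t = 2 sin\<^sup>2 t\<close> it becomes quadratic in the coordinates \<open>cos t\<close> and \<open>sin t X\<close> of the point.\<close>

lemma quadratic_formula:
  assumes p: "norm p = 1" and u: "norm u = 1" "p \<bullet> u = 0" and y: "norm y = 1"
  defines "v \<equiv> y - (y \<bullet> p) *\<^sub>R p"
  shows "F y = F p + (y \<bullet> p) *\<^sub>R \<partial> v F p + (1/2) *\<^sub>R \<partial> v (\<partial> v F) p"
proof -
  obtain X t where X: "norm X = 1" "p \<bullet> X = 0" and yX: "y = great_circle p X t"
    using sphere_point_on_great_circle[OF p u y] by blast
  have p0: "p \<in> - {0}" using p by auto
  note l1 = smooth_linear_dir_deriv[OF smooth_F p0]
  note l2 = smooth_hessian_linear[OF smooth_F open_punctured p0]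
  have yp: "y \<bullet> p = cos t" using p X by (simp add: yX great_circle_def inner_simps dot_square_norm inner_commute[of X])
  then have v: "v = sin t *\<^sub>R X" by (simp add: v_def yX great_circle_def)
  have w: "(0::real) < 2" "(2::real)\<^sup>2 = frequency2 (\<partial> X F p \<bullet> \<partial> X F p)"
    unfolding frequency2_def unfolding dilation_eq_2 by simp_all
  have "F y = F p + (sin (2 * t) / 2) *\<^sub>R \<partial> X F p + ((1 - cos (2 * t)) / 2\<^sup>2) *\<^sub>R \<partial> X (\<partial> X F) p"
    unfolding yX by (rule great_circle_image(2)[OF p X w])
  also have "sin (2 * t) / 2 = cos t * sin t" by (simp add: sin_double)
  also have "(1 - cos (2 * t)) / 2\<^sup>2 = (1/2) * (sin t * sin t)"
    by (simp add: cos_double_sin power2_eq_square)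
  finally show ?thesis
    unfolding v yp by (simp add: linear_cmul[OF l1] linear_cmul[OF l2(1)] linear_cmul[OF l2(2)])
qed

end

section \<open>The Hopf fibration\<close>

lemma smooth_on_sphere_linear:
  fixes T :: "'a::euclidean_space \<Rightarrow> 'b::euclidean_space"
  assumes T: "linear T" and eq: "\<And>x. x \<in> usphere \<Longrightarrow> f x = T x"
  shows "smooth_on_sphere f"
  unfolding smooth_on_sphere_def
  by (intro ballI exI[of _ UNIV] exI[of _ T]) (use eq Ck_on_linear[OF T] in auto)

lemma sphere_isometry_orthogonal_transformation:
  fixes T :: "'a::euclidean_space \<Rightarrow> 'a"
  assumes T: "orthogonal_transformation T"
  shows "sphere_isometry T"
proof -
  have l: "linear T" by (rule orthogonal_transformation_linear[OF T])
  have bij: "bij T" by (rule orthogonal_transformation_bij[OF T])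
  have Ti: "orthogonal_transformation (inv T)" by (rule orthogonal_transformation_inv[OF T])
  have n: "norm (T x) = norm x" "norm (inv T x) = norm x" for x
    by (rule orthogonal_transformation_norm[OF T], rule orthogonal_transformation_norm[OF Ti])
  have img: "T ` usphere = usphere"
  proof
    show "T ` usphere \<subseteq> usphere" using n by auto
    show "usphere \<subseteq> T ` usphere"
    proof
      fix y :: 'a assume y: "y \<in> usphere"
      have "y = T (inv T y)" using bij by (simp add: bij_is_surj surj_f_inv_f)
      moreover have "inv T y \<in> usphere" using y n by simp
      ultimately show "y \<in> T ` usphere" by (rule image_eqI)
    qed
  qed
  have inj: "inj T" by (rule bij_is_inj[OF bij])
  have bb: "bij_betw T usphere usphere"
    unfolding bij_betw_def using img inj inj_on_subset by blast
  have inv: "inv_into usphere T y = inv T y" if "y \<in> usphere" for y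
  proof -
    have "inv T y \<in> usphere" using that n by simp
    moreover have "y = T (inv T y)" using bij by (simp add: bij_is_surj surj_f_inv_f)
    ultimately show ?thesis using inv_into_f_f[OF bij_betw_imp_inj_on[OF bb], of "inv T y"] by simp
  qed
  have d: "differential T p v = T v" if p: "p \<in> usphere" and v: "v \<in> tangent_space p" for p v
  proof -
    have h: "(T has_derivative T) (at p)"
      by (simp add: l bounded_linear_imp_has_derivative linear_conv_bounded_linear[symmetric])
    have tv: "tangent_proj p v = v" using v by (simp add: tangent_proj_def tangent_space_def)
    have "differential T p v = \<partial> v T p"
      unfolding differential_def tv
      by (rule derivative_within_sphere[OF p v]) (use h in \<open>auto simp: differentiable_def\<close>)
    also have "\<dots> = T v" by (rule dir_deriv_eq[OF h])
    finally show ?thesis .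
  qed
  show ?thesis
    unfolding sphere_isometry_def
  proof (intro conjI ballI)
    show "bij_betw T usphere usphere" by (rule bb)
    show "smooth_on_sphere T" by (rule smooth_on_sphere_linear[OF l]) simp
    show "smooth_on_sphere (inv_into usphere T)"
      by (rule smooth_on_sphere_linear[OF orthogonal_transformation_linear[OF Ti] inv])
    fix p v w :: 'a assume "p \<in> usphere" "v \<in> tangent_space p" "w \<in> tangent_space p"
    then show "differential T p v \<bullet> differential T p w = v \<bullet> w"
      using T by (simp add: d orthogonal_transformation_def)
  qed
qed

context conformal_at
begin

lemma s_square_4: "s\<^sup>2 = 4"
  using s_square unfolding dilation_eq_2 by simp

lemma F_in_coordinates:
  fixes y :: "real^4"
  assumes y: "norm y = 1"
  defines "y0 \<equiv> y \<bullet> p" and "y1 \<equiv> y \<bullet> e 1" and "y2 \<equiv> y \<bullet> e 2" and "y3 \<equiv> y \<bullet> e 3"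
  shows "F y = (y0\<^sup>2 + y3\<^sup>2 - y1\<^sup>2 - y2\<^sup>2) *\<^sub>R F p + (2 * y0 * y1 - s * y2 * y3) *\<^sub>R E1 + (2 * y0 * y2 + s * y1 * y3) *\<^sub>R E2"
proof -
  define v where "v = y - y0 *\<^sub>R p"
  have pe: "p \<bullet> p = 1" "p \<bullet> e j = 0" for j using p e_unit by (simp_all add: dot_square_norm)
  have v: "v \<bullet> p = 0" "v \<bullet> e 1 = y1" "v \<bullet> e 2 = y2" "v \<bullet> e 3 = y3"
    by (simp_all add: v_def inner_diff_left pe y0_def y1_def y2_def y3_def)
  have "y \<bullet> y = y0\<^sup>2 + y1\<^sup>2 + y2\<^sup>2 + y3\<^sup>2"
    using orthoframe_inner[OF frame, of y y] by (simp add: sum_4 y0_def y1_def y2_def y3_def power2_eq_square)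
  then have 1: "y0\<^sup>2 + y1\<^sup>2 + y2\<^sup>2 + y3\<^sup>2 = 1" using y by (simp add: dot_square_norm)
  have 2: "y0\<^sup>2 + y3\<^sup>2 - y1\<^sup>2 - y2\<^sup>2 = 1 - 2 * (y1\<^sup>2 + y2\<^sup>2)" using 1 by simp
  have "F y = F p + y0 *\<^sub>R \<partial> v F p + (1/2) *\<^sub>R \<partial> v (\<partial> v F) p"
    unfolding v_def y0_def by (rule quadratic_formula[OF p e_unit(1)[of 1] e_unit(2)[of 1] y])
  also have "\<dots> = (1 - 2 * (y1\<^sup>2 + y2\<^sup>2)) *\<^sub>R F p + (2 * y0 * y1 - s * y2 * y3) *\<^sub>R E1 + (2 * y0 * y2 + s * y1 * y3) *\<^sub>R E2"
    unfolding directional[OF v(1)] v dilation_eq_2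
    by (simp add: scaleR_add_right scaleR_diff_right scaleR_add_left scaleR_diff_left algebra_simps)
  finally show ?thesis unfolding 2 .
qed

text \<open>The sign of \<open>s = 2\<close> or \<open>s = -2\<close> is an orientation. It is absorbed in the coordinate along the kernel, the
  second coordinate of \<open>\<phi>\<close>.\<close>

lemma hopf_form: "\<exists>\<phi> \<psi>. orthogonal_transformation \<phi> \<and> orthogonal_transformation \<psi> \<and>
    (\<forall>x. norm x = 1 \<longrightarrow> F x = \<psi> (hopf_map (\<phi> x)))"
proof (intro exI conjI allI impI)
  define \<phi> :: "real^4 \<Rightarrow> real^4" where "\<phi> y =
    (\<chi> i. if i = 1 then y \<bullet> p else if i = 2 then - (s/2) * (y \<bullet> e 3) else if i = 3 then y \<bullet> e 1 else y \<bullet> e 2)" for y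
  define \<psi> :: "real^3 \<Rightarrow> real^3" where "\<psi> z = (z $ 1) *\<^sub>R F p + (z $ 2) *\<^sub>R E1 + (z $ 3) *\<^sub>R E2" for z
  have s4: "s/2 * (s/2) = 1" using s_square_4 by (simp add: power2_eq_square)
  show "orthogonal_transformation \<phi>"
    unfolding orthogonal_transformation_def
  proof (intro conjI allI)
    show "linear \<phi>"
      by (rule linearI) (simp_all add: vec_eq_iff forall_4 \<phi>_def inner_add_left algebra_simps)
    fix x y
    have "\<phi> x \<bullet> \<phi> y = (x \<bullet> p) * (y \<bullet> p) + (s/2 * (s/2)) * ((x \<bullet> e 3) * (y \<bullet> e 3))
        + (x \<bullet> e 1) * (y \<bullet> e 1) + (x \<bullet> e 2) * (y \<bullet> e 2)"
      unfolding inner_vec_def sum_4 \<phi>_def by (simp add: algebra_simps)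
    then show "\<phi> x \<bullet> \<phi> y = x \<bullet> y"
      using orthoframe_inner[OF frame, of x y] unfolding s4 by (simp add: sum_4)
  qed
  show "orthogonal_transformation \<psi>"
    unfolding orthogonal_transformation_def
  proof (intro conjI allI)
    show "linear \<psi>" by (rule linearI) (simp_all add: \<psi>_def algebra_simps)
    fix x y :: "real^3"
    have "E1 \<bullet> F p = 0" "E2 \<bullet> F p = 0" "E2 \<bullet> E1 = 0" using E_frame by (simp_all add: inner_commute)
    then show "\<psi> x \<bullet> \<psi> y = x \<bullet> y"
      using E_frame by (simp add: \<psi>_def inner_simps inner_vec_def[of x y] sum_3)
  qed
  fix x :: "real^4" assume x: "norm x = 1"
  have "(- (s/2) * (x \<bullet> e 3))\<^sup>2 = (s/2 * (s/2)) * (x \<bullet> e 3)\<^sup>2" by (simp add: power2_eq_square)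
  then have sq: "(- (s/2) * (x \<bullet> e 3))\<^sup>2 = (x \<bullet> e 3)\<^sup>2" unfolding s4 by simp
  have "hopf_map (\<phi> x) $ 1 = (x \<bullet> p)\<^sup>2 + (x \<bullet> e 3)\<^sup>2 - (x \<bullet> e 1)\<^sup>2 - (x \<bullet> e 2)\<^sup>2"
    using sq by (simp add: hopf_map_def \<phi>_def)
  moreover have "hopf_map (\<phi> x) $ 2 = 2 * (x \<bullet> p) * (x \<bullet> e 1) - s * (x \<bullet> e 2) * (x \<bullet> e 3)"
    "hopf_map (\<phi> x) $ 3 = 2 * (x \<bullet> p) * (x \<bullet> e 2) + s * (x \<bullet> e 1) * (x \<bullet> e 3)"
    by (simp_all add: hopf_map_def \<phi>_def algebra_simps)
  ultimately show "F x = \<psi> (hopf_map (\<phi> x))"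
    unfolding F_in_coordinates[OF x] \<psi>_def by simp
qed

end

text \<open>Any two points lie on a great circle, along which the derivative vanishes.\<close>

lemma constant_of_zero_energy:
  fixes F :: "real^4 \<Rightarrow> real^3"
  assumes F: "sphere_extension F" and z: "\<And>x. norm x = 1 \<Longrightarrow> energy F x = 0"
    and x: "norm x = 1" and y: "norm y = 1"
  shows "F x = F y"
proof -
  interpret sphere_extension F by fact
  obtain e where e: "orthonormal_basis_at x e" using exists_tangent_frame[OF x] by blast
  have u: "norm (e 1) = 1" "x \<bullet> e 1 = 0"
    using e by (auto simp: orthonormal_basis_at_def tangent_space_def norm_eq_sqrt_inner inner_commute)
  obtain X t where X: "norm X = 1" "x \<bullet> X = 0" and yX: "y = great_circle x X t"
    using sphere_point_on_great_circle[OF x u y] by blast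
  have d0: "\<partial> v F q = 0" if q: "norm q = 1" for v q
  proof -
    have q0: "q \<in> - {0}" using q by auto
    note l = smooth_linear_dir_deriv[OF smooth_F q0]
    have "\<forall>u\<in>Basis. \<partial> u F q \<bullet> \<partial> u F q = 0"
      using z[OF q] unfolding energy_def by (subst (asm) sum_nonneg_eq_0_iff) auto
    then have b: "\<partial> u F q = 0" if "u \<in> Basis" for u using that by simp
    have "\<partial> v F q = \<partial> (\<Sum>u\<in>Basis. (v \<bullet> u) *\<^sub>R u) F q" by (simp add: euclidean_representation)
    also have "\<dots> = 0" by (simp add: linear_sum[OF l] linear_cmul[OF l] b del: euclidean_representation)
    finally show ?thesis .
  qed
  have "((\<lambda>t. F (great_circle x X t)) has_vector_derivative 0) (at t)" for t
    using great_circle_has_vector_derivative[OF smooth_F x X, of t] d0[OF norm_great_circle[OF x X]] by simp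
  from vector_derivative_zero_constant[of "\<lambda>t. F (great_circle x X t)" t, OF this] show ?thesis by (simp add: yX)
qed

theorem theorem4:
  fixes f :: "real^4 \<Rightarrow> real^3"
  assumes "harmonic f"
    and "\<not> f constant_on usphere"
    and "energy_density f constant_on usphere \<or> two_dilation f constant_on usphere"
  shows "hopf_fibration f"
proof -
  define F where "F = hom_ext f"
  interpret harmonic_extension F unfolding F_def by (rule harmonic_extension_hom_ext[OF assms(1)])
  note sph = sphere_extension_axioms
  have fF: "f x = F x" if "x \<in> usphere" for x using that by (simp add: F_def hom_ext_def)
  have nonconst: "\<exists>x. norm x = 1 \<and> energy F x \<noteq> 0"
  proof (rule ccontr)
    assume "\<not> ?thesis"
    then have eq: "F x = F (axis 1 1)" if "norm x = 1" for x
      using constant_of_zero_energy[OF sph, of x "axis 1 1"] that by simp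
    have "f x = F (axis 1 1)" if "x \<in> usphere" for x
      using fF[OF that] eq[of x] that by simp
    then have "f constant_on usphere" unfolding constant_on_def by blast
    then show False using assms(2) by simp
  qed
  have const: "(\<exists>c. \<forall>x. norm x = 1 \<longrightarrow> energy F x = c) \<or> (\<exists>d. \<forall>x. norm x = 1 \<longrightarrow> (energy F x)\<^sup>2 - quartic F x = d)"
    using assms(3)
  proof
    assume "energy_density f constant_on usphere"
    then obtain c where c: "\<And>x. x \<in> usphere \<Longrightarrow> energy_density f x = c" unfolding constant_on_def by blast
    have "energy F x = c" if "norm x = 1" for x
      using c[of x] energy_density_eq_energy[OF sph that fF] that by simp
    then show ?thesis by blast
  next
    assume "two_dilation f constant_on usphere"
    then obtain c where c: "\<And>x. x \<in> usphere \<Longrightarrow> two_dilation f x = c" unfolding constant_on_def by blast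
    have "(energy F x)\<^sup>2 - quartic F x = 2 * c\<^sup>2" if "norm x = 1" for x
      using c[of x] two_dilation_power2[OF sph that fF] that by simp
    then show ?thesis by blast
  qed
  obtain l where l: "l > 0" "\<And>p e. norm p = 1 \<Longrightarrow> adapted_basis F p e \<Longrightarrow>
     norm (\<partial> (e 1) F p) = l \<and> norm (\<partial> (e 2) F p) = l"
    using constant_dilation[OF nonconst const] by blast
  interpret conformal_extension F l by unfold_locales (simp_all add: l)
  define p :: "real^4" where "p = axis 1 1"
  have p: "norm p = 1" by (simp add: p_def)
  obtain e where ad: "adapted_basis F p e" using exists_adapted_basis[OF sph p] by blast
  interpret nondegenerate_at F p e by (rule nondegenerate_atI[OF p ad])
  interpret conformal_at F l p e by unfold_locales
  obtain \<phi> \<psi> where "orthogonal_transformation \<phi>" "orthogonal_transformation \<psi>"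
    "\<And>x. norm x = 1 \<Longrightarrow> F x = \<psi> (hopf_map (\<phi> x))"
    using hopf_form by blast
  then show ?thesis
    unfolding hopf_fibration_def
    by (intro exI[of _ \<phi>] exI[of _ \<psi>]) (simp add: sphere_isometry_orthogonal_transformation fF)
qed

end
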